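(* Let the group $G=AB$ be the product of two subgroups $A$ and $B$, each of which is either abelian or has a quasicyclic subgroup of index $2$. Then $G$ is soluble with derived length at most $3$. Moreover, if the subgroup $B$ is non-abelian and $X$ is its quasicyclic subgroup (of index $2$ in $B$), then $AX=XA$ is a metabelian subgroup of index $2$ in $G$.
   Context: Groups are not assumed finite. $G=AB$ means $G=\{ab\mid a\in A,\ b\in B\}$, and $AX=\{ax\mid a\in A,\ x\in X\}$, $XA=\{xa\mid x\in X,\ a\in A\}$. A group is called quasicyclic (or a Prüfer group) if it is an infinite locally cyclic $p$-group for some prime $p$. A group is metabelian if its derived subgroup is abelian.
   Formalization: The claim that AX has index 2 in G is asserted exactly when A∩B is contained in X; otherwise AX=G is proved. As printed it fails, e.g. G=B=X⋊⟨t⟩ with t inverting X and A=⟨t⟩, where AX=G. All other conclusions are unrestricted. *)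

theory Defs
  imports "HOL-Algebra.Solvable_Groups" "HOL-Algebra.Elementary_Groups"
    "HOL-Algebra.Multiplicative_Group" "HOL-Computational_Algebra.Primes"
begin

definition locally_cyclic :: "('a, 'b) monoid_scheme \<Rightarrow> bool" where
  "locally_cyclic G \<longleftrightarrow>
     group G \<and> (\<forall>S. finite S \<and> S \<subseteq> carrier G \<longrightarrow> cyclic_group (subgroup_generated G S))"

text \<open>In the library an element of infinite order has \<open>ord\<close> equal to \<open>0\<close>, which is not a power
  of \<open>p\<close>; so every element of a \<open>p\<close>-group has finite order.\<close>

definition p_group :: "nat \<Rightarrow> ('a, 'b) monoid_scheme \<Rightarrow> bool" where
  "p_group p G \<longleftrightarrow> group G \<and> (\<forall>x\<in>carrier G. \<exists>n. group.ord G x = p ^ n)"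

definition quasicyclic :: "('a, 'b) monoid_scheme \<Rightarrow> bool" where
  "quasicyclic G \<longleftrightarrow>
     infinite (carrier G) \<and> locally_cyclic G \<and> (\<exists>p. Factorial_Ring.prime p \<and> p_group p G)"

text \<open>As a cardinality, this is \<open>0\<close> for a subgroup of infinite index.\<close>

definition subgroup_index :: "('a, 'b) monoid_scheme \<Rightarrow> 'a set \<Rightarrow> nat" where
  "subgroup_index G H = card (rcosets\<^bsub>G\<^esub> H)"

definition quasicyclic_index_two :: "'a set \<Rightarrow> ('a, 'b) monoid_scheme \<Rightarrow> bool" where
  "quasicyclic_index_two H G \<longleftrightarrow>
     subgroup H G \<and> quasicyclic (G\<lparr>carrier := H\<rparr>) \<and> subgroup_index G H = 2"

text \<open>Meaningful for soluble groups only; the value is unspecified otherwise.\<close>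

definition derived_length :: "('a, 'b) monoid_scheme \<Rightarrow> nat" where
  "derived_length G = (LEAST n. (derived G ^^ n) (carrier G) = {\<one>\<^bsub>G\<^esub>})"

definition metabelian :: "('a, 'b) monoid_scheme \<Rightarrow> bool" where
  "metabelian G \<longleftrightarrow> group G \<and> comm_group (G\<lparr>carrier := derived G (carrier G)\<rparr>)"

end

theory Submission
  imports Defs "HOL-Library.Set_Algebras"
begin

text \<open>A nonabelian factor \<open>B\<close> with a quasicyclic subgroup \<open>X\<close> of index two has the form
  \<open>B = X \<union> X b\<close> where \<open>b\<close> inverts \<open>X\<close>: the map \<open>x \<mapsto> x (b x b\<^sup>-\<^sup>1)\<close> is a homomorphism of \<open>X\<close> into
  the centralizer of \<open>b\<close> in \<open>X\<close>, which is finite, and a quasicyclic group has no nontrivial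
  finite image. Put \<open>T = X b\<close>; every element of \<open>T\<close> inverts \<open>X\<close> and has the same square \<open>z\<close>,
  with \<open>z\<^sup>2 = 1\<close>. The core of the proof is the inclusion \<open>X A \<subseteq> A X\<close>
  (\<open>permutes_inverted_extension\<close>). It makes \<open>A X\<close> a subgroup, and \<open>G\<close> is the union of \<open>A X\<close> and
  \<open>A X b\<close>.\<close>

text \<open>If \<open>A\<close> meets \<open>T\<close>, then \<open>A X\<close> is all of \<open>G\<close>. Otherwise \<open>G\<close> is the disjoint union of \<open>A X\<close>
  and \<open>A T\<close>, and the key lemma \<open>permutes_if_almost_stabilized\<close> compares these halves up to
  finitely many cosets of \<open>A\<close>. The elements \<open>g\<close> for which \<open>A X\<close> and \<open>A X g\<close> differ in only
  finitely many cosets of \<open>A\<close> form a subgroup \<open>S\<close> that contains \<open>X\<close>, is normalized by \<open>B\<close> and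
  misses \<open>T\<close>. Let \<open>I\<close> be the normal set of all conjugates of elements of \<open>T\<close>, and let \<open>z\<close> be
  central. If \<open>I \<inter> A X \<subseteq> S\<close>, then \<open>S \<subseteq> A X\<close> and \<open>I \<subseteq> S \<union> S b\<close>; each element of a conjugate of
  \<open>X\<close> is the square of a product of two elements of \<open>I\<close>, so it lies in \<open>S \<subseteq> A X\<close>, which gives
  \<open>X A \<subseteq> A X\<close>.\<close>

text \<open>For abelian \<open>A\<close> and central \<open>z\<close>, a conjugate \<open>y \<sigma> y\<^sup>-\<^sup>1 = c t\<close> with \<open>c \<in> A\<close>, \<open>t \<in> T\<close>
  forces \<open>t\<close> to invert \<open>c\<close>, and then \<open>t\<close> commensurates \<open>A\<close>; either this happens for finitely
  many \<open>y \<in> X\<close>, or \<open>X\<close> itself commensurates \<open>A\<close> and a direct argument applies. For arbitrary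
  \<open>z\<close>, the conjugates of \<open>z\<close> lie in \<open>A X\<close>, and one factors out the normal subgroup that they
  generate (\<open>permutes_abelian\<close>). If \<open>A = Y \<union> Y a0\<close> is nonabelian too and \<open>z\<close> or \<open>a0\<^sup>2\<close> is
  central, normalizers of finite subgroups of \<open>Y\<close> play the part of the commensurator; if neither
  is central, they commute with each other, and the normal closure of \<open>z\<close> is used again
  (\<open>permutes_nonabelian\<close>).\<close>

text \<open>For the structure of \<open>A X\<close>: if \<open>A\<close> is abelian, \<open>A X\<close> is metabelian by Ito's theorem.
  Otherwise \<open>X Y\<close> is a subgroup of index at most two in \<open>A X\<close>, and it is abelian since a product
  of two quasicyclic groups is always abelian (\<open>pruefer_product_commute\<close>). As \<open>A X\<close> has index at
  most two in \<open>G\<close>, it contains the derived subgroup of \<open>G\<close>, and so the derived length is at most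
  three. If both factors are abelian, Ito's theorem applies to \<open>G\<close> directly.\<close>

text \<open>All of this is carried out in a type class of groups, where products need no membership
  conditions. The given group enters that class through its regular permutation representation.\<close>

section \<open>Groups as a type class\<close>

class grp = monoid_mult + inverse +
  assumes grp_left_inverse [simp]: "inverse a * a = 1"
    and grp_divide: "a / b = a * inverse b"
begin

lemma inv_mult_cancel [simp]: "inverse a * (a * b) = b"
  by (metis grp_left_inverse mult_assoc mult_1_left)

lemma grp_left_cancel: "a * b = a * c \<longleftrightarrow> b = c"
  by (metis inv_mult_cancel)

lemma grp_right_inverse [simp]: "a * inverse a = 1"
  by (metis grp_left_inverse inv_mult_cancel mult_1_right)

lemma mult_inv_cancel [simp]: "a * (inverse a * b) = b"
  by (metis grp_right_inverse mult_assoc mult_1_left)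

lemma grp_right_cancel: "b * a = c * a \<longleftrightarrow> b = c"
  by (metis grp_right_inverse mult_assoc mult_1_right)

lemma grp_inverse_unique: "a * b = 1 \<Longrightarrow> inverse a = b"
  by (metis grp_right_inverse grp_left_cancel)

lemma grp_inverse_inverse [simp]: "inverse (inverse a) = a"
  by (rule grp_inverse_unique) simp

lemma grp_inverse_one [simp]: "inverse 1 = 1"
  by (rule grp_inverse_unique) simp

lemma grp_inverse_mult: "inverse (a * b) = inverse b * inverse a"
  by (rule grp_inverse_unique) (metis mult_assoc mult_inv_cancel grp_right_inverse)

end

lemmas grp_simps = mult.assoc grp_inverse_mult grp_left_cancel

lemma grp_inverse_power: "inverse (a ^ n) = inverse a ^ n" for a :: "'a::grp"
  by (induction n) (simp_all add: grp_inverse_mult power_commutes)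

lemma conj_power: "(g * x * inverse g) ^ n = g * x ^ n * inverse g" for g :: "'a::grp"
  by (induction n) (simp_all add: grp_simps)

definition subgrp :: "'a::grp set \<Rightarrow> bool" where
  "subgrp H \<longleftrightarrow> 1 \<in> H \<and> (\<forall>x\<in>H. \<forall>y\<in>H. x * y \<in> H) \<and> (\<forall>x\<in>H. inverse x \<in> H)"

lemma subgrp_one: "subgrp H \<Longrightarrow> 1 \<in> H"
  and subgrp_mult: "subgrp H \<Longrightarrow> x \<in> H \<Longrightarrow> y \<in> H \<Longrightarrow> x * y \<in> H"
  and subgrp_inverse: "subgrp H \<Longrightarrow> x \<in> H \<Longrightarrow> inverse x \<in> H"
  by (auto simp: subgrp_def)

lemma subgrp_inverse_iff: "subgrp H \<Longrightarrow> inverse x \<in> H \<longleftrightarrow> x \<in> H"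
  by (metis subgrp_inverse grp_inverse_inverse)

lemma subgrp_power: "subgrp H \<Longrightarrow> x \<in> H \<Longrightarrow> x ^ n \<in> H"
  by (induction n) (auto simp: subgrp_def)

lemma subgrp_mult_left_iff: "subgrp H \<Longrightarrow> x \<in> H \<Longrightarrow> x * y \<in> H \<longleftrightarrow> y \<in> H"
  by (metis subgrp_mult subgrp_inverse inv_mult_cancel)

lemma subgrp_mult_right_iff: "subgrp H \<Longrightarrow> x \<in> H \<Longrightarrow> y * x \<in> H \<longleftrightarrow> y \<in> H"
  using subgrp_mult[of H "y * x" "inverse x"] subgrp_mult[of H y x] subgrp_inverse[of H x]
  by (auto simp: mult.assoc)

lemma subgrp_Int: "subgrp H \<Longrightarrow> subgrp K \<Longrightarrow> subgrp (H \<inter> K)"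
  by (auto simp: subgrp_def)

lemma subgrp_conj: "subgrp H \<Longrightarrow> subgrp ((\<lambda>x. g * x * inverse g) ` H)"
  unfolding subgrp_def image_iff Ball_def
  apply (intro conjI allI impI)
    apply (rule bexI[of _ 1]; simp)
   apply (elim conjE bexE)
   subgoal for x y u v by (rule bexI[of _ "u * v"]) (auto simp: grp_simps)
  apply (elim conjE bexE)
  subgoal for x u by (rule bexI[of _ "inverse u"]) (auto simp: grp_simps)
  done

definition commuting :: "'a::grp set \<Rightarrow> bool" where
  "commuting H \<longleftrightarrow> (\<forall>x\<in>H. \<forall>y\<in>H. x * y = y * x)"

lemma commutingD: "commuting H \<Longrightarrow> x \<in> H \<Longrightarrow> y \<in> H \<Longrightarrow> x * y = y * x"
  by (auto simp: commuting_def)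

definition centralizer :: "'a::grp set \<Rightarrow> 'a set" where
  "centralizer S = {g. \<forall>s\<in>S. g * s = s * g}"

lemma commute_inverse:
  assumes "g * s = s * g" shows "inverse g * s = s * inverse (g::'a::grp)"
proof -
  have "inverse g * (s * g) * inverse g = inverse g * (g * s) * inverse g" using assms by simp
  thus ?thesis by (simp add: grp_simps)
qed

lemma commute_power: "a * b = b * a \<Longrightarrow> a * b ^ k = b ^ k * (a::'a::grp)"
  by (metis power_commuting_commutes)

lemma subgrp_centralizer: "subgrp (centralizer S)"
  unfolding subgrp_def centralizer_def
  by (auto simp: commute_inverse) (metis mult.assoc)

lemma commuting_power:
  assumes "commuting H" "x \<in> H" "y \<in> H"
  shows "(x * y) ^ n = x ^ n * (y::'a::grp) ^ n"
proof (induction n)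
  case (Suc n)
  have "x ^ n * y = y * x ^ n" by (rule power_commuting_commutes) (rule commutingD[OF assms])
  thus ?case using Suc by (simp add: mult.assoc) (metis mult.assoc)
qed simp

subsection \<open>Subgroup generated by a set\<close>

text \<open>Generators are multiplied on the left, so that an induction peels off one generator at a
  time.\<close>
inductive_set gen :: "'a::grp set \<Rightarrow> 'a set" for S where
  gen_one: "1 \<in> gen S"
| gen_mult: "x \<in> S \<Longrightarrow> y \<in> gen S \<Longrightarrow> x * y \<in> gen S"
| gen_inv: "x \<in> S \<Longrightarrow> y \<in> gen S \<Longrightarrow> inverse x * y \<in> gen S"

lemma gen_incl: "x \<in> S \<Longrightarrow> x \<in> gen S"
  using gen_mult[OF _ gen_one] by simp

lemma gen_closed: "x \<in> gen S \<Longrightarrow> y \<in> gen S \<Longrightarrow> x * y \<in> gen S"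
  by (induction rule: gen.induct) (auto simp: mult.assoc intro: gen.intros)

lemma gen_inverse: "x \<in> gen S \<Longrightarrow> inverse x \<in> gen S"
proof (induction rule: gen.induct)
  case (gen_mult x y)
  thus ?case using gen_closed[OF gen_mult(3) gen_inv[OF gen_mult(1) gen_one]] by (simp add: grp_inverse_mult)
next
  case (gen_inv x y)
  thus ?case using gen_closed[OF gen_inv(3) gen_incl[OF gen_inv(1)]] by (simp add: grp_inverse_mult)
qed (simp add: gen_one)

lemma subgrp_gen: "subgrp (gen S)"
  by (simp add: subgrp_def gen_one gen_closed gen_inverse)

lemma gen_least: "subgrp H \<Longrightarrow> S \<subseteq> H \<Longrightarrow> gen S \<subseteq> H"
proof
  fix x assume H: "subgrp H" "S \<subseteq> H" "x \<in> gen S"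
  from H(3) show "x \<in> H"
    by induction (use H in \<open>auto intro: subgrp_one subgrp_mult subgrp_inverse\<close>)
qed

lemma gen_conj:
  assumes "\<And>s. s \<in> S \<Longrightarrow> g * s * inverse g \<in> gen S" "x \<in> gen S"
  shows "g * x * inverse g \<in> gen (S::'a::grp set)"
  using assms(2)
proof induction
  case (gen_mult x y)
  have "g * (x * y) * inverse g = (g * x * inverse g) * (g * y * inverse g)" by (simp add: grp_simps)
  thus ?case using gen_mult assms(1) gen_closed by metis
next
  case (gen_inv x y)
  have "g * (inverse x * y) * inverse g = inverse (g * x * inverse g) * (g * y * inverse g)" by (simp add: grp_simps)
  thus ?case using gen_inv assms(1) gen_closed gen_inverse by metis
qed (simp add: gen_one)

text \<open>The centralizer of \<open>S\<close> is a subgroup containing \<open>S\<close>, so it contains \<open>gen S\<close>; repeating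
  this with \<open>gen S\<close> in place of one copy of \<open>S\<close> gives the claim.\<close>
lemma commuting_gen:
  assumes "commuting S" shows "commuting (gen S)"
proof -
  have "S \<subseteq> centralizer S" using assms by (auto simp: commuting_def centralizer_def)
  hence "gen S \<subseteq> centralizer S" by (rule gen_least[OF subgrp_centralizer])
  hence "S \<subseteq> centralizer (gen S)" by (auto simp: centralizer_def)
  hence "gen S \<subseteq> centralizer (gen S)" by (rule gen_least[OF subgrp_centralizer])
  thus ?thesis by (auto simp: commuting_def centralizer_def)
qed

section \<open>Coverings by finitely many cosets\<close>

lemma mem_times: "x \<in> A * B \<longleftrightarrow> (\<exists>a\<in>A. \<exists>b\<in>B. x = a * b)"
  by (auto simp: set_times_def)

text \<open>For a subgroup \<open>H\<close> this says that \<open>W\<close> is covered by finitely many right cosets of \<open>H\<close>; if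
  \<open>W\<close> is a subgroup as well, it says that \<open>H \<inter> W\<close> has finite index in \<open>W\<close>. No index is ever
  computed, so only this finiteness is recorded.\<close>
definition fcov :: "'a::grp set \<Rightarrow> 'a set \<Rightarrow> bool" where
  "fcov H W \<longleftrightarrow> (\<exists>F. finite F \<and> W \<subseteq> H * F)"

lemma fcovI: "finite F \<Longrightarrow> (\<And>w. w \<in> W \<Longrightarrow> \<exists>h\<in>H. \<exists>f\<in>F. w = h * f) \<Longrightarrow> fcov H W"
  unfolding fcov_def by (rule exI[of _ F]) (auto simp: mem_times)

lemma fcovE:
  assumes "fcov H W"
  obtains F where "finite F" "\<And>w. w \<in> W \<Longrightarrow> \<exists>h\<in>H. \<exists>f\<in>F. w = h * f"
  using assms unfolding fcov_def by (auto simp: mem_times subset_eq)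

lemma fcov_subset: "fcov H W \<Longrightarrow> V \<subseteq> W \<Longrightarrow> fcov H V"
  unfolding fcov_def by blast

lemma fcov_refl: "W \<subseteq> H \<Longrightarrow> fcov H W"
  by (rule fcovI[of "{1}"]) auto

lemma fcov_finite: "finite W \<Longrightarrow> 1 \<in> H \<Longrightarrow> fcov H W"
  by (rule fcovI[of W]) force+

lemma fcov_imp_finite: "fcov H W \<Longrightarrow> finite H \<Longrightarrow> finite W"
  unfolding fcov_def using finite_set_times finite_subset by blast

lemma fcov_Un:
  assumes "fcov H V" "fcov H W" shows "fcov H (V \<union> W)"
proof -
  obtain F1 F2 where "finite F1" "finite F2" "V \<subseteq> H * F1" "W \<subseteq> H * F2"
    using assms by (auto simp: fcov_def)
  thus ?thesis by (intro fcovI[of "F1 \<union> F2"]) (auto simp: mem_times subset_eq, blast+)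
qed

lemma fcov_translate:
  assumes "fcov H W" "\<And>v. v \<in> V \<Longrightarrow> v * g \<in> W"
  shows "fcov H V"
proof -
  obtain F where F: "finite F" "W \<subseteq> H * F"
    using assms by (auto simp: fcov_def)
  show ?thesis
  proof (rule fcovI[of "(\<lambda>f. f * inverse g) ` F"])
    fix v assume "v \<in> V"
    then obtain h f where "h \<in> H" "f \<in> F" "v * g = h * f"
      using assms(2) F(2) by (meson mem_times subsetD)
    moreover have "v = (v * g) * inverse g" by (simp add: grp_simps)
    ultimately show "\<exists>h\<in>H. \<exists>f\<in>(\<lambda>f. f * inverse g) ` F. v = h * f"
      by (auto simp: mult.assoc)
  qed (use F in auto)
qed

lemma fcov_trans:
  assumes "fcov H V" "fcov V W" shows "fcov H W"
proof -
  obtain F1 F2 where F: "finite F1" "finite F2" "V \<subseteq> H * F1" "W \<subseteq> V * F2"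
    using assms by (auto simp: fcov_def)
  hence "W \<subseteq> H * (F1 * F2)"
    using set_times_mono2[OF F(3) order_refl[of F2]] by (simp add: mult.assoc)
  moreover have "finite (F1 * F2)" using F finite_set_times by blast
  ultimately show ?thesis by (auto simp: fcov_def)
qed

text \<open>Elements of \<open>W\<close> in the same coset of \<open>V1\<close> and in the same coset of \<open>V2\<close> lie in the same
  coset of \<open>V1 \<inter> V2\<close>, and there are finitely many pairs of cosets.\<close>
lemma fcov_Int:
  assumes "subgrp V1" "subgrp V2" "fcov V1 W" "fcov V2 W"
  shows "fcov (V1 \<inter> V2) W"
proof -
  obtain F1 where F1: "finite F1" "\<And>w. w \<in> W \<Longrightarrow> \<exists>h\<in>V1. \<exists>f\<in>F1. w = h * f"
    using assms(3) by (rule fcovE) blast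
  obtain F2 where F2: "finite F2" "\<And>w. w \<in> W \<Longrightarrow> \<exists>h\<in>V2. \<exists>f\<in>F2. w = h * f"
    using assms(4) by (rule fcovE) blast
  define rep where "rep f = (SOME w. w \<in> W \<and> (\<exists>h\<in>V1. w = h * fst f) \<and> (\<exists>h\<in>V2. w = h * snd f))" for f
  show ?thesis
  proof (rule fcovI[of "rep ` (F1 \<times> F2)"])
    fix w assume w: "w \<in> W"
    obtain h1 f1 h2 f2 where h: "h1 \<in> V1" "f1 \<in> F1" "w = h1 * f1" "h2 \<in> V2" "f2 \<in> F2" "w = h2 * f2"
      using F1(2)[OF w] F2(2)[OF w] by blast
    let ?r = "rep (f1, f2)"
    have "?r \<in> W \<and> (\<exists>h\<in>V1. ?r = h * f1) \<and> (\<exists>h\<in>V2. ?r = h * f2)"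
      unfolding rep_def fst_conv snd_conv
      by (rule someI[of _ w]) (use w h in blast)
    then obtain k1 k2 where k: "k1 \<in> V1" "?r = k1 * f1" "k2 \<in> V2" "?r = k2 * f2" by blast
    have "w * inverse ?r = h1 * inverse k1" using h k by (simp add: grp_simps)
    moreover have "w * inverse ?r = h2 * inverse k2"
      unfolding k(4) h(6) by (simp add: grp_simps)
    ultimately have "w * inverse ?r \<in> V1 \<inter> V2"
      using assms(1,2) h k by (metis IntI subgrp_mult subgrp_inverse)
    moreover have "w = (w * inverse ?r) * ?r" by (simp add: grp_simps)
    ultimately show "\<exists>h\<in>V1 \<inter> V2. \<exists>f\<in>rep ` (F1 \<times> F2). w = h * f"
      using h by blast
  qed (use F1 F2 in auto)
qed

lemma fcov_INT:
  assumes "finite I" "\<And>i. i \<in> I \<Longrightarrow> subgrp (V i)" "\<And>i. i \<in> I \<Longrightarrow> fcov (V i) W"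
  shows "fcov (\<Inter>i\<in>I. V i) W \<and> subgrp (\<Inter>i\<in>I. V i)"
  using assms
proof (induction I rule: finite_induct)
  case empty
  show ?case by (auto simp: subgrp_def intro: fcov_refl)
next
  case (insert i I)
  thus ?case using fcov_Int[of "V i" "\<Inter>i\<in>I. V i"] subgrp_Int[of "V i" "\<Inter>i\<in>I. V i"]
    by simp
qed

lemma fcov_conj:
  assumes "fcov H W"
  shows "fcov ((\<lambda>x. g * x * inverse g) ` H) ((\<lambda>x. g * x * inverse g) ` W)"
proof -
  obtain F where F: "finite F" "W \<subseteq> H * F"
    using assms by (auto simp: fcov_def)
  show ?thesis
  proof (rule fcovI[of "(\<lambda>x. g * x * inverse g) ` F"])
    fix v assume "v \<in> (\<lambda>x. g * x * inverse g) ` W"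
    then obtain h f where "h \<in> H" "f \<in> F" "v = g * (h * f) * inverse g"
      using F(2) by (auto simp: mem_times subset_eq)
    moreover have "g * (h * f) * inverse g = (g * h * inverse g) * (g * f * inverse g)" by (simp add: grp_simps)
    ultimately show "\<exists>h\<in>(\<lambda>x. g * x * inverse g) ` H. \<exists>f\<in>(\<lambda>x. g * x * inverse g) ` F. v = h * f" by blast
  qed (use F in auto)
qed

text \<open>One chosen point in each of the finitely many fibres of \<open>f\<close> represents a coset.\<close>
lemma fcov_fibres:
  assumes "finite (f ` W)" "\<And>v w. v \<in> W \<Longrightarrow> w \<in> W \<Longrightarrow> f v = f w \<Longrightarrow> v * inverse w \<in> H"
  shows "fcov H W"
proof (rule fcovI[of "(\<lambda>y. SOME w. w \<in> W \<and> f w = y) ` f ` W"])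
  fix w assume w: "w \<in> W"
  let ?r = "SOME v. v \<in> W \<and> f v = f w"
  have r: "?r \<in> W \<and> f ?r = f w" by (rule someI[of _ w]) (use w in auto)
  have "w * inverse ?r \<in> H" using assms(2) w r by metis
  moreover have "w = (w * inverse ?r) * ?r" by (simp add: grp_simps)
  ultimately show "\<exists>h\<in>H. \<exists>g\<in>(\<lambda>y. SOME w. w \<in> W \<and> f w = y) ` f ` W. w = h * g" using w by blast
qed (use assms in auto)

text \<open>Orbit and stabilizer: a finite conjugacy orbit means a centralizer of finite index.\<close>
lemma fcov_centralizer:
  assumes "subgrp K" "finite ((\<lambda>g. inverse g * s * g) ` K)"
  shows "fcov (centralizer {s}) K"
proof (rule fcov_fibres[OF assms(2)])
  fix v w assume *: "inverse v * s * v = inverse w * s * w"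
  have "v * (inverse v * s * v) * inverse w = v * (inverse w * s * w) * inverse w" using * by simp
  thus "v * inverse w \<in> centralizer {s}" by (simp add: centralizer_def grp_simps)
qed

context
  fixes f :: "'a::grp \<Rightarrow> 'b::grp" and X :: "'a set"
  assumes X: "subgrp X" and hom: "\<And>x y. x \<in> X \<Longrightarrow> y \<in> X \<Longrightarrow> f (x * y) = f x * f y"
begin

lemma hom_one: "f 1 = 1"
proof -
  have "f 1 * f 1 = f 1 * 1" using hom[of 1 1] subgrp_one[OF X] by simp
  thus ?thesis using grp_left_cancel by blast
qed

lemma hom_inverse: "y \<in> X \<Longrightarrow> f (inverse y) = inverse (f y)"
  using hom[of y "inverse y"] subgrp_inverse[OF X] hom_one
  by (intro grp_inverse_unique[symmetric]) simp

lemma hom_power: "y \<in> X \<Longrightarrow> f (y ^ n) = f y ^ n"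
  by (induction n) (auto simp: hom_one hom subgrp_power[OF X])

lemma subgrp_hom_image:
  assumes "subgrp H" "H \<subseteq> X" shows "subgrp (f ` H)"
  unfolding subgrp_def
proof (intro conjI ballI)
  show "1 \<in> f ` H" using hom_one subgrp_one[OF assms(1)] by (metis imageI)
next
  fix x y assume "x \<in> f ` H" "y \<in> f ` H"
  thus "x * y \<in> f ` H" using hom assms(2) subgrp_mult[OF assms(1)] by (smt (verit) imageE imageI subsetD)
next
  fix x assume "x \<in> f ` H"
  thus "inverse x \<in> f ` H" using hom_inverse assms(2) subgrp_inverse[OF assms(1)] by (smt (verit) imageE imageI subsetD)
qed

end

section \<open>Pruefer subgroups\<close>

text \<open>In a \<open>p\<close>-group, two elements generate a cyclic subgroup if and only if one of them is a
  power of the other; the last clause is therefore local cyclicity, in a form that needs no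
  generated subgroups.\<close>
definition pruefer :: "nat \<Rightarrow> 'a::grp set \<Rightarrow> bool" where
  "pruefer p X \<longleftrightarrow> subgrp X \<and> infinite X \<and> Factorial_Ring.prime p \<and> (\<forall>x\<in>X. \<exists>n. x ^ p ^ n = 1) \<and>
     (\<forall>x\<in>X. \<forall>y\<in>X. (\<exists>k::nat. x = y ^ k) \<or> (\<exists>k::nat. y = x ^ k))"

lemma finite_powers:
  assumes "x ^ m = (1::'a::grp)" "m > 0" shows "finite {x ^ k | k. True}" "card {x ^ k |k. True} \<le> m"
proof -
  have "{x ^ k | k. True} \<subseteq> (\<lambda>k. x ^ k) ` {..<m}"
  proof clarify
    fix k
    have "x ^ k = x ^ (m * (k div m) + k mod m)" by simp
    also have "\<dots> = x ^ (k mod m)" unfolding power_add power_mult assms(1) by simp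
    finally show "x ^ k \<in> (\<lambda>k. x ^ k) ` {..<m}" using assms by auto
  qed
  moreover have "finite ((\<lambda>k. x ^ k) ` {..<m})" "card ((\<lambda>k. x ^ k) ` {..<m}) \<le> m"
    using card_image_le[of "{..<m}" "\<lambda>k. x ^ k"] by auto
  ultimately have "finite {x ^ k | k. True} \<and> card {x ^ k |k. True} \<le> m"
    by (meson finite_subset card_mono le_trans)
  thus "finite {x ^ k | k. True}" "card {x ^ k |k. True} \<le> m" by auto
qed

lemma inverse_as_power:
  assumes "x ^ m = (1::'a::grp)" "m > 0" shows "inverse x = x ^ (m - 1)"
  using assms by (intro grp_inverse_unique) (simp flip: power_Suc)

context
  fixes p :: nat and X :: "'a::grp set"
  assumes X: "pruefer p X"
begin

lemma pruefer_subgrp: "subgrp X" and pruefer_infinite: "infinite X"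
  and pruefer_prime: "Factorial_Ring.prime p"
  and pruefer_chain: "x \<in> X \<Longrightarrow> y \<in> X \<Longrightarrow> (\<exists>k::nat. x = y ^ k) \<or> (\<exists>k::nat. y = x ^ k)"
  using X by (auto simp: pruefer_def)

lemma pruefer_torsion:
  assumes "x \<in> X" obtains n where "x ^ p ^ n = 1" "p ^ n > 0"
  using X assms pruefer_prime prime_gt_0_nat that unfolding pruefer_def by (metis zero_less_power)

lemma pruefer_commuting: "commuting X"
  unfolding commuting_def
proof (intro ballI)
  fix x y assume "x \<in> X" "y \<in> X"
  from pruefer_chain[OF this] show "x * y = y * x" by (auto simp: power_commutes)
qed

text \<open>An element \<open>g\<close> outside \<open>H\<close> is not a power of an element of \<open>H\<close>, hence every element of \<open>H\<close>
  is one of the finitely many powers of \<open>g\<close>.\<close>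
lemma pruefer_subgroup:
  assumes "subgrp H" "H \<subseteq> X" "H \<noteq> X" shows "finite H"
proof -
  obtain g where g: "g \<in> X" "g \<notin> H" using assms by blast
  have "H \<subseteq> {g ^ k |k. True}"
  proof
    fix h assume h: "h \<in> H"
    hence "\<not> (\<exists>k. g = h ^ k)" using subgrp_power[OF assms(1)] g by blast
    thus "h \<in> {g ^ k |k. True}" using pruefer_chain[of g h] g h assms(2) by auto
  qed
  thus ?thesis using finite_powers pruefer_torsion[OF g(1)] finite_subset by metis
qed

text \<open>A Pruefer group has no proper subgroup of finite index, because its proper subgroups are
  finite. This lets statements about subgroups of finite index be sharpened to statements about
  all of \<open>X\<close>.\<close>
lemma pruefer_fcov:
  assumes "subgrp H" "fcov H X" shows "X \<subseteq> H"
proof (rule ccontr)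
  assume n: "\<not> X \<subseteq> H"
  have fin: "finite (H \<inter> X)"
    by (rule pruefer_subgroup) (use n assms subgrp_Int pruefer_subgrp in auto)
  have "fcov (H \<inter> X) X"
    by (rule fcov_Int[OF assms(1) pruefer_subgrp assms(2)]) (simp add: fcov_refl)
  thus False using fcov_imp_finite fin pruefer_infinite by blast
qed

lemma pruefer_fibres:
  assumes "finite (f ` X)" "subgrp H" "\<And>v w. v \<in> X \<Longrightarrow> w \<in> X \<Longrightarrow> f v = f w \<Longrightarrow> v * inverse w \<in> H"
  shows "X \<subseteq> H"
  using pruefer_fcov[OF assms(2) fcov_fibres[OF assms(1)]] assms(3) by blast

lemma pruefer_finite_orbit:
  assumes "finite ((\<lambda>g. inverse g * s * g) ` X)" "x \<in> X"
  shows "x * s = s * x"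
  using pruefer_fcov[OF subgrp_centralizer fcov_centralizer[OF pruefer_subgrp assms(1)]] assms(2)
  by (auto simp: centralizer_def)

text \<open>The centralizer of a point of a finite orbit has finite index in \<open>X\<close>, so it is all of
  \<open>X\<close>.\<close>
lemma pruefer_acts_trivially:
  assumes "finite N" "s \<in> N" "\<And>x s. x \<in> X \<Longrightarrow> s \<in> N \<Longrightarrow> x * s * inverse x \<in> N" "x \<in> X"
  shows "x * s = s * x"
proof (rule pruefer_finite_orbit[OF _ assms(4)])
  have "(\<lambda>g. inverse g * s * g) ` X \<subseteq> N"
  proof clarify
    fix g assume "g \<in> X"
    thus "inverse g * s * g \<in> N" using assms(3)[of "inverse g" s] assms(2) subgrp_inverse[OF pruefer_subgrp] by simp
  qed
  thus "finite ((\<lambda>g. inverse g * s * g) ` X)" using assms(1) finite_subset by blast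
qed

text \<open>The kernel has finite index.\<close>
lemma pruefer_hom_finite:
  assumes "\<And>x y. x \<in> X \<Longrightarrow> y \<in> X \<Longrightarrow> f (x * y) = f x * f y" "finite (f ` X)" "x \<in> X"
  shows "f x = (1 :: 'b::grp)"
proof -
  note h = pruefer_subgrp assms(1)
  have "X \<subseteq> {x\<in>X. f x = 1}"
  proof (rule pruefer_fibres[OF assms(2)])
    show "subgrp {x \<in> X. f x = 1}"
      using hom_one[OF h] hom_inverse[OF h] assms(1) pruefer_subgrp by (auto simp: subgrp_def)
    fix v w assume vw: "v \<in> X" "w \<in> X" "f v = f w"
    hence "f (v * inverse w) = f w * inverse (f w)"
      using hom_inverse[OF h] assms(1) subgrp_inverse[OF pruefer_subgrp] by simp
    thus "v * inverse w \<in> {x \<in> X. f x = 1}" using vw pruefer_subgrp by (simp add: subgrp_def)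
  qed
  thus ?thesis using assms by blast
qed

lemma pruefer_locally_cyclic:
  assumes "finite F" "F \<subseteq> X" shows "\<exists>g\<in>X. \<forall>x\<in>F. \<exists>k::nat. x = g ^ k"
  using assms
proof (induction F rule: finite_induct)
  case empty
  thus ?case using pruefer_infinite by (metis ex_in_conv finite.emptyI)
next
  case (insert y F)
  then obtain g where g: "g \<in> X" "\<forall>x\<in>F. \<exists>k::nat. x = g ^ k" by auto
  from pruefer_chain[of g y] g insert consider (a) k where "g = y ^ k" | (b) k where "y = g ^ k" by auto
  thus ?case
  proof cases
    case (a k)
    hence "\<forall>x\<in>F. \<exists>k::nat. x = y ^ k" using g(2) by (metis power_mult)
    thus ?thesis using insert by (metis insert_iff insert_subset power_one_right)
  next
    case b
    thus ?thesis using g by auto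
  qed
qed

text \<open>If all of \<open>X\<close> had exponent \<open>n\<close>, then \<open>n + 1\<close> elements of \<open>X\<close> would lie in one cyclic group
  of order at most \<open>n\<close>.\<close>
lemma pruefer_bounded:
  assumes "n > 0" shows "finite {x\<in>X. x ^ n = 1}"
proof (rule pruefer_subgroup)
  show "subgrp {x\<in>X. x ^ n = 1}"
    using pruefer_subgrp commuting_power[OF pruefer_commuting]
    by (auto simp: subgrp_def simp flip: grp_inverse_power)
  show "{x\<in>X. x ^ n = 1} \<noteq> X"
  proof
    assume E: "{x\<in>X. x ^ n = 1} = X"
    obtain F where F: "F \<subseteq> X" "finite F" "card F = Suc n" using infinite_arbitrarily_large[OF pruefer_infinite] by metis
    obtain g where g: "g \<in> X" "\<forall>x\<in>F. \<exists>k::nat. x = g ^ k" using pruefer_locally_cyclic F by blast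
    have fin: "finite {g ^ k |k. True}" "card {g ^ k |k. True} \<le> n" using finite_powers[of g n] g E assms by blast+
    have "F \<subseteq> {g ^ k |k. True}" using g by blast
    hence "card F \<le> card {g ^ k |k. True}" by (rule card_mono[OF fin(1)])
    hence "card F \<le> n" using fin(2) by linarith
    thus False using F by simp
  qed
qed auto

text \<open>The \<open>n\<close>-th power map has a finite kernel, so its image is an infinite subgroup.\<close>
lemma pruefer_divisible:
  assumes "n > 0" "x \<in> X" obtains y where "y \<in> X" "y ^ n = x"
proof -
  have sub: "subgrp ((\<lambda>y. y ^ n) ` X)"
    unfolding subgrp_def
  proof (intro conjI ballI)
    show "1 \<in> (\<lambda>y. y ^ n) ` X" using subgrp_one[OF pruefer_subgrp] by (auto intro!: image_eqI[of _ _ 1])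
  next
    fix x y assume "x \<in> (\<lambda>y. y ^ n) ` X" "y \<in> (\<lambda>y. y ^ n) ` X"
    then obtain u v where "u \<in> X" "v \<in> X" "x = u ^ n" "y = v ^ n" by blast
    thus "x * y \<in> (\<lambda>y. y ^ n) ` X"
      using commuting_power[OF pruefer_commuting, of u v n] subgrp_mult[OF pruefer_subgrp, of u v]
      by (metis imageI)
  next
    fix x assume "x \<in> (\<lambda>y. y ^ n) ` X"
    thus "inverse x \<in> (\<lambda>y. y ^ n) ` X"
      using subgrp_inverse[OF pruefer_subgrp] by (auto simp: grp_inverse_power)
  qed
  have "(\<lambda>y. y ^ n) ` X = X"
  proof (rule ccontr)
    assume "(\<lambda>y. y ^ n) ` X \<noteq> X"
    hence fin: "finite ((\<lambda>y. y ^ n) ` X)"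
      by (intro pruefer_subgroup[OF sub]) (auto intro: subgrp_power pruefer_subgrp)
    have "fcov {x\<in>X. x ^ n = 1} X"
    proof (rule fcov_fibres[OF fin])
      fix v w assume "v \<in> X" "w \<in> X" "v ^ n = w ^ n"
      thus "v * inverse w \<in> {x \<in> X. x ^ n = 1}"
        using pruefer_subgrp commuting_power[OF pruefer_commuting, of v "inverse w" n]
        by (simp add: subgrp_def flip: grp_inverse_power)
    qed
    thus False using fcov_imp_finite pruefer_bounded[OF assms(1)] pruefer_infinite by blast
  qed
  thus ?thesis using assms that by (metis (no_types, lifting) imageE)
qed

lemma pruefer_hom_image:
  assumes "\<And>x y. x \<in> X \<Longrightarrow> y \<in> X \<Longrightarrow> f (x * y) = f x * f y" "infinite (f ` X)"
  shows "pruefer p (f ` X :: 'b::grp set)"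
proof -
  note h = pruefer_subgrp assms(1)
  have "\<exists>n. f x ^ p ^ n = 1" if "x \<in> X" for x
    using pruefer_torsion[OF that] by (metis hom_power[OF h that] hom_one[OF h])
  moreover have "(\<exists>k::nat. f x = f y ^ k) \<or> (\<exists>k::nat. f y = f x ^ k)" if "x \<in> X" "y \<in> X" for x y
    using pruefer_chain[OF that] by (metis hom_power[OF h] that)
  ultimately show ?thesis using subgrp_hom_image[OF h pruefer_subgrp order_refl] assms(2) pruefer_prime
    by (auto simp: pruefer_def)
qed

end

section \<open>Factorised groups with an inverted Pruefer subgroup\<close>

text \<open>The second factor is \<open>B = X \<union> X b\<close>, and the aim is \<open>X * A \<subseteq> A * X\<close>. That \<open>A\<close> misses \<open>X b\<close>
  is what makes \<open>A X\<close> and \<open>A X b\<close> disjoint; without it these sets coincide and the aim is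
  trivial. The set \<open>G\<close> is fixed because the ambient type need not be the product.\<close>
locale inverted_factor =
  fixes p :: nat and A X :: "'a::grp set" and b :: 'a and G :: "'a set"
  assumes A: "subgrp A" and X: "pruefer p X"
    and b_inverts: "x \<in> X \<Longrightarrow> b * x * inverse b = inverse x"
    and b_square: "b * b \<in> X"
    and G: "subgrp G" and AG: "A \<subseteq> G" and XG: "X \<subseteq> G" and bG: "b \<in> G"
    and G_cover: "G \<subseteq> A * (X \<union> (\<lambda>x. x * b) ` X)"
    and A_disjoint: "A \<inter> (\<lambda>x. x * b) ` X = {}"
begin

definition T where "T = (\<lambda>x. x * b) ` X"
definition z where "z = b * b"

lemmas Xs = pruefer_subgrp[OF X]
lemmas X_mult = subgrp_mult[OF Xs] and X_inverse = subgrp_inverse[OF Xs] and X_one = subgrp_one[OF Xs]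
lemmas A_mult = subgrp_mult[OF A] and A_inverse = subgrp_inverse[OF A] and A_one = subgrp_one[OF A]
lemmas G_mult = subgrp_mult[OF G] and G_inverse = subgrp_inverse[OF G] and G_one = subgrp_one[OF G]

lemma X_comm: "x \<in> X \<Longrightarrow> y \<in> X \<Longrightarrow> x * y = y * x"
  using commutingD[OF pruefer_commuting[OF X]] .

lemma A_in_G: "a \<in> A \<Longrightarrow> a \<in> G" using AG by blast
lemma X_in_G: "x \<in> X \<Longrightarrow> x \<in> G" using XG by blast

lemma b_x: "x \<in> X \<Longrightarrow> b * x = inverse x * b"
  using b_inverts[of x] by (metis grp_right_inverse mult.assoc mult.right_neutral grp_left_inverse)

lemma TE: assumes "t \<in> T" obtains x where "x \<in> X" "t = x * b" using assms by (auto simp: T_def)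
lemma TI: "x \<in> X \<Longrightarrow> x * b \<in> T" by (auto simp: T_def)
lemma b_in_T: "b \<in> T" using TI[OF X_one] by simp
lemma T_in_G: "t \<in> T \<Longrightarrow> t \<in> G" using X_in_G bG G_mult by (auto simp: T_def)

lemma t_x: assumes "t \<in> T" "x \<in> X" shows "t * x = inverse x * t"
proof -
  obtain y where y: "y \<in> X" "t = y * b" using assms TE by blast
  have "t * x = y * inverse x * b" using y b_x[OF assms(2)] by (simp add: mult.assoc)
  also have "\<dots> = inverse x * t" using y X_comm[of y "inverse x"] X_inverse assms by (simp add: mult.assoc[symmetric])
  finally show ?thesis .
qed

lemma t_inverts: "t \<in> T \<Longrightarrow> x \<in> X \<Longrightarrow> t * x * inverse t = inverse x"
  using t_x by (simp add: mult.assoc)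

lemma XT: "x \<in> X \<Longrightarrow> t \<in> T \<Longrightarrow> x * t \<in> T"
  using X_mult by (auto simp: T_def mult.assoc[symmetric])
lemma TX: "x \<in> X \<Longrightarrow> t \<in> T \<Longrightarrow> t * x \<in> T"
  using XT X_inverse t_x by metis

lemma t_square: assumes "t \<in> T" shows "t * t = z"
proof -
  obtain y where y: "y \<in> X" "t = y * b" using assms TE by blast
  have "t * t = y * (b * y) * b" using y by (simp add: mult.assoc)
  also have "\<dots> = z" using b_x[OF y(1)] by (simp add: z_def mult.assoc)
  finally show ?thesis .
qed

lemma z_X: "z \<in> X" using b_square by (simp add: z_def)

lemma t_z: "t \<in> T \<Longrightarrow> t * z = z * t" using t_square by (metis mult.assoc)

lemma z_z: "z * z = 1"
proof -
  have "b * z = inverse z * b" by (rule b_x[OF z_X])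
  moreover have "b * z = z * b" using t_z[OF b_in_T] .
  ultimately have "inverse z = z" using grp_right_cancel by metis
  thus ?thesis by (metis grp_left_inverse)
qed

lemma inverse_z: "inverse z = z" using z_z by (rule grp_inverse_unique)

lemma inverse_t: "t \<in> T \<Longrightarrow> inverse t = z * t"
proof (rule grp_inverse_unique)
  assume "t \<in> T"
  thus "t * (z * t) = 1" using t_z[of t] t_square[of t] z_z by (metis mult.assoc)
qed

lemma T_inverse: "t \<in> T \<Longrightarrow> inverse t \<in> T"
  using inverse_t XT z_X by metis

lemma TT: assumes "t \<in> T" "u \<in> T" shows "t * u \<in> X"
proof -
  obtain y where y: "y \<in> X" "u = y * b" using assms TE by blast
  obtain x where x: "x \<in> X" "t = x * b" using assms TE by blast
  have "t * u = inverse y * (t * b)" using y t_x[OF assms(1) y(1)] by (simp add: mult.assoc[symmetric])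
  also have "t * b = x * z" using x by (simp add: z_def mult.assoc)
  finally show ?thesis using X_mult X_inverse x y z_X by metis
qed

lemma T_conj_X: "t \<in> T \<Longrightarrow> x \<in> X \<Longrightarrow> x * t * inverse x = x * x * t"
  using t_x[of t "inverse x"] X_inverse by (simp add: mult.assoc)

definition B where "B = X \<union> T"

lemma B_in_G: "\<beta> \<in> B \<Longrightarrow> \<beta> \<in> G" using X_in_G T_in_G by (auto simp: B_def)

lemma B: "subgrp B"
  unfolding subgrp_def B_def
  by (auto intro: X_one X_mult X_inverse TT XT TX T_inverse)

lemma B_conj_T: "\<beta> \<in> B \<Longrightarrow> t \<in> T \<Longrightarrow> \<beta> * t * inverse \<beta> \<in> T"
  unfolding B_def using XT TX TT X_inverse T_inverse by (metis Un_iff)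

lemma AT_empty: "a \<in> A \<Longrightarrow> a \<notin> T" using A_disjoint by (auto simp: T_def)

lemma G_cases:
  assumes "g \<in> G" obtains a x where "a \<in> A" "x \<in> X" "g = a * x" | a t where "a \<in> A" "t \<in> T" "g = a * t"
  using assms G_cover unfolding T_def[symmetric] by (auto simp: mem_times subset_eq)

lemma AX_in_G: "g \<in> A * X \<Longrightarrow> g \<in> G" and AT_in_G: "g \<in> A * T \<Longrightarrow> g \<in> G"
  using A_in_G X_in_G T_in_G G_mult by (auto simp: mem_times)

text \<open>Two factorisations \<open>a t = a' x\<close> would put \<open>x t\<^sup>-\<^sup>1\<close> into \<open>A \<inter> T\<close>.\<close>
lemma AX_AT: "g \<in> G \<Longrightarrow> g \<in> A * T \<longleftrightarrow> g \<notin> A * X"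
proof -
  assume g: "g \<in> G"
  have "\<not> (g \<in> A * T \<and> g \<in> A * X)"
  proof
    assume "g \<in> A * T \<and> g \<in> A * X"
    then obtain a t a' x where h: "a \<in> A" "t \<in> T" "g = a * t" "a' \<in> A" "x \<in> X" "g = a' * x" by (auto simp: mem_times)
    hence "inverse a' * a = x * inverse t" by (metis inv_mult_cancel mult.assoc grp_right_inverse mult.right_neutral)
    moreover have "inverse a' * a \<in> A" using h A_mult A_inverse by blast
    moreover have "x * inverse t \<in> T" using h XT T_inverse by blast
    ultimately show False using AT_empty by metis
  qed
  moreover have "g \<in> A * T \<or> g \<in> A * X" using G_cases[OF g] by (metis mem_times)
  ultimately show ?thesis by blast
qed

lemma AX_X: "g \<in> A * X \<Longrightarrow> x \<in> X \<Longrightarrow> g * x \<in> A * X"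
  by (auto simp: mem_times mult.assoc) (metis X_mult)
lemma AX_T: "g \<in> A * X \<Longrightarrow> t \<in> T \<Longrightarrow> g * t \<in> A * T"
  by (auto simp: mem_times mult.assoc) (metis XT)
lemma AT_X: "g \<in> A * T \<Longrightarrow> x \<in> X \<Longrightarrow> g * x \<in> A * T"
  by (auto simp: mem_times mult.assoc) (metis TX)
lemma AT_T: "g \<in> A * T \<Longrightarrow> t \<in> T \<Longrightarrow> g * t \<in> A * X"
  by (auto simp: mem_times mult.assoc) (metis TT)
lemma A_AX: "g \<in> A * X \<Longrightarrow> a \<in> A \<Longrightarrow> a * g \<in> A * X"
  by (auto simp: mem_times mult.assoc[symmetric] intro: A_mult) (metis A_mult mult.assoc)
lemma A_AT: "g \<in> A * T \<Longrightarrow> a \<in> A \<Longrightarrow> a * g \<in> A * T"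
  by (auto simp: mem_times mult.assoc[symmetric] intro: A_mult) (metis A_mult mult.assoc)
lemma A_AT_iff: "a \<in> A \<Longrightarrow> a * g \<in> A * T \<longleftrightarrow> g \<in> A * T"
  using A_AT[of g a] A_AT[of "a * g" "inverse a"] A_inverse by auto
lemma AX_X_iff: "x \<in> X \<Longrightarrow> g * x \<in> A * X \<longleftrightarrow> g \<in> A * X"
  using AX_X[of g x] AX_X[of "g * x" "inverse x"] X_inverse by (auto simp: mult.assoc)
lemma AT_X_iff: "x \<in> X \<Longrightarrow> g * x \<in> A * T \<longleftrightarrow> g \<in> A * T"
  using AT_X[of g x] AT_X[of "g * x" "inverse x"] X_inverse by (auto simp: mult.assoc)
lemma AT_T_iff: "t \<in> T \<Longrightarrow> g * t \<in> A * X \<longleftrightarrow> g \<in> A * T"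
  using AT_T[of g t] AX_T[of "g * t" "inverse t"] T_inverse by (auto simp: mult.assoc)
lemma A_AX': "a \<in> A \<Longrightarrow> x \<in> X \<Longrightarrow> a * x \<in> A * X" and A_AT': "a \<in> A \<Longrightarrow> t \<in> T \<Longrightarrow> a * t \<in> A * T"
  by (auto simp: mem_times)
lemma X_AX: "x \<in> X \<Longrightarrow> x \<in> A * X" using A_AX'[OF A_one] by simp
lemma T_AT: "x \<in> T \<Longrightarrow> x \<in> A * T" using A_AT'[OF A_one] by simp

text \<open>Two square roots differ by an element of exponent two.\<close>
lemma finite_square_roots: "finite {x \<in> X. x * x = c}"
proof (cases "\<exists>y\<in>X. y * y = c")
  case True
  then obtain y where y: "y \<in> X" "y * y = c" by blast
  have "{x \<in> X. x * x = c} \<subseteq> (\<lambda>u. u * y) ` {x \<in> X. x ^ 2 = 1}"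
  proof
    fix x assume x: "x \<in> {x \<in> X. x * x = c}"
    have "(x * inverse y) ^ 2 = x ^ 2 * inverse y ^ 2"
      by (rule commuting_power[OF pruefer_commuting[OF X]]) (use x y X_inverse in auto)
    also have "\<dots> = 1" using x y by (simp add: power2_eq_square flip: grp_inverse_mult)
    finally have "x * inverse y \<in> {x \<in> X. x ^ 2 = 1}" using x y X_mult X_inverse by auto
    moreover have "x = (x * inverse y) * y" by (simp add: mult.assoc)
    ultimately show "x \<in> (\<lambda>u. u * y) ` {x \<in> X. x ^ 2 = 1}" by blast
  qed
  moreover have "finite {x \<in> X. x ^ 2 = 1}" by (rule pruefer_bounded[OF X]) simp
  ultimately show ?thesis using finite_subset finite_imageI by blast
qed (auto intro: finite_subset[of _ "{}"])

subsection \<open>Conjugates of the inverting elements\<close>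

text \<open>Since \<open>G = B A\<close> and \<open>B\<close> normalizes \<open>T\<close>, conjugating \<open>T\<close> by \<open>A\<close> already produces all its
  conjugates in \<open>G\<close>.\<close>
definition I where "I = {inverse a * t * a | a t. a \<in> A \<and> t \<in> T}"

lemma I_I: "a \<in> A \<Longrightarrow> t \<in> T \<Longrightarrow> inverse a * t * a \<in> I" by (auto simp: I_def)

lemma G_BA: assumes "g \<in> G" obtains \<beta> a where "\<beta> \<in> B" "a \<in> A" "g = \<beta> * a"
proof -
  have "\<exists>a \<beta>. a \<in> A \<and> \<beta> \<in> B \<and> inverse g = a * \<beta>"
    using G_cases[OF G_inverse[OF assms]] unfolding B_def by (metis Un_iff)
  then obtain a \<beta> where "a \<in> A" "\<beta> \<in> B" "inverse g = a * \<beta>" by blast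
  moreover from this have "g = inverse \<beta> * inverse a" by (metis grp_inverse_inverse grp_inverse_mult)
  ultimately show ?thesis using that A_inverse subgrp_inverse[OF B] by blast
qed

lemma I_conj: assumes "\<sigma> \<in> I" "g \<in> G" shows "g * \<sigma> * inverse g \<in> I"
proof -
  obtain a t where a: "a \<in> A" "t \<in> T" "\<sigma> = inverse a * t * a" using assms by (auto simp: I_def)
  have "a * inverse g \<in> G" using a A_in_G G_mult G_inverse assms by blast
  then obtain \<beta> c where c: "\<beta> \<in> B" "c \<in> A" "a * inverse g = \<beta> * c" using G_BA by blast
  have "g * \<sigma> * inverse g = inverse (a * inverse g) * t * (a * inverse g)" using a by (simp add: grp_simps)
  also have "\<dots> = inverse c * (inverse \<beta> * t * inverse (inverse \<beta>)) * c" using c by (simp add: grp_simps)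
  finally show ?thesis using I_I[OF c(2) B_conj_T[OF subgrp_inverse[OF B c(1)] a(2)]] by simp
qed

lemma I_in_G: "\<sigma> \<in> I \<Longrightarrow> \<sigma> \<in> G"
  using A_in_G T_in_G G_mult G_inverse by (auto simp: I_def)

lemma T_in_I: "t \<in> T \<Longrightarrow> t \<in> I" using I_I[OF A_one] by simp

definition z_central where "z_central \<longleftrightarrow> (\<forall>g\<in>G. z * g = g * z)"

lemma I_square: assumes "\<sigma> \<in> I" z_central shows "\<sigma> * \<sigma> = z"
proof -
  obtain a t where a: "a \<in> A" "t \<in> T" "\<sigma> = inverse a * t * a" using assms by (auto simp: I_def)
  have "\<sigma> * \<sigma> = inverse a * (t * t) * a" using a by (simp add: grp_simps)
  also have "\<dots> = z" using assms a A_in_G by (simp add: t_square z_central_def mult.assoc)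
  finally show ?thesis .
qed

text \<open>Both \<open>t\<close> and the conjugate \<open>c t\<close> have the square \<open>z\<close>; comparing \<open>(c t)\<^sup>2 = t\<^sup>2\<close> gives the
  claim.\<close>
lemma T_inverts_left_part:
  assumes "c * t \<in> I" "t \<in> T" z_central shows "t * c * inverse t = inverse c"
proof -
  have "c * t * (c * t) = t * t" using I_square[OF assms(1,3)] t_square[OF assms(2)] by simp
  hence "c * (t * c * inverse t) = 1"
    by (metis grp_right_cancel mult.assoc mult.left_neutral grp_right_inverse mult.right_neutral)
  thus ?thesis by (metis grp_inverse_unique)
qed

text \<open>The set \<open>A * X\<close> is a union of right cosets of \<open>A\<close>. The condition is that \<open>A * X\<close> and its
  translate by \<open>inverse g\<close> have a symmetric difference made of finitely many such cosets.\<close>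
definition almost where "almost = {g \<in> G. fcov A {w \<in> G. (w \<in> A * X) \<noteq> (w * g \<in> A * X)}}"

lemma subgrp_almost: "subgrp almost"
  unfolding subgrp_def
proof (intro conjI ballI)
  show "1 \<in> almost" unfolding almost_def using G_one by (auto intro!: fcov_finite A_one)
next
  fix g h assume g: "g \<in> almost" and h: "h \<in> almost"
  hence gG: "g \<in> G" "h \<in> G" by (auto simp: almost_def)
  let ?W = "\<lambda>g. {w \<in> G. (w \<in> A * X) \<noteq> (w * g \<in> A * X)}"
  have "fcov A {w \<in> G. w * g \<in> ?W h}"
    by (rule fcov_translate[of A "?W h" _ g]) (use h in \<open>auto simp: almost_def\<close>)
  hence "fcov A (?W g \<union> {w \<in> G. w * g \<in> ?W h})"
    using g by (auto simp: almost_def intro: fcov_Un)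
  hence "fcov A (?W (g * h))"
    by (rule fcov_subset) (auto simp: mult.assoc G_mult gG)
  thus "g * h \<in> almost" using gG G_mult by (simp add: almost_def)
next
  fix g assume g: "g \<in> almost"
  hence gG: "g \<in> G" by (auto simp: almost_def)
  let ?W = "\<lambda>g. {w \<in> G. (w \<in> A * X) \<noteq> (w * g \<in> A * X)}"
  have "fcov A (?W (inverse g))"
    by (rule fcov_translate[of A "?W g" _ "inverse g"]) (use g gG G_mult G_inverse in \<open>auto simp: almost_def mult.assoc\<close>)
  thus "inverse g \<in> almost" using gG G_inverse by (simp add: almost_def)
qed

lemma X_almost: "x \<in> X \<Longrightarrow> x \<in> almost"
  unfolding almost_def using X_in_G by (auto simp: AX_X_iff intro!: fcov_finite A_one)

text \<open>Right multiplication by \<open>t\<close> exchanges the complementary sets \<open>A * X\<close> and \<open>A * T\<close>.\<close>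
lemma T_normalizes_almost: assumes "t \<in> T" "g \<in> almost" shows "t * g * inverse t \<in> almost"
proof -
  have gG: "g \<in> G" using assms by (auto simp: almost_def)
  note tG = T_in_G[OF assms(1)]
  let ?W = "\<lambda>g. {w \<in> G. (w \<in> A * X) \<noteq> (w * g \<in> A * X)}"
  have "fcov A (?W (t * g * inverse t))"
  proof (rule fcov_translate[of A "?W g" _ t])
    show "fcov A (?W g)" using assms by (simp add: almost_def)
    fix v assume v: "v \<in> ?W (t * g * inverse t)"
    have "v * (t * g * inverse t) = (v * t * g) * inverse t" by (simp add: mult.assoc)
    hence "v * (t * g * inverse t) \<in> A * X \<longleftrightarrow> v * t * g \<in> A * T"
      using AT_T_iff[OF T_inverse[OF assms(1)]] by simp
    moreover have "v * t \<in> A * X \<longleftrightarrow> v \<in> A * T" by (rule AT_T_iff[OF assms(1)])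
    ultimately show "v * t \<in> ?W g" using v AX_AT[of v] AX_AT[of "v * t * g"] G_mult tG gG by auto
  qed
  thus ?thesis using G_mult tG gG G_inverse by (simp add: almost_def)
qed

lemma B_normalizes_almost:
  assumes "\<beta> \<in> B" "g \<in> almost" shows "\<beta> * g * inverse \<beta> \<in> almost"
  using assms T_normalizes_almost X_almost subgrp_almost unfolding B_def
  by (metis Un_iff subgrp_mult subgrp_inverse)

lemma B_normalizes_almost_iff:
  assumes "\<beta> \<in> B" shows "\<beta> * g * inverse \<beta> \<in> almost \<longleftrightarrow> g \<in> almost"
  using B_normalizes_almost[OF assms, of g] B_normalizes_almost[of "inverse \<beta>" "\<beta> * g * inverse \<beta>"]
    subgrp_inverse[OF B assms] by (auto simp: mult.assoc)

context
  assumes fin: "finite (A \<inter> X)"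
begin

lemma fcov_X_finite: assumes "fcov A W" "W \<subseteq> X" shows "finite W"
proof -
  have "fcov (A \<inter> X) W" by (rule fcov_Int[OF A Xs assms(1) fcov_refl[OF assms(2)]])
  thus ?thesis using fin by (rule fcov_imp_finite)
qed

text \<open>Right multiplication by \<open>t\<close> moves \<open>X\<close>, which meets infinitely many cosets of \<open>A\<close>, out of
  \<open>A * X\<close>.\<close>
lemma T_not_almost: assumes "t \<in> T" shows "t \<notin> almost"
proof
  assume "t \<in> almost"
  hence "fcov A {w \<in> G. (w \<in> A * X) \<noteq> (w * t \<in> A * X)}" by (simp add: almost_def)
  moreover have "X \<subseteq> {w \<in> G. (w \<in> A * X) \<noteq> (w * t \<in> A * X)}"
    using X_AX AT_T_iff[OF assms] AX_AT X_in_G by blast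
  ultimately have "finite X" using fcov_X_finite fcov_subset by blast
  thus False using pruefer_infinite[OF X] by blast
qed

text \<open>The hypothesis says that an element of \<open>I\<close> inside \<open>A * X\<close> either preserves \<open>X\<close> or has few
  conjugates in \<open>A * T\<close>; in both cases it lies in \<open>almost\<close>. From this one deduces
  \<open>almost \<subseteq> A * X\<close>, and that every element of \<open>I\<close> lies in \<open>almost\<close> or in \<open>almost * b\<close>. A
  conjugate of \<open>y \<in> X\<close> is a product of two elements of \<open>I\<close>, namely conjugates of \<open>y b\<close> and of
  \<open>inverse b\<close>; its square, a conjugate of \<open>y\<^sup>2\<close>, then lies in \<open>almost\<close>. Since \<open>X\<close> is divisible,
  this covers all conjugates of \<open>X\<close> by elements of \<open>A\<close>.\<close>
lemma permutes_if_almost_stabilized: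
  assumes zc: z_central
    and H: "\<And>\<sigma>. \<sigma> \<in> I \<Longrightarrow> \<sigma> \<in> A * X \<Longrightarrow> (\<forall>x\<in>X. \<sigma> * x * inverse \<sigma> \<in> X) \<or> finite {y \<in> X. y * \<sigma> * inverse y \<in> A * T}"
  shows "X * A \<subseteq> A * X"
proof -
  have I_AX: "\<sigma> \<in> almost" if \<sigma>: "\<sigma> \<in> I" "\<sigma> \<in> A * X" for \<sigma>
  proof -
    let ?W = "{w \<in> G. (w \<in> A * X) \<noteq> (w * \<sigma> \<in> A * X)}"
    \<comment> \<open>Since \<open>\<sigma>\<^sup>2 = z\<close> fixes both halves, the coset exchange caused by \<open>\<sigma>\<close> is \<open>?V\<close> and a
      translate of \<open>?V\<close>.\<close>
    let ?V = "{w \<in> G. w \<in> A * X \<and> w * \<sigma> \<in> A * T}"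
    have \<sigma>G: "\<sigma> \<in> G" using I_in_G \<sigma> by blast
    have "fcov A ?V"
    proof (cases "\<forall>x\<in>X. \<sigma> * x * inverse \<sigma> \<in> X")
      case True
      have "?V = {}"
      proof (rule ccontr)
        assume "?V \<noteq> {}"
        then obtain w where w: "w \<in> A * X" "w * \<sigma> \<in> A * T" by blast
        then obtain a x where ax: "a \<in> A" "x \<in> X" "w = a * x" by (auto simp: mem_times)
        have "x * \<sigma> \<in> A * T" using w ax by (simp add: mult.assoc A_AT_iff)
        have "inverse \<sigma> * x * \<sigma> \<in> X"
        proof -
          have "inverse \<sigma> = inverse z * \<sigma>" using I_square[OF \<sigma>(1) zc]
            by (metis grp_inverse_mult grp_left_cancel inv_mult_cancel mult.assoc mult.right_neutral grp_left_inverse)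
          hence "inverse \<sigma> * x * \<sigma> = inverse z * \<sigma> * x * \<sigma>" by simp
          also have "\<dots> = inverse z * (\<sigma> * x * inverse \<sigma>) * (\<sigma> * \<sigma>)" by (simp only: mult.assoc inv_mult_cancel)
          finally have e: "inverse \<sigma> * x * \<sigma> = inverse z * (\<sigma> * x * inverse \<sigma>) * (\<sigma> * \<sigma>)" .
          show ?thesis unfolding e I_square[OF \<sigma>(1) zc]
            by (rule X_mult[OF X_mult[OF X_inverse[OF z_X]] z_X]) (use True ax in blast)
        qed
        moreover have "x * \<sigma> = \<sigma> * (inverse \<sigma> * x * \<sigma>)" by (simp add: mult.assoc)
        ultimately have "x * \<sigma> \<in> A * X" using AX_X \<sigma> by metis
        thus False using \<open>x * \<sigma> \<in> A * T\<close> AX_AT AX_in_G by blast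
      qed
      show ?thesis unfolding \<open>?V = {}\<close> by (rule fcov_finite[OF finite.emptyI A_one])
    next
      case False
      hence fY: "finite {y \<in> X. y * \<sigma> * inverse y \<in> A * T}" using H \<sigma> by blast
      show ?thesis
      proof (rule fcovI[OF fY])
        fix w assume "w \<in> ?V"
        hence w: "w \<in> A * X" "w * \<sigma> \<in> A * T" by auto
        then obtain a x where ax: "a \<in> A" "x \<in> X" "w = a * x" by (auto simp: mem_times)
        have "x * \<sigma> \<in> A * T" using w ax by (simp add: mult.assoc A_AT_iff)
        hence "x * \<sigma> * inverse x \<in> A * T" using AT_X X_inverse ax by blast
        thus "\<exists>h\<in>A. \<exists>f\<in>{y \<in> X. y * \<sigma> * inverse y \<in> A * T}. w = h * f" using ax by blast
      qed
    qed
    moreover have "fcov A {w \<in> G. w * \<sigma> \<in> ?V}" by (rule fcov_translate[OF \<open>fcov A ?V\<close>, of _ \<sigma>]) auto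
    ultimately have "fcov A (?V \<union> {w \<in> G. w * \<sigma> \<in> ?V})" by (rule fcov_Un)
    moreover have "?W \<subseteq> ?V \<union> {w \<in> G. w * \<sigma> \<in> ?V}"
    proof
      fix w assume w: "w \<in> ?W"
      have "w * \<sigma> * \<sigma> \<in> A * T \<longleftrightarrow> w \<in> A * T"
        using I_square[OF \<sigma>(1) zc] AT_X_iff[OF z_X] by (simp add: mult.assoc)
      thus "w \<in> ?V \<union> {w \<in> G. w * \<sigma> \<in> ?V}" using w AX_AT[of w] AX_AT[of "w * \<sigma>"] G_mult \<sigma>G by auto
    qed
    ultimately show ?thesis using fcov_subset \<sigma>G by (auto simp: almost_def)
  qed
  \<comment> \<open>\<open>almost\<close> misses \<open>A * T\<close>: only finitely many \<open>x\<close> in \<open>X\<close> are bad for \<open>c t\<close>; for another \<open>x\<close>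
    one has \<open>x c = a u\<close> with \<open>u \<in> T\<close>, and the conjugate \<open>c u c\<^sup>-\<^sup>1\<close> of \<open>u\<close> lies in \<open>I \<inter> A X\<close>.
    Conjugating it back with \<open>c t\<close> and \<open>t\<close> puts \<open>u\<close> into \<open>almost\<close>.\<close>
  have AT_almost: False if ct: "c \<in> A" "t \<in> T" "c * t \<in> almost" for c t
  proof -
    let ?W = "{w \<in> G. (w \<in> A * X) \<noteq> (w * (c * t) \<in> A * X)}"
    have "fcov A ?W" using ct by (simp add: almost_def)
    hence "finite (?W \<inter> X)" by (intro fcov_X_finite) (auto intro: fcov_subset)
    then obtain x where x: "x \<in> X" "x \<notin> ?W" using pruefer_infinite[OF X]
      by (metis (no_types, lifting) IntI finite_subset subsetI)
    hence "x * c * t \<in> A * X" using X_AX X_in_G by (auto simp: mult.assoc)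
    hence "x * c \<in> A * T" using AT_T_iff[OF ct(2)] by simp
    then obtain a u where au: "a \<in> A" "u \<in> T" "x * c = a * u" by (auto simp: mem_times)
    have "u = inverse a * x * c" using au by (metis inv_mult_cancel mult.assoc)
    hence e: "c * u * inverse c = (c * inverse a) * x" by (simp add: grp_simps)
    have "c * u * inverse c \<in> A * X" unfolding e by (intro A_AX' A_mult A_inverse ct au x)
    moreover have "c * u * inverse c \<in> I" by (intro I_conj T_in_I au A_in_G ct)
    ultimately have "c * u * inverse c \<in> almost" using I_AX by blast
    hence "inverse (c * t) * (c * u * inverse c) * (c * t) \<in> almost"
      using ct subgrp_almost by (blast intro: subgrp_mult subgrp_inverse)
    hence "inverse t * u * inverse (inverse t) \<in> almost" by (simp add: grp_simps)
    hence "u \<in> almost" using B_normalizes_almost_iff[of "inverse t" u] T_inverse ct by (auto simp: B_def)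
    thus False using T_not_almost au by blast
  qed
  have almost_AX: "g \<in> A * X" if "g \<in> almost" for g
  proof -
    have "g \<in> G" using that by (simp add: almost_def)
    thus ?thesis using G_cases AT_almost that AX_AT by (metis mem_times)
  qed
  \<comment> \<open>An element of \<open>I\<close> in \<open>A * T\<close> has all its conjugates under \<open>B\<close> in \<open>A * T\<close>, so it exchanges
    the two halves exactly.\<close>
  have I_AT: "\<tau> * inverse b \<in> almost" if \<tau>: "\<tau> \<in> I" "\<tau> \<in> A * T" for \<tau>
  proof -
    have \<tau>G: "\<tau> \<in> G" using I_in_G \<tau> by blast
    have conj: "\<beta> * \<tau> * inverse \<beta> \<in> A * T" if "\<beta> \<in> B" for \<beta>
    proof (rule ccontr)
      assume n: "\<beta> * \<tau> * inverse \<beta> \<notin> A * T"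
      have i: "\<beta> * \<tau> * inverse \<beta> \<in> I" using I_conj B_in_G that \<tau> by blast
      hence "\<beta> * \<tau> * inverse \<beta> \<in> almost" using I_AX AX_AT n I_in_G by blast
      hence "\<tau> \<in> A * X" using almost_AX B_normalizes_almost_iff[OF that] by blast
      thus False using \<tau> AX_AT AX_in_G by blast
    qed
    have E: "{w \<in> G. (w \<in> A * X) \<noteq> (w * (\<tau> * inverse b) \<in> A * X)} = {}"
    proof (rule ccontr)
      assume "{w \<in> G. (w \<in> A * X) \<noteq> (w * (\<tau> * inverse b) \<in> A * X)} \<noteq> {}"
      then obtain w where w: "w \<in> G" "(w \<in> A * X) \<noteq> (w * \<tau> * inverse b \<in> A * X)" by (auto simp: mult.assoc)
      hence w2: "(w \<in> A * X) \<noteq> (w * \<tau> \<in> A * T)" using AT_T_iff[OF T_inverse[OF b_in_T]] by simp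
      have "(w \<in> A * X) = (w * \<tau> \<in> A * T)"
      proof (cases rule: G_cases[OF w(1)])
        case (1 a x)
        have "x * \<tau> * inverse x \<in> A * T" using conj 1 by (auto simp: B_def)
        hence "x * \<tau> * inverse x * x \<in> A * T" using AT_X 1 by blast
        hence "w * \<tau> \<in> A * T" using 1 A_AT by (simp add: mult.assoc)
        thus ?thesis using 1 A_AX' by blast
      next
        case (2 a t)
        have "t * \<tau> * inverse t \<in> A * T" using conj 2 by (auto simp: B_def)
        hence "t * \<tau> * inverse t * t \<in> A * X" using AT_T 2 by blast
        hence "w * \<tau> \<in> A * X" using 2 A_AX by (simp add: mult.assoc)
        moreover have "w \<in> A * T" using 2 A_AT' by blast
        ultimately show ?thesis using AX_AT AX_in_G AT_in_G by blast
      qed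
      thus False using w2 by blast
    qed
    have "fcov A {w \<in> G. (w \<in> A * X) \<noteq> (w * (\<tau> * inverse b) \<in> A * X)}"
      unfolding E by (rule fcov_finite[OF finite.emptyI A_one])
    moreover have "\<tau> * inverse b \<in> G" using \<tau>G bG G_mult G_inverse by blast
    ultimately show ?thesis unfolding almost_def by blast
  qed
  have I_cases: "\<sigma> \<in> almost \<or> \<sigma> * inverse b \<in> almost" if "\<sigma> \<in> I" for \<sigma>
    using that I_AX I_AT AX_AT I_in_G by blast
  show ?thesis
  proof
    fix g assume "g \<in> X * A"
    then obtain x a where xa: "x \<in> X" "a \<in> A" "g = x * a" by (auto simp: mem_times)
    obtain y where y: "y \<in> X" "y ^ 2 = x" using pruefer_divisible[OF X, of 2 x] xa by auto
    let ?\<sigma> = "inverse a * (y * b) * a" and ?\<tau> = "inverse a * inverse b * a"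
    have I: "?\<sigma> \<in> I" "?\<tau> \<in> I" using I_I xa TI y T_inverse b_in_T by auto
    have bB: "b \<in> B" "inverse b \<in> B" using b_in_T T_inverse by (auto simp: B_def)
    let ?k = "inverse a * y * a"
    have k: "?k = ?\<sigma> * ?\<tau>" by (simp add: grp_simps)
    have zk: "inverse b * inverse b \<in> almost" using X_almost X_inverse[OF b_square] by (simp add: grp_inverse_mult)
    note al = subgrp_mult[OF subgrp_almost]
    have k2: "?k * ?k \<in> almost"
    proof -
      have sq: "w * w \<in> almost" if w: "w * inverse b \<in> almost" for w
      proof -
        have "b * (w * inverse b) * inverse b \<in> almost" using B_normalizes_almost[OF bB(1) w] .
        hence "(w * inverse b) * (b * (w * inverse b) * inverse b) * inverse (inverse b * inverse b) \<in> almost"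
          using w zk subgrp_almost by (blast intro: subgrp_mult subgrp_inverse)
        thus ?thesis by (simp add: grp_simps)
      qed
      have "?k \<in> almost \<or> ?k * inverse b \<in> almost"
      proof -
        consider "?\<sigma> \<in> almost" "?\<tau> \<in> almost" | "?\<sigma> \<in> almost" "?\<tau> * inverse b \<in> almost"
          | "?\<sigma> * inverse b \<in> almost" "?\<tau> \<in> almost" | "?\<sigma> * inverse b \<in> almost" "?\<tau> * inverse b \<in> almost"
          using I_cases I by blast
        thus ?thesis
        proof cases
          case 1
          thus ?thesis using al unfolding k by blast
        next
          case 2
          hence "?\<sigma> * (?\<tau> * inverse b) \<in> almost" using al by blast
          thus ?thesis unfolding k by (simp add: mult.assoc)
        next
          case 3
          have "(?\<sigma> * inverse b) * (b * ?\<tau> * inverse b) \<in> almost"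
            by (rule al[OF 3(1) B_normalizes_almost[OF bB(1) 3(2)]])
          moreover have "(?\<sigma> * inverse b) * (b * ?\<tau> * inverse b) = ?k * inverse b" unfolding k by (simp add: grp_simps)
          ultimately show ?thesis by metis
        next
          case 4
          have "(?\<sigma> * inverse b) * (b * (?\<tau> * inverse b) * inverse b) * inverse (inverse b * inverse b) \<in> almost"
            by (rule al[OF al[OF 4(1) B_normalizes_almost[OF bB(1) 4(2)]] subgrp_inverse[OF subgrp_almost zk]])
          moreover have "(?\<sigma> * inverse b) * (b * (?\<tau> * inverse b) * inverse b) * inverse (inverse b * inverse b) = ?k"
            unfolding k by (simp add: grp_simps)
          ultimately show ?thesis by metis
        qed
      qed
      thus ?thesis using sq al by blast
    qed
    have "?k * ?k = inverse a * x * a" unfolding y(2)[symmetric] by (simp add: grp_simps power2_eq_square)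
    hence "inverse a * x * a \<in> A * X" using k2 almost_AX by metis
    hence "a * (inverse a * x * a) \<in> A * X" using A_AX xa by blast
    thus "g \<in> A * X" using xa by (simp add: mult.assoc)
  qed
qed

end

lemma permutes_if_infinite_meet: assumes "infinite (A \<inter> X)" shows "X * A \<subseteq> A * X"
proof -
  have "A \<inter> X = X" using pruefer_subgroup[OF X subgrp_Int[OF A Xs]] assms by blast
  hence "X \<subseteq> A" by blast
  hence "X * A \<subseteq> A" using A_mult by (auto simp: mem_times subset_eq)
  thus ?thesis using A_AX'[OF _ X_one] by (metis mult.right_neutral subset_eq)
qed

end

section \<open>An abelian factor, central square\<close>

context inverted_factor
begin

lemma G_conj: "g \<in> G \<Longrightarrow> u \<in> G \<Longrightarrow> g * u * inverse g \<in> G" "g \<in> G \<Longrightarrow> u \<in> G \<Longrightarrow> inverse g * u * g \<in> G"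
  by (simp_all add: G_mult G_inverse)

lemma A_conj_AX: assumes "a \<in> A" "x \<in> X" "inverse a * x * a \<in> A * X" shows "x * a \<in> A * X"
proof -
  have "a * (inverse a * x * a) \<in> A * X" using A_AX assms by blast
  thus ?thesis by (simp add: mult.assoc)
qed

lemma X_conj_AX: assumes "x \<in> X" "a \<in> A" "x * a * inverse x \<in> A * X" shows "x * a \<in> A * X"
proof -
  have "(x * a * inverse x) * x \<in> A * X" using AX_X assms by blast
  thus ?thesis by (simp add: mult.assoc)
qed

text \<open>Write \<open>y a\<^sup>-\<^sup>1 = c \<beta>\<close> with \<open>c \<in> A\<close> and \<open>\<beta> \<in> B\<close>, where \<open>\<sigma>\<close> is the conjugate of \<open>t\<close> by \<open>a\<close>.
  Then \<open>y \<sigma> y\<^sup>-\<^sup>1 \<in> D\<close> if and only if \<open>\<beta> t \<beta>\<^sup>-\<^sup>1\<close> lies in the finite set \<open>D \<inter> T\<close>, and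
  \<open>\<beta> \<mapsto> \<beta> t \<beta>\<^sup>-\<^sup>1\<close> is finite-to-one on \<open>B\<close> because \<open>x t x\<^sup>-\<^sup>1 = x\<^sup>2 t\<close>. So the \<open>y\<close> in question
  lie in finitely many cosets of \<open>A\<close>.\<close>
lemma stabilizer_finite:
  assumes D: "subgrp D" "A \<subseteq> D" and DT: "finite (D \<inter> X)" and fin: "finite (A \<inter> X)" and \<sigma>: "\<sigma> \<in> I"
  shows "finite {y \<in> X. y * \<sigma> * inverse y \<in> D}"
proof -
  obtain a t where a: "a \<in> A" "t \<in> T" "\<sigma> = inverse a * t * a" using \<sigma> by (auto simp: I_def)
  have "finite (D \<inter> T)"
  proof (cases "D \<inter> T = {}")
    case False
    then obtain u where u: "u \<in> D" "u \<in> T" by blast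
    have "D \<inter> T \<subseteq> (\<lambda>x. x * u) ` (D \<inter> X)"
    proof
      fix v assume v: "v \<in> D \<inter> T"
      have "v * inverse u \<in> D \<inter> X" using v u D TT T_inverse by (auto intro: subgrp_mult subgrp_inverse)
      moreover have "v = (v * inverse u) * u" by (simp add: mult.assoc)
      ultimately show "v \<in> (\<lambda>x. x * u) ` (D \<inter> X)" by blast
    qed
    thus ?thesis using DT finite_subset by blast
  qed auto
  let ?\<Phi> = "{\<beta> \<in> B. \<beta> * t * inverse \<beta> \<in> D \<inter> T}"
  have "?\<Phi> \<subseteq> (\<Union>v\<in>D \<inter> T. {x \<in> X. x * x = v * inverse t}) \<union> (\<Union>v\<in>D \<inter> T. (\<lambda>x. x * t) ` {x \<in> X. x * x = v * inverse t})"
  proof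
    fix \<beta> assume \<beta>: "\<beta> \<in> ?\<Phi>"
    show "\<beta> \<in> (\<Union>v\<in>D \<inter> T. {x \<in> X. x * x = v * inverse t}) \<union> (\<Union>v\<in>D \<inter> T. (\<lambda>x. x * t) ` {x \<in> X. x * x = v * inverse t})"
    proof (cases "\<beta> \<in> X")
      case True
      hence "\<beta> * \<beta> = (\<beta> * t * inverse \<beta>) * inverse t" using T_conj_X[OF a(2) True] by (simp add: mult.assoc)
      thus ?thesis using \<beta> True by blast
    next
      case False
      hence "\<beta> \<in> T" using \<beta> by (auto simp: B_def)
      hence x: "\<beta> * inverse t \<in> X" using TT T_inverse a by blast
      define x where "x = \<beta> * inverse t"
      have bx: "\<beta> = x * t" by (simp add: x_def mult.assoc)
      have "x * x = (\<beta> * t * inverse \<beta>) * inverse t" using T_conj_X[OF a(2) x[folded x_def]]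
        unfolding bx by (simp add: grp_simps)
      thus ?thesis using \<beta> x bx unfolding x_def[symmetric] by blast
    qed
  qed
  moreover have "finite ((\<Union>v\<in>D \<inter> T. {x \<in> X. x * x = v * inverse t}) \<union> (\<Union>v\<in>D \<inter> T. (\<lambda>x. x * t) ` {x \<in> X. x * x = v * inverse t}))"
    using \<open>finite (D \<inter> T)\<close> finite_square_roots by blast
  ultimately have \<Phi>: "finite ?\<Phi>" using finite_subset by blast
  show ?thesis
  proof (rule fcov_X_finite[OF fin])
    show "fcov A {y \<in> X. y * \<sigma> * inverse y \<in> D}"
    proof (rule fcovI[of "(\<lambda>\<beta>. \<beta> * a) ` ?\<Phi>"])
      fix y assume y: "y \<in> {y \<in> X. y * \<sigma> * inverse y \<in> D}"
      have "y * inverse a \<in> G" using y a A_in_G X_in_G G_mult G_inverse by blast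
      then obtain c \<beta> where c: "c \<in> A" "\<beta> \<in> B" "y * inverse a = c * \<beta>"
        using G_cases unfolding B_def by (metis Un_iff)
      have yc: "y = c * (\<beta> * a)" using c(3) by (metis grp_left_inverse mult.assoc mult.right_neutral)
      have "y * \<sigma> * inverse y = c * (\<beta> * t * inverse \<beta>) * inverse c"
        unfolding a(3) yc by (simp add: grp_simps)
      hence "\<beta> * t * inverse \<beta> = inverse c * (y * \<sigma> * inverse y) * c" by (simp add: mult.assoc)
      hence "\<beta> * t * inverse \<beta> \<in> D" using y c D A_inverse by (auto intro!: subgrp_mult)
      hence "\<beta> \<in> ?\<Phi>" using B_conj_T c a by blast
      thus "\<exists>h\<in>A. \<exists>f\<in>(\<lambda>\<beta>. \<beta> * a) ` ?\<Phi>. y = h * f" using c yc by blast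
    qed (use \<Phi> in auto)
  qed auto
qed

text \<open>Let \<open>cj\<close> be conjugation by a fixed \<open>a \<in> A\<close>. If \<open>cj m = c u\<close> with \<open>c \<in> A\<close>, \<open>u \<in> X\<close>, then
  \<open>u\<close> commutes with \<open>cj m\<close> and the square of \<open>cj m\<close> is \<open>c\<^sup>2 u\<^sup>2\<close>. Suppose \<open>cj m = c t\<close> with
  \<open>t \<in> T\<close>, and let \<open>m1\<close> be a square root of \<open>m\<close>; by the first remark \<open>cj m1 = d u\<close> with \<open>u \<in> T\<close>.
  Here \<open>d\<close> inverts \<open>X\<close>, because \<open>cj m1\<close> centralizes \<open>X\<close> and \<open>u\<close> inverts it. But then
  \<open>cj m1 = cj m (cj m1)\<^sup>-\<^sup>1 = c t u\<^sup>-\<^sup>1 d\<^sup>-\<^sup>1\<close> equals \<open>c d\<^sup>-\<^sup>1 (t u\<^sup>-\<^sup>1)\<^sup>-\<^sup>1\<close>, which is in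
  \<open>A * X\<close>, a contradiction.\<close>
lemma permutes_if_normal_closure_abelian:
  assumes N: "\<And>x y a. x \<in> X \<Longrightarrow> y \<in> X \<Longrightarrow> a \<in> A \<Longrightarrow> x * (inverse a * y * a) = (inverse a * y * a) * x"
  shows "X * A \<subseteq> A * X"
proof
  fix g assume "g \<in> X * A"
  then obtain x a where xa: "x \<in> X" "a \<in> A" "g = x * a" by (auto simp: mem_times)
  define cj where "cj y = inverse a * y * a" for y
  have cj_mult: "cj y * cj y' = cj (y * y')" for y y' by (simp add: cj_def grp_simps)
  have cj_X: "x' * cj y = cj y * x'" if "x' \<in> X" "y \<in> X" for x' y using N that xa by (simp add: cj_def)
  have sq_AX: "cj (m * m) \<in> A * X" if m: "m \<in> X" "cj m \<in> A * X" for m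
  proof -
    obtain c u where c: "c \<in> A" "u \<in> X" "cj m = c * u" using m(2) unfolding mem_times by blast
    have "cj (m * m) = c * (u * cj m)" using c by (simp add: cj_mult[symmetric] mult.assoc)
    also have "\<dots> = c * (cj m * u)" using cj_X[OF c(2) m(1)] by simp
    also have "\<dots> = (c * c) * (u * u)" by (simp add: c mult.assoc)
    finally show ?thesis using A_AX' A_mult X_mult c by simp
  qed
  have AX: "cj m \<in> A * X" if m: "m \<in> X" for m
  proof (rule ccontr)
    have cjG: "cj y \<in> G" if "y \<in> X" for y unfolding cj_def using that xa A_in_G X_in_G G_conj(2) by blast
    assume n: "cj m \<notin> A * X"
    then obtain c t where c: "c \<in> A" "t \<in> T" "cj m = c * t" using cjG[OF m] AX_AT by (metis mem_times)
    obtain m1 where m1: "m1 \<in> X" "m1 ^ 2 = m" using pruefer_divisible[OF X, of 2 m] m by auto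
    have m1sq: "m1 * m1 = m" using m1 by (simp add: power2_eq_square)
    have n1: "cj m1 \<notin> A * X" using sq_AX m1 m1sq n by metis
    then obtain d u where d: "d \<in> A" "u \<in> T" "cj m1 = d * u" using cjG[OF m1(1)] AX_AT by (metis mem_times)
    have "cj m1 = cj m * inverse (cj m1)" unfolding m1sq[symmetric] cj_mult[symmetric] by (simp add: mult.assoc)
    also have "\<dots> = c * t * inverse u * inverse d" using c d by (simp add: grp_simps)
    finally have e: "cj m1 = c * (t * inverse u) * inverse d" by (simp add: mult.assoc)
    have tu: "t * inverse u \<in> X" using TT T_inverse c d by blast
    have du: "d * y * inverse d = inverse y" if "y \<in> X" for y
    proof -
      have dm: "d = cj m1 * inverse u" using d by (simp add: mult.assoc)
      have "d * y * inverse d = cj m1 * (inverse u * y * inverse (inverse u)) * inverse (cj m1)" unfolding dm by (simp add: grp_simps)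
      also have "inverse u * y * inverse (inverse u) = inverse y" using t_inverts T_inverse d that by blast
      also have "cj m1 * inverse y * inverse (cj m1) = inverse y"
        using cj_X[OF X_inverse[OF that] m1(1)] by (metis grp_right_inverse mult.assoc mult.right_neutral)
      finally show ?thesis .
    qed
    have "inverse (t * inverse u) = d * (t * inverse u) * inverse d" using du[OF tu] by simp
    hence "inverse d * inverse (t * inverse u) = (t * inverse u) * inverse d" by (simp add: mult.assoc)
    hence "cj m1 = (c * inverse d) * inverse (t * inverse u)" unfolding e by (simp add: mult.assoc)
    hence "cj m1 \<in> A * X" using A_AX' A_mult A_inverse X_inverse tu c d by metis
    thus False using n1 by blast
  qed
  show "g \<in> A * X" using A_conj_AX[OF xa(2,1)] AX[OF xa(1)] xa by (simp add: cj_def)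
qed

text \<open>Together the two conditions say that \<open>A\<close> and its conjugate by \<open>g\<close> are commensurable.\<close>
definition commensurator where
  "commensurator = {g \<in> G. fcov A ((\<lambda>a. g * a * inverse g) ` A) \<and> fcov A ((\<lambda>a. inverse g * a * g) ` A)}"

lemma fcov_conj_A: "g \<in> commensurator \<Longrightarrow> fcov ((\<lambda>a. g * a * inverse g) ` A) A"
  using fcov_conj[of A "(\<lambda>a. inverse g * a * g) ` A" g]
  by (simp add: commensurator_def image_image mult.assoc)

lemma subgrp_commensurator: "subgrp commensurator"
  unfolding subgrp_def
proof (intro conjI ballI)
  show "1 \<in> commensurator" by (simp add: commensurator_def G_one fcov_refl)
next
  fix g h assume gh: "g \<in> commensurator" "h \<in> commensurator"
  have 1: "fcov A ((\<lambda>a. g * h * a * inverse (g * h)) ` A)"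
  proof (rule fcov_trans)
    show "fcov A ((\<lambda>a. g * a * inverse g) ` A)" using gh by (simp add: commensurator_def)
    show "fcov ((\<lambda>a. g * a * inverse g) ` A) ((\<lambda>a. g * h * a * inverse (g * h)) ` A)"
      using fcov_conj[of A "(\<lambda>a. h * a * inverse h) ` A" g] gh
      by (simp add: commensurator_def image_image grp_inverse_mult mult.assoc)
  qed
  have 2: "fcov A ((\<lambda>a. inverse (g * h) * a * (g * h)) ` A)"
  proof (rule fcov_trans)
    show "fcov A ((\<lambda>a. inverse h * a * h) ` A)" using gh by (simp add: commensurator_def)
    show "fcov ((\<lambda>a. inverse h * a * h) ` A) ((\<lambda>a. inverse (g * h) * a * (g * h)) ` A)"
      using fcov_conj[of A "(\<lambda>a. inverse g * a * g) ` A" "inverse h"] gh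
      by (simp add: commensurator_def image_image grp_inverse_mult mult.assoc)
  qed
  show "g * h \<in> commensurator" using 1 2 gh G_mult by (simp add: commensurator_def)
next
  fix g assume "g \<in> commensurator"
  thus "inverse g \<in> commensurator" using G_inverse by (simp add: commensurator_def)
qed

lemma A_commensurator: "A \<subseteq> commensurator"
proof
  fix g assume g: "g \<in> A"
  have "(\<lambda>a. g * a * inverse g) ` A \<subseteq> A" "(\<lambda>a. inverse g * a * g) ` A \<subseteq> A"
    using g A_mult A_inverse by auto
  thus "g \<in> commensurator" using A_in_G[OF g] by (simp add: commensurator_def fcov_refl)
qed

text \<open>Dedekind's law for the centralizer.\<close>
lemma centralizer_decomp:
  assumes "A \<subseteq> centralizer S" "g \<in> G" "g \<in> centralizer S"
  obtains a \<beta> where "a \<in> A" "\<beta> \<in> B" "\<beta> \<in> centralizer S" "g = a * \<beta>"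
proof -
  obtain a \<beta> where c: "a \<in> A" "\<beta> \<in> B" "g = a * \<beta>" using G_cases[OF assms(2)] unfolding B_def by (metis Un_iff)
  have "\<beta> \<in> centralizer S"
    using c assms subgrp_mult_left_iff[OF subgrp_centralizer, of a S \<beta>] by auto
  thus ?thesis using that c by blast
qed

text \<open>The group \<open>D \<inter> X\<close> has index at most two in \<open>D \<inter> B\<close>.\<close>
lemma finite_Int_B: assumes D: "subgrp D" and "finite (D \<inter> X)" shows "finite (D \<inter> B)"
proof -
  have "fcov (D \<inter> X) (D \<inter> B)"
  proof (rule fcov_fibres[of "\<lambda>\<beta>. \<beta> \<in> X"])
    fix v w assume v: "v \<in> D \<inter> B" "w \<in> D \<inter> B" "(v \<in> X) = (w \<in> X)"
    have "v * inverse w \<in> X"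
      using v TT T_inverse X_mult X_inverse by (auto simp: B_def)
    thus "v * inverse w \<in> D \<inter> X" using v D by (auto intro: subgrp_mult subgrp_inverse)
  qed auto
  thus ?thesis using assms(2) by (rule fcov_imp_finite)
qed

text \<open>Let \<open>K\<close> be the set of elements of \<open>X\<close> whose centralizer in \<open>A\<close> has finite index in \<open>A\<close>. If
  \<open>K\<close> contains all squares, then \<open>K = X\<close>; since \<open>b\<close> inverts \<open>X\<close>, each \<open>x \<in> X\<close> then has a
  centralizer of finite index in \<open>G\<close>, which contains every conjugate of \<open>X\<close>, and
  \<open>permutes_if_normal_closure_abelian\<close> applies. Otherwise choose \<open>x0 \<in> X\<close> with \<open>x0\<^sup>2 \<notin> K\<close>. Given
  \<open>x \<in> X\<close>, take a finite cyclic \<open>W \<subseteq> X\<close> that contains \<open>x\<close> and \<open>x0\<close>. The intersection \<open>V\<close> of the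
  conjugates of \<open>A\<close> under \<open>W\<close> has finite index in \<open>A\<close> and is normalized by \<open>W\<close>, so \<open>x a x\<^sup>-\<^sup>1\<close>
  centralizes \<open>V\<close> and equals \<open>c \<beta>\<close> where \<open>\<beta> \<in> B\<close> centralizes \<open>V\<close>. If \<open>\<beta>\<close> were in \<open>T\<close>, it would
  invert \<open>x0\<close>, and the conjugates of \<open>v \<in> V\<close> by \<open>x0\<close> and by \<open>x0\<^sup>-\<^sup>1\<close> would agree; then \<open>x0\<^sup>2\<close>
  would centralize \<open>V\<close>.\<close>
lemma permutes_if_commensurated:
  assumes cA: "commuting A" and XC: "X \<subseteq> commensurator"
  shows "X * A \<subseteq> A * X"
proof -
  define K where "K = {x \<in> X. fcov (centralizer {x} \<inter> A) A}"
  show ?thesis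
  proof (cases "\<forall>x\<in>X. x * x \<in> K")
    case True
    have K: "x \<in> K" if "x \<in> X" for x
      using pruefer_divisible[OF X, of 2 x] that True by (metis power2_eq_square zero_less_numeral)
    show ?thesis
    proof (rule permutes_if_normal_closure_abelian)
      fix x y a assume xya: "x \<in> X" "y \<in> X" "a \<in> A"
      let ?C = "centralizer {x}"
      have "fcov (?C \<inter> A) A" using K xya by (auto simp: K_def)
      then obtain F where F: "finite F" "A \<subseteq> (?C \<inter> A) * F" by (auto simp: fcov_def)
      have X_C: "X \<subseteq> ?C" using X_comm xya by (auto simp: centralizer_def)
      have bC: "b * c * inverse b \<in> ?C" if "c \<in> ?C" for c
      proof -
        have "c * inverse x = inverse x * c" using that by (auto simp: centralizer_def intro: commute_inverse[symmetric])
        hence e: "b * (c * inverse x) * inverse b = b * (inverse x * c) * inverse b" by simp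
        have "b * inverse x * inverse b = x" using b_inverts[OF X_inverse[OF xya(1)]] by simp
        moreover from e have "b * c * inverse b * (b * inverse x * inverse b) = (b * inverse x * inverse b) * (b * c * inverse b)"
          by (simp add: mult.assoc)
        ultimately show ?thesis by (simp add: centralizer_def)
      qed
      have "fcov ?C G"
      proof (rule fcovI[of "F \<union> (\<lambda>f. b * f) ` F"])
        fix g assume "g \<in> G"
        then obtain \<beta> c where c: "\<beta> \<in> B" "c \<in> A" "g = \<beta> * c" using G_BA by blast
        obtain d f where d: "d \<in> ?C" "d \<in> A" "f \<in> F" "c = d * f" using F c by (auto simp: mem_times subset_eq)
        show "\<exists>h\<in>?C. \<exists>f\<in>F \<union> (\<lambda>f. b * f) ` F. g = h * f"
        proof (cases "\<beta> \<in> X")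
          case True
          hence "\<beta> * d \<in> ?C" using X_C d subgrp_mult[OF subgrp_centralizer] by blast
          moreover have "g = (\<beta> * d) * f" using c d by (simp add: mult.assoc)
          ultimately show ?thesis using d by blast
        next
          case False
          then obtain y where y: "y \<in> X" "\<beta> = y * b" using c TE by (auto simp: B_def)
          have "y * (b * d * inverse b) \<in> ?C" using y X_C d bC subgrp_mult[OF subgrp_centralizer] by blast
          moreover have "g = (y * (b * d * inverse b)) * (b * f)" using c d y by (simp add: mult.assoc)
          ultimately show ?thesis using d by blast
        qed
      qed (use F in auto)
      hence "fcov ((\<lambda>x. a * x * inverse a) ` ?C) ((\<lambda>x. a * x * inverse a) ` G)" by (rule fcov_conj)
      moreover have "X \<subseteq> (\<lambda>x. a * x * inverse a) ` G"
      proof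
        fix u assume "u \<in> X"
        hence "inverse a * u * a \<in> G" using X_in_G A_in_G xya G_conj(2) by blast
        moreover have "u = a * (inverse a * u * a) * inverse a" by (simp add: mult.assoc)
        ultimately show "u \<in> (\<lambda>x. a * x * inverse a) ` G" by blast
      qed
      ultimately have "X \<subseteq> (\<lambda>x. a * x * inverse a) ` ?C"
        using pruefer_fcov[OF X subgrp_conj[OF subgrp_centralizer]] fcov_subset by blast
      then obtain c where "c \<in> ?C" "y = a * c * inverse a" using xya by blast
      thus "x * (inverse a * y * a) = (inverse a * y * a) * x" by (simp add: mult.assoc centralizer_def)
    qed
  next
    case False
    then obtain x0 where x0: "x0 \<in> X" "x0 * x0 \<notin> K" by blast
    show ?thesis
    proof
      fix g assume "g \<in> X * A"
      then obtain x a where xa: "x \<in> X" "a \<in> A" "g = x * a" by (auto simp: mem_times)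
      obtain w where w: "w \<in> X" "\<forall>u\<in>{x0, x}. \<exists>k::nat. u = w ^ k"
        using pruefer_locally_cyclic[OF X, of "{x0, x}"] x0 xa by auto
      obtain n where n: "w ^ p ^ n = 1" "p ^ n > 0" using pruefer_torsion[OF X w(1)] .
      define W where "W = {w ^ k | k. True}"
      have W: "finite W" "x0 \<in> W" "x \<in> W" "W \<subseteq> X" "1 \<in> W"
        using finite_powers(1)[OF n] w subgrp_power[OF Xs w(1)] by (auto simp: W_def intro: exI[of _ 0])
      have W_mult: "u * v \<in> W" if "u \<in> W" "v \<in> W" for u v
        using that by (auto simp: W_def simp flip: power_add)
      have W_inv: "inverse u \<in> W" if "u \<in> W" for u
        using that inverse_as_power[OF n] by (auto simp: W_def grp_inverse_power simp flip: power_mult)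
      define V where "V = (\<Inter>d\<in>W. (\<lambda>a. d * a * inverse d) ` A)"
      have V: "fcov V A" "V \<subseteq> A"
      proof -
        show "fcov V A" unfolding V_def
          using fcov_INT[OF W(1), of "\<lambda>d. (\<lambda>a. d * a * inverse d) ` A" A] subgrp_conj[OF A] fcov_conj_A XC W(4) by blast
        show "V \<subseteq> A" using W(5) by (auto simp: V_def)
      qed
      have V_conj: "e * v * inverse e \<in> V" if e: "e \<in> W" "v \<in> V" for e v
        unfolding V_def
      proof
        fix d assume "d \<in> W"
        hence "v \<in> (\<lambda>a. (inverse e * d) * a * inverse (inverse e * d)) ` A" using e W_mult W_inv by (auto simp: V_def)
        then obtain a' where "a' \<in> A" "v = (inverse e * d) * a' * inverse (inverse e * d)" by blast
        moreover from this have "e * v * inverse e = d * a' * inverse d" by (simp add: grp_simps)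
        ultimately show "e * v * inverse e \<in> (\<lambda>a. d * a * inverse d) ` A" by blast
      qed
      have "x * a * inverse x \<in> centralizer V"
        unfolding centralizer_def
      proof clarify
        fix v assume v: "v \<in> V"
        have "inverse x * v * x \<in> A" using V_conj[OF W_inv[OF W(3)] v] V by auto
        hence "a * (inverse x * v * x) = (inverse x * v * x) * a" using xa cA by (auto dest: commutingD)
        hence "x * (a * (inverse x * v * x)) * inverse x = x * ((inverse x * v * x) * a) * inverse x" by simp
        thus "x * a * inverse x * v = v * (x * a * inverse x)" by (simp add: mult.assoc)
      qed
      moreover have "A \<subseteq> centralizer V" using V cA by (auto simp: centralizer_def dest: commutingD)
      moreover have "x * a * inverse x \<in> G" using xa X_in_G A_in_G G_conj(1) by blast
      ultimately obtain c \<beta> where c: "c \<in> A" "\<beta> \<in> B" "\<beta> \<in> centralizer V" "x * a * inverse x = c * \<beta>"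
        using centralizer_decomp by metis
      have "\<beta> \<notin> T"
      proof
        assume t: "\<beta> \<in> T"
        have "V \<subseteq> centralizer {x0 * x0}"
        proof
          fix v assume v: "v \<in> V"
          have "\<beta> * (x0 * v * inverse x0) = (x0 * v * inverse x0) * \<beta>"
            using V_conj[OF W(2) v] c(3) by (auto simp: centralizer_def)
          moreover have "\<beta> * (x0 * v * inverse x0) = inverse x0 * v * x0 * \<beta>"
          proof -
            have "\<beta> * (x0 * v * inverse x0) = inverse x0 * (\<beta> * v) * inverse x0" using t_x[OF t x0(1)] by (simp add: mult.assoc[symmetric])
            also have "\<beta> * v = v * \<beta>" using c(3) v by (auto simp: centralizer_def)
            also have "inverse x0 * (v * \<beta>) * inverse x0 = inverse x0 * v * (\<beta> * inverse x0)" by (simp add: mult.assoc)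
            also have "\<beta> * inverse x0 = x0 * \<beta>" using t_x[OF t X_inverse[OF x0(1)]] by simp
            finally show ?thesis by (simp add: mult.assoc)
          qed
          ultimately have "x0 * v * inverse x0 = inverse x0 * v * x0" using grp_right_cancel by metis
          hence "x0 * (x0 * v * inverse x0) * x0 = x0 * (inverse x0 * v * x0) * x0" by simp
          thus "v \<in> centralizer {x0 * x0}" by (simp add: mult.assoc centralizer_def)
        qed
        hence "fcov (centralizer {x0 * x0} \<inter> A) A" using V by (meson fcov_trans fcov_refl Int_greatest)
        thus False using x0 X_mult by (auto simp: K_def)
      qed
      hence "x * a * inverse x \<in> A * X" using c A_AX' by (auto simp: B_def)
      thus "g \<in> A * X" using X_conj_AX xa by blast
    qed
  qed
qed

text \<open>If \<open>y \<sigma> y\<^sup>-\<^sup>1 = c t\<close> with \<open>c \<in> A\<close>, \<open>t \<in> T\<close>, then \<open>t\<close> inverts \<open>c\<close>. If \<open>c\<close> centralizes \<open>X\<close>,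
  conjugating back gives \<open>\<sigma> \<in> A * T\<close>, which is excluded. Otherwise the centralizer of \<open>c\<close>
  contains the abelian group \<open>A\<close> with finite index, and also the conjugates of \<open>A\<close> by \<open>t\<close> and
  its inverse, because they contain \<open>inverse c\<close> and are abelian. So \<open>t\<close>, and with it \<open>c t\<close>,
  commensurates \<open>A\<close>; by \<open>stabilizer_finite\<close> this happens for finitely many \<open>y\<close> unless \<open>X\<close> itself
  commensurates \<open>A\<close>.\<close>
theorem permutes_abelian_central_square:
  assumes cA: "commuting A" and zc: z_central
  shows "X * A \<subseteq> A * X"
proof (cases "finite (A \<inter> X)")
  case False
  thus ?thesis by (rule permutes_if_infinite_meet)
next
  case fin: True
  show ?thesis
  proof (cases "X \<subseteq> commensurator")
    case True
    thus ?thesis by (rule permutes_if_commensurated[OF cA])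
  next
    case nC: False
    have finD: "finite (commensurator \<inter> X)"
      by (rule pruefer_subgroup[OF X subgrp_Int[OF subgrp_commensurator Xs]]) (use nC in auto)
    show ?thesis
    proof (rule permutes_if_almost_stabilized[OF fin zc])
      fix \<sigma> assume \<sigma>: "\<sigma> \<in> I" "\<sigma> \<in> A * X"
      have "{y \<in> X. y * \<sigma> * inverse y \<in> A * T} \<subseteq> {y \<in> X. y * \<sigma> * inverse y \<in> commensurator}"
      proof clarify
        fix y assume y: "y \<in> X" "y * \<sigma> * inverse y \<in> A * T"
        then obtain c t where c: "c \<in> A" "t \<in> T" "y * \<sigma> * inverse y = c * t" by (auto simp: mem_times)
        have i: "c * t \<in> I" using I_conj[OF \<sigma>(1) X_in_G[OF y(1)]] c by simp
        have tct: "t * c * inverse t = inverse c" by (rule T_inverts_left_part[OF i c(2) zc])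
        have "t \<in> commensurator"
        proof (cases "\<forall>x\<in>X. c * x = x * c")
          case True
          have "c * y = y * c" using True y by blast
          hence "inverse y * (c * t) * y = c * (inverse y * t * y)"
            by (metis inv_mult_cancel mult.assoc)
          moreover have "\<sigma> = inverse y * (c * t) * y" using c(3)[symmetric] by (simp add: mult.assoc)
          moreover have "inverse y * t * y \<in> T" using XT TX X_inverse y c by blast
          ultimately have "\<sigma> \<in> A * T" using c A_AT' by auto
          thus ?thesis using \<sigma> AX_AT AX_in_G by blast
        next
          case False
          then obtain x where "x \<in> X" "x \<notin> centralizer {c}" unfolding centralizer_def by force
          hence "finite (centralizer {c} \<inter> X)"
            by (intro pruefer_subgroup[OF X subgrp_Int[OF subgrp_centralizer Xs]]) blast+
          hence finB: "finite (centralizer {c} \<inter> B)" by (rule finite_Int_B[OF subgrp_centralizer])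
          have AC: "A \<subseteq> centralizer {c}" using c cA by (auto simp: centralizer_def dest: commutingD)
          have cov: "fcov A ((\<lambda>a. u * a * inverse u) ` A)" if u: "u \<in> G" "inverse u * c * u \<in> A" for u
          proof (rule fcovI[OF finB])
            fix g assume "g \<in> (\<lambda>a. u * a * inverse u) ` A"
            then obtain a where a: "a \<in> A" "g = u * a * inverse u" by blast
            have "a * (inverse u * c * u) = (inverse u * c * u) * a" using a u cA by (auto dest: commutingD)
            hence "u * (a * (inverse u * c * u)) * inverse u = u * ((inverse u * c * u) * a) * inverse u" by simp
            hence "g \<in> centralizer {c}" using a by (simp add: centralizer_def mult.assoc)
            moreover have "g \<in> G" using a u A_in_G G_conj(1) by blast
            ultimately show "\<exists>h\<in>A. \<exists>f\<in>centralizer {c} \<inter> B. g = h * f"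
              using centralizer_decomp[OF AC] by (metis IntI)
          qed
          have 1: "inverse (inverse t) * c * inverse t \<in> A" using tct c A_inverse by simp
          have 2: "inverse t * c * t \<in> A"
          proof -
            have "inverse t * inverse (t * c * inverse t) * t = inverse t * c * t" using tct by simp
            hence "inverse t * c * t = inverse c" by (simp add: grp_simps)
            thus ?thesis using c A_inverse by simp
          qed
          show ?thesis using cov[OF T_in_G[OF c(2)] 2] cov[OF G_inverse[OF T_in_G[OF c(2)]] 1] T_in_G[OF c(2)]
            by (simp add: commensurator_def)
        qed
        thus "y * \<sigma> * inverse y \<in> commensurator"
          using c A_commensurator subgrp_mult[OF subgrp_commensurator] by auto
      qed
      moreover have "finite {y \<in> X. y * \<sigma> * inverse y \<in> commensurator}"
        by (rule stabilizer_finite[OF subgrp_commensurator A_commensurator finD fin \<sigma>(1)])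
      ultimately show "(\<forall>x\<in>X. \<sigma> * x * inverse \<sigma> \<in> X) \<or> finite {y \<in> X. y * \<sigma> * inverse y \<in> A * T}"
        using finite_subset by blast
    qed
  qed
qed

end

section \<open>Permutation groups and quotients\<close>

text \<open>Permutation groups are the source of all concrete members of the class: quotients and the
  given group itself are represented by permutations.\<close>
typedef 'a sym = "{f :: 'a \<Rightarrow> 'a. bij f}"
  by (auto intro: bij_id)

setup_lifting type_definition_sym

instantiation sym :: (type) grp
begin
lift_definition one_sym :: "'a sym" is id by (rule bij_id)
lift_definition times_sym :: "'a sym \<Rightarrow> 'a sym \<Rightarrow> 'a sym" is "\<lambda>f g. f \<circ> g" by (rule bij_comp)
lift_definition inverse_sym :: "'a sym \<Rightarrow> 'a sym" is "\<lambda>f. inv_into UNIV f" by (rule bij_imp_bij_inv)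
definition divide_sym :: "'a sym \<Rightarrow> 'a sym \<Rightarrow> 'a sym" where "divide_sym f g = f * inverse g"
instance
  by (standard; (simp add: divide_sym_def)?; transfer; auto simp: bij_def fun_eq_iff)
end

text \<open>Abstract group operations \<open>m\<close>, \<open>i\<close>, \<open>e\<close> are used so that the lemma serves both for
  quotients of groups in the type class and for the regular representation of a group given by a
  carrier. Points outside \<open>\<Omega>\<close> are fixed.\<close>
lemma action_hom:
  fixes act :: "'g \<Rightarrow> 'b \<Rightarrow> 'b"
  assumes "\<And>g \<omega>. g \<in> G \<Longrightarrow> \<omega> \<in> \<Omega> \<Longrightarrow> act g \<omega> \<in> \<Omega>"
    and "\<And>g h \<omega>. g \<in> G \<Longrightarrow> h \<in> G \<Longrightarrow> \<omega> \<in> \<Omega> \<Longrightarrow> act (m g h) \<omega> = act g (act h \<omega>)"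
    and "\<And>g. g \<in> G \<Longrightarrow> i g \<in> G \<and> m g (i g) = e \<and> m (i g) g = e"
    and "\<And>\<omega>. \<omega> \<in> \<Omega> \<Longrightarrow> act e \<omega> = \<omega>" and "\<And>g h. g \<in> G \<Longrightarrow> h \<in> G \<Longrightarrow> m g h \<in> G"
  obtains \<phi> :: "'g \<Rightarrow> 'b sym" where
    "\<And>g h. g \<in> G \<Longrightarrow> h \<in> G \<Longrightarrow> \<phi> (m g h) = \<phi> g * \<phi> h"
    "\<And>g h. g \<in> G \<Longrightarrow> h \<in> G \<Longrightarrow> \<phi> g = \<phi> h \<longleftrightarrow> (\<forall>\<omega>\<in>\<Omega>. act g \<omega> = act h \<omega>)"
proof -
  define f where "f g \<omega> = (if \<omega> \<in> \<Omega> then act g \<omega> else \<omega>)" for g \<omega>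
  have comp: "f (m g h) = f g \<circ> f h" if "g \<in> G" "h \<in> G" for g h
    using that assms(1,2) by (auto simp: f_def fun_eq_iff)
  have bij: "bij (f g)" if "g \<in> G" for g
  proof (rule o_bij)
    have "f e = id" using assms(4) by (auto simp: f_def fun_eq_iff)
    thus "f (i g) \<circ> f g = id" "f g \<circ> f (i g) = id" using comp assms(3) that by metis+
  qed
  show ?thesis
  proof (rule that[of "\<lambda>g. Abs_sym (f g)"])
    fix g h assume "g \<in> G" "h \<in> G"
    thus "Abs_sym (f (m g h)) = Abs_sym (f g) * Abs_sym (f h)"
      using comp bij by (simp add: times_sym.abs_eq eq_onp_def)
    have "Abs_sym (f g) = Abs_sym (f h) \<longleftrightarrow> f g = f h"
      using bij \<open>g \<in> G\<close> \<open>h \<in> G\<close> by (simp add: Abs_sym_inject)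
    also have "\<dots> \<longleftrightarrow> (\<forall>\<omega>\<in>\<Omega>. act g \<omega> = act h \<omega>)" by (auto simp: f_def fun_eq_iff)
    finally show "Abs_sym (f g) = Abs_sym (f h) \<longleftrightarrow> (\<forall>\<omega>\<in>\<Omega>. act g \<omega> = act h \<omega>)" .
  qed
qed

text \<open>The quotient \<open>G / N\<close> is realised by the action of \<open>G\<close> on the cosets of \<open>N\<close>; this keeps
  quotients inside the type class.\<close>
lemma quotient_hom:
  assumes G: "subgrp G" and N: "subgrp N" "N \<subseteq> G"
    and normal: "\<And>g n. g \<in> G \<Longrightarrow> n \<in> N \<Longrightarrow> g * n * inverse g \<in> N"
  obtains \<phi> :: "'a::grp \<Rightarrow> 'a set sym" where
    "\<And>g h. g \<in> G \<Longrightarrow> h \<in> G \<Longrightarrow> \<phi> (g * h) = \<phi> g * \<phi> h"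
    "\<And>g h. g \<in> G \<Longrightarrow> h \<in> G \<Longrightarrow> \<phi> g = \<phi> h \<longleftrightarrow> inverse g * h \<in> N"
proof -
  define \<Omega> where "\<Omega> = {(\<lambda>n. x * n) ` N | x. x \<in> G}"
  define act where "act g C = (\<lambda>c. g * c) ` C" for g :: 'a and C
  obtain \<phi> :: "'a \<Rightarrow> 'a set sym" where \<phi>: "\<And>g h. g \<in> G \<Longrightarrow> h \<in> G \<Longrightarrow> \<phi> (g * h) = \<phi> g * \<phi> h"
    "\<And>g h. g \<in> G \<Longrightarrow> h \<in> G \<Longrightarrow> \<phi> g = \<phi> h \<longleftrightarrow> (\<forall>\<omega>\<in>\<Omega>. act g \<omega> = act h \<omega>)"
  proof (rule action_hom[of G \<Omega> act "(*)" inverse 1])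
    fix g \<omega> assume "g \<in> G" "\<omega> \<in> \<Omega>"
    then obtain x where "x \<in> G" "\<omega> = (\<lambda>n. x * n) ` N" by (auto simp: \<Omega>_def)
    hence "g * x \<in> G" "act g \<omega> = (\<lambda>n. (g * x) * n) ` N" using \<open>g \<in> G\<close> subgrp_mult[OF G] by (auto simp: act_def image_image mult.assoc)
    thus "act g \<omega> \<in> \<Omega>" by (auto simp: \<Omega>_def)
  qed (use subgrp_mult[OF G] subgrp_inverse[OF G] in \<open>auto simp: act_def image_image mult.assoc\<close>)
  show ?thesis
  proof (rule that[of \<phi>, OF \<phi>(1)])
    fix g h assume gh: "g \<in> G" "h \<in> G"
    have "(\<forall>\<omega>\<in>\<Omega>. act g \<omega> = act h \<omega>) \<longleftrightarrow> inverse g * h \<in> N"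
    proof
      assume *: "\<forall>\<omega>\<in>\<Omega>. act g \<omega> = act h \<omega>"
      have "N \<in> \<Omega>" unfolding \<Omega>_def using subgrp_one[OF G] by (auto intro!: exI[of _ 1])
      hence "(\<lambda>c. g * c) ` N = (\<lambda>c. h * c) ` N" using * by (auto simp: act_def)
      moreover have "h \<in> (\<lambda>c. h * c) ` N" using subgrp_one[OF N(1)] by force
      ultimately obtain n where "n \<in> N" "h = g * n" by blast
      thus "inverse g * h \<in> N" by simp
    next
      assume *: "inverse g * h \<in> N"
      have sub: "(\<lambda>c. u * c) ` (\<lambda>n. x * n) ` N \<subseteq> (\<lambda>c. v * c) ` (\<lambda>n. x * n) ` N"
        if uv: "u \<in> G" "v \<in> G" "inverse v * u \<in> N" "x \<in> G" for u v x
      proof clarify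
        fix n assume n: "n \<in> N"
        have "inverse x * (inverse v * u) * inverse (inverse x) \<in> N" using normal uv subgrp_inverse[OF G] by blast
        hence "(inverse x * (inverse v * u) * x) * n \<in> N" using subgrp_mult[OF N(1)] n by simp
        moreover have "u * (x * n) = v * (x * ((inverse x * (inverse v * u) * x) * n))" by (simp add: mult.assoc)
        ultimately show "u * (x * n) \<in> (\<lambda>c. v * c) ` (\<lambda>n. x * n) ` N" by blast
      qed
      have "inverse h * g \<in> N" using subgrp_inverse[OF N(1) *] by (simp add: grp_inverse_mult)
      thus "\<forall>\<omega>\<in>\<Omega>. act g \<omega> = act h \<omega>"
        unfolding \<Omega>_def act_def using sub[OF gh] sub[OF gh(2,1)] * by blast
    qed
    thus "\<phi> g = \<phi> h \<longleftrightarrow> inverse g * h \<in> N" using \<phi>(2)[OF gh] by simp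
  qed
qed

section \<open>An abelian factor\<close>

context inverted_factor
begin

lemma I_not_A: "\<sigma> \<in> I \<Longrightarrow> \<sigma> \<notin> A"
proof
  assume "\<sigma> \<in> I" "\<sigma> \<in> A"
  then obtain a t where a: "a \<in> A" "t \<in> T" "\<sigma> = inverse a * t * a" by (auto simp: I_def)
  hence "t = a * \<sigma> * inverse a" by (simp add: mult.assoc)
  hence "t \<in> A" using a \<open>\<sigma> \<in> A\<close> A_mult A_inverse by blast
  thus False using AT_empty a by blast
qed

lemma z_B: "\<beta> \<in> B \<Longrightarrow> z * \<beta> = \<beta> * z"
  using X_comm z_X t_z by (auto simp: B_def)

definition z_conjugates where "z_conjugates = {inverse a * z * a | a. a \<in> A}"

lemma z_conjugates_normal:
  assumes g: "g \<in> G" "s \<in> z_conjugates" shows "g * s * inverse g \<in> z_conjugates"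
proof -
  obtain a where a: "a \<in> A" "s = inverse a * z * a" using g by (auto simp: z_conjugates_def)
  have "a * inverse g \<in> G" using a g A_in_G G_mult G_inverse by blast
  then obtain \<beta> c where c: "\<beta> \<in> B" "c \<in> A" "a * inverse g = \<beta> * c" using G_BA by blast
  have "g * s * inverse g = inverse (a * inverse g) * z * (a * inverse g)" by (simp add: a grp_simps)
  also have "\<dots> = inverse c * (inverse \<beta> * (z * \<beta>)) * c" unfolding c(3) by (simp add: grp_simps)
  also have "\<dots> = inverse c * z * c" using z_B[OF c(1)] by simp
  finally show ?thesis using c by (auto simp: z_conjugates_def)
qed

lemma z_closure: "subgrp (gen z_conjugates)" "gen z_conjugates \<subseteq> G" "z \<in> gen z_conjugates"
proof -
  have "z \<in> G" using z_X X_in_G by blast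
  hence "z_conjugates \<subseteq> G" using A_in_G G_conj(2) by (auto simp: z_conjugates_def)
  thus "gen z_conjugates \<subseteq> G" by (rule gen_least[OF G])
  show "z \<in> gen z_conjugates" by (rule gen_incl) (auto simp: z_conjugates_def intro!: exI[of _ 1] A_one)
qed (rule subgrp_gen)

lemma z_closure_normal:
  "g \<in> G \<Longrightarrow> n \<in> gen z_conjugates \<Longrightarrow> g * n * inverse g \<in> gen z_conjugates"
  using gen_conj[of z_conjugates g n] z_conjugates_normal gen_incl by blast

text \<open>Put \<open>d = inverse a\<close> and write \<open>z d z = \<beta> a1\<close> with \<open>\<beta> \<in> B\<close>, \<open>a1 \<in> A\<close>. If \<open>\<beta>\<close> were in \<open>T\<close>,
  the fact that \<open>d\<close> and \<open>a1\<close> commute, before and after conjugation with \<open>z\<close>, would make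
  \<open>a1 d\<^sup>-\<^sup>1\<close> a conjugate of \<open>\<beta>\<^sup>-\<^sup>1 \<in> T\<close>, whereas \<open>A\<close> contains no conjugate of an element of \<open>T\<close>.
  So \<open>\<beta> \<in> X\<close>, and the inverse of the equation shows \<open>z a z \<in> A * X\<close>.\<close>
lemma z_conj_AX: assumes cA: "commuting A" and a: "a \<in> A" shows "inverse a * z * a \<in> A * X"
proof -
  have zG: "z \<in> G" using z_X X_in_G by blast
  have "z * inverse a * z \<in> G" using zG A_in_G G_mult A_inverse a by blast
  then obtain \<beta> a1 where c: "\<beta> \<in> B" "a1 \<in> A" "z * inverse a * z = \<beta> * a1" using G_BA by blast
  define d where "d = inverse a"
  have d: "d \<in> A" "z * d * z = \<beta> * a1" using c a A_inverse by (auto simp: d_def)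
  have zb: "z * \<beta> = \<beta> * z" using z_B c by blast
  have "\<beta> \<notin> T"
  proof
    assume t: "\<beta> \<in> T"
    have za1: "z * a1 * z = inverse \<beta> * d"
    proof -
      have "d = z * (z * d * z) * z" using z_z by (metis mult.assoc mult.left_neutral mult.right_neutral)
      also have "\<dots> = \<beta> * (z * a1 * z)" unfolding d(2) using zb by (metis mult.assoc)
      finally show ?thesis by simp
    qed
    have "d * a1 = a1 * d" using cA d c by (auto dest: commutingD)
    moreover have "z * (d * a1) * z = (z * d * z) * (z * a1 * z)" "z * (a1 * d) * z = (z * a1 * z) * (z * d * z)"
      using z_z by (metis mult.assoc mult.left_neutral)+
    ultimately have E: "\<beta> * a1 * (inverse \<beta> * d) = inverse \<beta> * d * (\<beta> * a1)" unfolding d(2) za1 by simp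
    have z_a1: "z * a1 = inverse \<beta> * d * z" unfolding za1[symmetric] using z_z by (simp add: mult.assoc)
    have zib: "z * inverse \<beta> = \<beta>" using inverse_t[OF t] z_z by (metis mult.assoc mult.left_neutral)
    have "z * a1 * inverse \<beta> * d = d * \<beta> * a1"
    proof -
      have "z * a1 * inverse \<beta> * d = \<beta> * (\<beta> * a1 * (inverse \<beta> * d))" by (simp add: t_square[OF t, symmetric] mult.assoc)
      also have "\<dots> = d * \<beta> * a1" unfolding E by (simp add: mult.assoc)
      finally show ?thesis .
    qed
    hence "inverse \<beta> * d * (z * inverse \<beta>) * d = d * \<beta> * a1" unfolding z_a1 by (simp add: mult.assoc)
    hence "inverse \<beta> * d * \<beta> * d = d * \<beta> * a1" unfolding zib .
    hence "inverse (d * \<beta>) * (d * \<beta> * a1) * inverse d = inverse (d * \<beta>) * (inverse \<beta> * d * \<beta> * d) * inverse d" by simp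
    hence "a1 * inverse d = inverse (d * \<beta>) * inverse \<beta> * (d * \<beta>)" by (simp add: mult.assoc grp_inverse_mult)
    moreover have "inverse (d * \<beta>) * inverse \<beta> * (d * \<beta>) = inverse \<beta> * (inverse d * inverse \<beta> * d) * inverse (inverse \<beta>)"
      by (simp add: grp_simps)
    ultimately have "a1 * inverse d \<in> I"
      using I_conj[OF I_I[OF d(1) T_inverse[OF t]] G_inverse[OF T_in_G[OF t]]] by metis
    thus False using I_not_A A_mult A_inverse c d by blast
  qed
  hence \<beta>: "\<beta> \<in> X" using c by (auto simp: B_def)
  have "inverse (z * d * z) = z * a * z" by (simp add: grp_inverse_mult d_def inverse_z mult.assoc)
  hence "z * a * z = inverse a1 * inverse \<beta>" unfolding d by (simp add: grp_inverse_mult)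
  hence "z * a * z \<in> A * X" using A_AX' A_inverse X_inverse c \<beta> by metis
  hence "z * a \<in> A * X" using AX_X_iff[OF z_X] by simp
  thus ?thesis using A_AX[of "z * a" "inverse a"] A_inverse a by (simp add: mult.assoc)
qed

text \<open>Modulo \<open>N\<close> the element \<open>z\<close> is trivial and hence central. The image of \<open>A\<close> still misses the
  image of \<open>T\<close> since \<open>N\<close> stabilizes \<open>A * X\<close>, which does not meet \<open>T\<close>; for the same reason the
  inclusion lifts back to \<open>G\<close>. If the image of \<open>X\<close> is finite, then \<open>X \<subseteq> N\<close>.\<close>
lemma quotient_by_stabilizer:
  assumes N: "subgrp N" "N \<subseteq> G" and normal: "\<And>g n. g \<in> G \<Longrightarrow> n \<in> N \<Longrightarrow> g * n * inverse g \<in> N"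
    and stab: "\<And>w n. w \<in> A * X \<Longrightarrow> n \<in> N \<Longrightarrow> w * n \<in> A * X"
    and zN: "z \<in> N" and cA: "commuting A"
  shows "X * A \<subseteq> A * X"
proof -
  obtain \<phi> :: "'a \<Rightarrow> 'a set sym" where \<phi>:
    "\<And>g h. g \<in> G \<Longrightarrow> h \<in> G \<Longrightarrow> \<phi> (g * h) = \<phi> g * \<phi> h"
    "\<And>g h. g \<in> G \<Longrightarrow> h \<in> G \<Longrightarrow> \<phi> g = \<phi> h \<longleftrightarrow> inverse g * h \<in> N"
    using quotient_hom[OF G N normal] by metis
  have \<phi>X: "\<phi> (x * y) = \<phi> x * \<phi> y" if "x \<in> X" "y \<in> X" for x y using \<phi>(1) X_in_G that by blast
  show ?thesis
  proof (cases "finite (\<phi> ` X)")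
    case True
    have "X \<subseteq> N"
    proof (rule pruefer_fibres[OF X True N(1)])
      fix v w assume vw: "v \<in> X" "w \<in> X" "\<phi> v = \<phi> w"
      hence "inverse w * v \<in> N" using \<phi>(2)[of w v] X_in_G by simp
      thus "v * inverse w \<in> N" using X_comm[of v "inverse w"] X_inverse vw by simp
    qed
    show ?thesis
    proof
      fix g assume "g \<in> X * A"
      then obtain x a where xa: "x \<in> X" "a \<in> A" "g = x * a" by (auto simp: mem_times)
      have "inverse a * x * inverse (inverse a) \<in> N" using normal \<open>X \<subseteq> N\<close> xa A_in_G A_inverse by blast
      hence "1 * (inverse a * x * a) \<in> A * X" using stab X_AX[OF X_one] by (metis grp_inverse_inverse)
      thus "g \<in> A * X" using A_conj_AX xa by simp
    qed
  next
    case False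
    note h = G \<phi>(1)
    interpret Q: inverted_factor p "\<phi> ` A" "\<phi> ` X" "\<phi> b" "\<phi> ` G"
    proof
      show "subgrp (\<phi> ` A)" by (rule subgrp_hom_image[OF h A AG])
      show "pruefer p (\<phi> ` X)" by (rule pruefer_hom_image[OF X \<phi>X False])
      show "subgrp (\<phi> ` G)" by (rule subgrp_hom_image[OF h G order_refl])
      show "\<phi> ` A \<subseteq> \<phi> ` G" "\<phi> ` X \<subseteq> \<phi> ` G" "\<phi> b \<in> \<phi> ` G" using AG XG bG by auto
      show "\<phi> b * \<phi> b \<in> \<phi> ` X" using b_square \<phi>(1)[OF bG bG] by (metis imageI)
      fix x' assume "x' \<in> \<phi> ` X"
      then obtain x where x: "x \<in> X" "x' = \<phi> x" by blast
      have "\<phi> b * \<phi> x * inverse (\<phi> b) = \<phi> (b * x * inverse b)"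
        using hom_inverse[OF h] \<phi>(1) bG X_in_G[OF x(1)] G_mult G_inverse by simp
      also have "\<dots> = inverse (\<phi> x)" using b_inverts[OF x(1)] hom_inverse[OF h] X_in_G[OF x(1)] by simp
      finally show "\<phi> b * x' * inverse (\<phi> b) = inverse x'" by (simp add: x)
    next
      show "\<phi> ` G \<subseteq> \<phi> ` A * (\<phi> ` X \<union> (\<lambda>x. x * \<phi> b) ` \<phi> ` X)"
      proof clarify
        fix g assume g: "g \<in> G"
        show "\<phi> g \<in> \<phi> ` A * (\<phi> ` X \<union> (\<lambda>x. x * \<phi> b) ` \<phi> ` X)"
        proof (cases rule: G_cases[OF g])
          case (1 a x)
          hence "\<phi> g = \<phi> a * \<phi> x" using \<phi>(1) A_in_G X_in_G by blast
          thus ?thesis using 1 by (auto simp: mem_times)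
        next
          case (2 a t)
          then obtain x where x: "x \<in> X" "t = x * b" using TE by blast
          have "\<phi> g = \<phi> a * (\<phi> x * \<phi> b)" using 2 x \<phi>(1) A_in_G X_in_G bG G_mult by simp
          moreover have "\<phi> x * \<phi> b \<in> \<phi> ` X \<union> (\<lambda>x. x * \<phi> b) ` \<phi> ` X" using x by blast
          ultimately show ?thesis using 2 unfolding mem_times by blast
        qed
      qed
      show "\<phi> ` A \<inter> (\<lambda>x. x * \<phi> b) ` \<phi> ` X = {}"
      proof (rule ccontr)
        assume "\<phi> ` A \<inter> (\<lambda>x. x * \<phi> b) ` \<phi> ` X \<noteq> {}"
        then obtain a x where ax: "a \<in> A" "x \<in> X" "\<phi> a = \<phi> x * \<phi> b" by auto
        hence "\<phi> a = \<phi> (x * b)" using \<phi>(1) X_in_G bG by simp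
        hence "inverse a * (x * b) \<in> N" using \<phi>(2) ax A_in_G X_in_G bG G_mult by blast
        hence "a * (inverse a * (x * b)) \<in> A * X" using stab A_AX'[OF ax(1) X_one] by fastforce
        hence "x * b \<in> A * X" by simp
        thus False using AX_AT AX_in_G T_AT TI ax by blast
      qed
    qed
    have "\<phi> b * \<phi> b = 1"
    proof -
      have "\<phi> z = \<phi> 1" using \<phi>(2)[of z 1] zN N subgrp_inverse[OF N(1)] G_one by auto
      thus ?thesis using \<phi>(1)[OF bG bG] hom_one[OF h] by (simp add: z_def)
    qed
    hence "Q.z_central" by (simp add: Q.z_central_def Q.z_def)
    moreover have "commuting (\<phi> ` A)"
      using cA A_in_G by (auto simp: commuting_def simp flip: \<phi>(1))
    ultimately have Q: "\<phi> ` X * \<phi> ` A \<subseteq> \<phi> ` A * \<phi> ` X" by (rule Q.permutes_abelian_central_square[rotated])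
    show ?thesis
    proof
      fix g assume "g \<in> X * A"
      then obtain x a where xa: "x \<in> X" "a \<in> A" "g = x * a" by (auto simp: mem_times)
      hence "\<phi> x * \<phi> a \<in> \<phi> ` X * \<phi> ` A" by (auto simp: mem_times)
      hence "\<phi> x * \<phi> a \<in> \<phi> ` A * \<phi> ` X" by (rule subsetD[OF Q])
      then obtain a' x' where a': "a' \<in> A" "x' \<in> X" "\<phi> x * \<phi> a = \<phi> a' * \<phi> x'"
        unfolding mem_times by blast
      have m: "x * a \<in> G" "a' * x' \<in> G" using a' xa by (auto intro: G_mult A_in_G X_in_G)
      have "\<phi> (a' * x') = \<phi> (x * a)" using a' xa \<phi>(1) A_in_G X_in_G by simp
      hence "inverse (a' * x') * (x * a) \<in> N" using \<phi>(2)[OF m(2,1)] by simp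
      hence "(a' * x') * (inverse (a' * x') * (x * a)) \<in> A * X" using stab A_AX' a' by blast
      thus "g \<in> A * X" using xa(3) by simp
    qed
  qed
qed

text \<open>The normal subgroup generated by the conjugates of \<open>z\<close> stabilizes \<open>A * X\<close>: its generators
  form a normal set inside \<open>A * X\<close>, so they can be moved past \<open>X\<close>.\<close>
theorem permutes_abelian:
  assumes cA: "commuting A" shows "X * A \<subseteq> A * X"
proof -
  have S_AX: "s \<in> A * X" if "s \<in> z_conjugates" for s
    using that z_conj_AX[OF cA] by (auto simp: z_conjugates_def)
  have stab: "w * s \<in> A * X" if w: "w \<in> A * X" "s \<in> z_conjugates" for w s
  proof -
    obtain a x where ax: "a \<in> A" "x \<in> X" "w = a * x" using w by (auto simp: mem_times)
    have "x * s * inverse x * x \<in> A * X" using AX_X S_AX z_conjugates_normal X_in_G ax w by blast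
    hence "a * (x * s * inverse x * x) \<in> A * X" using A_AX ax by blast
    thus ?thesis using ax by (simp add: mult.assoc)
  qed
  have S_inv: "inverse s = s" if "s \<in> z_conjugates" for s
    using that by (auto simp: z_conjugates_def grp_inverse_mult inverse_z mult.assoc)
  have "\<forall>w. w \<in> A * X \<longrightarrow> w * n \<in> A * X" if "n \<in> gen z_conjugates" for n
    using that
  proof (induction rule: gen.induct)
    case (gen_mult x y)
    thus ?case using stab by (simp add: mult.assoc[symmetric])
  next
    case (gen_inv x y)
    thus ?case using stab S_inv by (simp add: mult.assoc[symmetric])
  qed simp
  thus ?thesis
    by (intro quotient_by_stabilizer[OF z_closure(1,2) z_closure_normal _ z_closure(3) cA]) blast+
qed

end

section \<open>Two nonabelian factors, one central square\<close>

text \<open>Both factors are now inverted extensions. The condition \<open>A \<inter> X \<subseteq> Y\<close> is what \<open>A_disjoint\<close>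
  becomes when the factors change places, so that the situation is symmetric.\<close>
locale doubly_inverted = inverted_factor p A X b G
  for p and A X :: "'a::grp set" and b G +
  fixes q :: nat and Y :: "'a set" and a0 :: 'a
  assumes Y: "pruefer q Y" and a0_inverts: "y \<in> Y \<Longrightarrow> a0 * y * inverse a0 = inverse y"
    and a0_square: "a0 * a0 \<in> Y" and A_eq: "A = Y \<union> (\<lambda>y. y * a0) ` Y"
    and meet: "A \<inter> X \<subseteq> Y"
begin

lemma a0_A: "a0 \<in> A" using subgrp_one[OF pruefer_subgrp[OF Y]] A_eq by force

lemma a0_notin_Y: "a0 \<notin> Y"
proof
  assume a: "a0 \<in> Y"
  have "y ^ 2 = 1" if "y \<in> Y" for y
  proof -
    have "a0 * y = y * a0" using commutingD[OF pruefer_commuting[OF Y]] a that by blast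
    hence "y = inverse y" using a0_inverts[OF that] by (simp add: mult.assoc)
    thus ?thesis by (metis grp_right_inverse power2_eq_square)
  qed
  hence "{y \<in> Y. y ^ 2 = 1} = Y" by blast
  thus False using pruefer_bounded[OF Y, of 2] pruefer_infinite[OF Y] by simp
qed

sublocale swap: inverted_factor q B Y a0 G
proof
  show "G \<subseteq> B * (Y \<union> (\<lambda>x. x * a0) ` Y)"
    using G_BA unfolding A_eq[symmetric] by (metis mem_times subsetI)
  have "y * a0 \<notin> Y" if "y \<in> Y" for y
    using that a0_notin_Y subgrp_mult_left_iff[OF pruefer_subgrp[OF Y]] by blast
  thus "B \<inter> (\<lambda>x. x * a0) ` Y = {}"
    using AT_empty meet A_eq unfolding B_def by blast
qed (use B Y a0_inverts a0_square G AG a0_A A_eq B_in_G in auto)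

lemma swap_B: "swap.B = A"
  unfolding swap.B_def swap.T_def using A_eq by simp

lemma Y_A: "y \<in> Y \<Longrightarrow> y \<in> A" using A_eq by blast
lemma S_A: "s \<in> swap.T \<Longrightarrow> s \<in> A" using swap_B swap.B_def by blast
lemma A_cases: "a \<in> A \<Longrightarrow> (a \<in> Y \<Longrightarrow> P) \<Longrightarrow> (a \<in> swap.T \<Longrightarrow> P) \<Longrightarrow> P"
  using swap_B swap.B_def by blast

text \<open>If \<open>D\<close> misses \<open>T\<close>, then \<open>D = A X\<close> is a subgroup; if it meets \<open>T\<close>, it contains \<open>B\<close> and is
  all of \<open>G\<close>.\<close>
lemma overgroup:
  assumes "subgrp D" "A \<subseteq> D" "X \<subseteq> D" "D \<subseteq> G"
  shows "X * A \<subseteq> A * X \<or> D = G"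
proof (cases "D \<inter> T = {}")
  case True
  have "X * A \<subseteq> A * X"
  proof
    fix g assume g: "g \<in> X * A"
    hence gD: "g \<in> D" using assms by (auto simp: mem_times subset_eq intro: subgrp_mult)
    hence "g \<in> G" using assms by blast
    thus "g \<in> A * X"
    proof (cases rule: G_cases)
      case (2 a t)
      hence "t \<in> D" using gD assms subgrp_mult_left_iff by blast
      thus ?thesis using 2 True by blast
    qed (auto simp: mem_times)
  qed
  thus ?thesis ..
next
  case False
  then obtain t where t: "t \<in> D" "t \<in> T" by blast
  have "G \<subseteq> D"
  proof
    fix g assume "g \<in> G"
    thus "g \<in> D"
    proof (cases rule: G_cases)
      case (1 a x) thus ?thesis using assms subgrp_mult by blast
    next
      case (2 a u)
      have "u * inverse t \<in> D" using TT T_inverse t 2 assms by blast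
      hence "u * inverse t * t \<in> D" using assms subgrp_mult t by blast
      hence "u \<in> D" by (simp add: mult.assoc)
      thus ?thesis using 2 assms subgrp_mult by blast
    qed
  qed
  thus ?thesis using assms by blast
qed

text \<open>For \<open>c\<close> of finite order this is the normalizer in \<open>G\<close> of the cyclic group generated by
  \<open>c\<close>.\<close>
definition Nm where
  "Nm c = {g \<in> G. (\<exists>k::nat. g * c * inverse g = c ^ k) \<and> (\<exists>k::nat. inverse g * c * g = c ^ k)}"

lemma subgrp_Nm: "subgrp (Nm c)"
proof -
  have comp: "\<exists>k. (g * h) * c * inverse (g * h) = c ^ k"
    if "g * c * inverse g = c ^ k" "h * c * inverse h = c ^ l" for g h and k l :: nat
  proof -
    have "(g * h) * c * inverse (g * h) = g * (h * c * inverse h) * inverse g" by (simp add: grp_simps)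
    also have "\<dots> = (g * c * inverse g) ^ l" unfolding that(2) conj_power ..
    also have "\<dots> = c ^ (k * l)" unfolding that(1) by (simp add: power_mult)
    finally show ?thesis by blast
  qed
  show ?thesis
    unfolding subgrp_def
  proof (intro conjI ballI)
    show "1 \<in> Nm c" using G_one by (auto simp: Nm_def intro!: exI[of _ 1])
  next
    fix g h assume gh: "g \<in> Nm c" "h \<in> Nm c"
    have "\<exists>k::nat. (g * h) * c * inverse (g * h) = c ^ k"
      using gh comp[of g _ h] by (auto simp: Nm_def)
    moreover have "\<exists>k::nat. inverse (g * h) * c * (g * h) = c ^ k"
      using gh comp[of "inverse h" _ "inverse g"] by (auto simp: Nm_def grp_inverse_mult mult.assoc)
    ultimately show "g * h \<in> Nm c" using gh G_mult by (simp add: Nm_def)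
  next
    fix g assume "g \<in> Nm c"
    thus "inverse g \<in> Nm c" using G_inverse by (simp add: Nm_def)
  qed
qed

lemma Nm_power: "Nm c \<subseteq> Nm (c ^ k)"
proof
  fix g assume g: "g \<in> Nm c"
  then obtain i j :: nat where ij: "g * c * inverse g = c ^ i" "inverse g * c * g = c ^ j" by (auto simp: Nm_def)
  have "g * c ^ k * inverse g = (c ^ k) ^ i"
    using conj_power[of g c k] ij by (simp add: mult.commute flip: power_mult)
  moreover have "inverse g * c ^ k * g = (c ^ k) ^ j"
    using conj_power[of "inverse g" c k] ij by (simp add: mult.commute flip: power_mult)
  ultimately show "g \<in> Nm (c ^ k)" using g by (auto simp: Nm_def)
qed

lemma Y_inverse_power: "y \<in> Y \<Longrightarrow> \<exists>k::nat. inverse y = y ^ k"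
  using inverse_as_power pruefer_torsion[OF Y] by metis

lemma inverts_Nm:
  assumes "g \<in> G" "c \<in> Y" "g * c * inverse g = inverse c" shows "g \<in> Nm c"
proof -
  obtain k where k: "inverse c = c ^ k" using Y_inverse_power assms by blast
  have "inverse g * (g * c * inverse g) * g = inverse g * inverse c * g" using assms by simp
  hence "inverse c = inverse g * c * g" by (metis (no_types, lifting) grp_inverse_inverse grp_inverse_mult inv_mult_cancel mult.assoc grp_left_inverse mult.right_neutral)
  hence "g * c * inverse g = c ^ k" "inverse g * c * g = c ^ k" using assms k by simp_all
  thus ?thesis using assms(1) unfolding Nm_def by blast
qed

lemma A_Nm: assumes "c \<in> Y" shows "A \<subseteq> Nm c"
proof
  fix a assume "a \<in> A"
  thus "a \<in> Nm c"
  proof (rule A_cases)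
    assume a: "a \<in> Y"
    have ac: "a * c = c * a" by (rule swap.X_comm[OF a assms])
    have "a * c * inverse a = c" unfolding ac by (simp add: mult.assoc)
    moreover have "inverse a * c * a = inverse a * (a * c)" unfolding ac by (simp add: mult.assoc)
    hence "inverse a * c * a = c" by simp
    ultimately show ?thesis using a A_in_G Y_A by (auto simp: Nm_def intro!: exI[of _ 1])
  next
    assume a: "a \<in> swap.T"
    thus ?thesis using inverts_Nm swap.t_inverts assms A_in_G S_A by blast
  qed
qed

text \<open>The elements of \<open>Y\<close> that generate a normal subgroup of \<open>G\<close>. They form a subgroup of \<open>Y\<close>,
  so either all of \<open>Y\<close> is covered or there are only finitely many.\<close>
definition \<zeta> where "\<zeta> = {c \<in> Y. Nm c = G}"

lemma Nm_G: "Nm c \<subseteq> G" by (auto simp: Nm_def)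

lemma zeta_power: "c \<in> \<zeta> \<Longrightarrow> c ^ k \<in> \<zeta>"
  using Nm_power[of c k] Nm_G subgrp_power[OF swap.Xs] by (auto simp: \<zeta>_def)

lemma subgrp_zeta: "subgrp \<zeta>"
  unfolding subgrp_def
proof (intro conjI ballI)
  have "1 \<in> Nm 1" "Nm 1 = G" using G_one by (auto simp: Nm_def)
  thus "1 \<in> \<zeta>" using swap.X_one by (simp add: \<zeta>_def)
next
  fix c d assume cd: "c \<in> \<zeta>" "d \<in> \<zeta>"
  hence "c \<in> Y" "d \<in> Y" by (auto simp: \<zeta>_def)
  from pruefer_chain[OF Y this] show "c * d \<in> \<zeta>"
  proof (elim disjE exE)
    fix k assume "c = d ^ k"
    thus ?thesis using zeta_power[OF cd(2), of "Suc k"] by (simp add: power_commutes)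
  next
    fix k assume "d = c ^ k"
    thus ?thesis using zeta_power[OF cd(1), of "Suc k"] by simp
  qed
next
  fix c assume "c \<in> \<zeta>"
  thus "inverse c \<in> \<zeta>" using Y_inverse_power[of c] zeta_power[of c] by (auto simp: \<zeta>_def)
qed

text \<open>Here \<open>Y\<close> is normal in \<open>G\<close>. Squares of elements of \<open>G\<close> lie in \<open>Y B\<close>, as \<open>Y\<close> has index two
  in \<open>A\<close>, and squares of elements of \<open>Y B\<close> lie in \<open>Y X \<subseteq> A X\<close>. Every element of a conjugate of
  \<open>X\<close> is a fourth power.\<close>
lemma permutes_if_zeta_full:
  assumes full: "\<zeta> = Y" shows "X * A \<subseteq> A * X"
proof -
  have YN: "g * y * inverse g \<in> Y" if g: "g \<in> G" "y \<in> Y" for g y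
  proof -
    have "g \<in> Nm y" using full g by (auto simp: \<zeta>_def)
    thus ?thesis using subgrp_power[OF swap.Xs g(2)] by (auto simp: Nm_def)
  qed
  have YN': "inverse g * y * g \<in> Y" if g: "g \<in> G" "y \<in> Y" for g y
    using YN[OF G_inverse[OF g(1)] g(2)] by simp
  have sq_B: "g * g \<in> Y * B" if g: "g \<in> G" for g
  proof (cases "g \<in> Y * B")
    case True
    then obtain y \<beta> where y: "y \<in> Y" "\<beta> \<in> B" "g = y * \<beta>" by (auto simp: mem_times)
    have "g * g = (y * (\<beta> * y * inverse \<beta>)) * (\<beta> * \<beta>)" using y by (simp add: mult.assoc)
    moreover have "y * (\<beta> * y * inverse \<beta>) \<in> Y" using YN B_in_G y swap.X_mult by blast
    moreover have "\<beta> * \<beta> \<in> B" using subgrp_mult[OF B] y by blast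
    ultimately show ?thesis unfolding mem_times by blast
  next
    case False
    have form: "\<exists>y\<in>Y. \<exists>\<beta>\<in>B. h = y * a0 * \<beta>" if h: "h \<in> G" "h \<notin> Y * B" for h
    proof -
      obtain a \<beta> where a: "a \<in> A" "\<beta> \<in> B" "h = a * \<beta>" using G_cases[OF h(1)] unfolding B_def by (metis Un_iff)
      hence "a \<notin> Y" using h by (auto simp: mem_times)
      then obtain y where "y \<in> Y" "a = y * a0" using a A_eq by blast
      thus ?thesis using a by blast
    qed
    show ?thesis
    proof (rule ccontr)
      assume n: "g * g \<notin> Y * B"
      obtain y1 \<beta>1 where 1: "y1 \<in> Y" "\<beta>1 \<in> B" "g = y1 * a0 * \<beta>1" using form[OF g False] by blast
      obtain y2 \<beta>2 where 2: "y2 \<in> Y" "\<beta>2 \<in> B" "g * g = y2 * a0 * \<beta>2" using form[OF G_mult[OF g g] n] by blast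
      have "y2 * a0 * \<beta>2 = (y2 * inverse y1) * (y1 * a0 * \<beta>1) * (inverse \<beta>1 * \<beta>2)" by (simp add: mult.assoc)
      hence "g * g = (y2 * inverse y1) * g * (inverse \<beta>1 * \<beta>2)" unfolding 2(3) 1(3)[symmetric] .
      hence "inverse g * (g * g) = inverse g * ((y2 * inverse y1) * g * (inverse \<beta>1 * \<beta>2))" by simp
      hence "g = (inverse g * (y2 * inverse y1) * g) * (inverse \<beta>1 * \<beta>2)" by (simp add: mult.assoc)
      moreover have "inverse g * (y2 * inverse y1) * g \<in> Y" using YN' g swap.X_mult swap.X_inverse 1 2 by blast
      moreover have "inverse \<beta>1 * \<beta>2 \<in> B" using 1 2 subgrp_mult[OF B] subgrp_inverse[OF B] by blast
      ultimately show False using False unfolding mem_times by blast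
    qed
  qed
  have sq_X: "g * g \<in> A * X" if g: "g \<in> Y * B" for g
  proof -
    obtain y \<beta> where y: "y \<in> Y" "\<beta> \<in> B" "g = y * \<beta>" using g by (auto simp: mem_times)
    have "g * g = (y * (\<beta> * y * inverse \<beta>)) * (\<beta> * \<beta>)" using y by (simp add: mult.assoc)
    moreover have "y * (\<beta> * y * inverse \<beta>) \<in> A" using YN B_in_G y swap.X_mult Y_A by blast
    moreover have "\<beta> * \<beta> \<in> X" using TT X_mult y by (auto simp: B_def)
    ultimately show ?thesis using A_AX' by metis
  qed
  show ?thesis
  proof
    fix g assume "g \<in> X * A"
    then obtain x a where xa: "x \<in> X" "a \<in> A" "g = x * a" by (auto simp: mem_times)
    obtain m where m: "m \<in> X" "m ^ 4 = x" using pruefer_divisible[OF X, of 4 x] xa by auto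
    let ?u = "inverse a * m * a"
    have "?u \<in> G" using G_conj(2) A_in_G X_in_G m xa by blast
    hence "?u * ?u * (?u * ?u) \<in> A * X" using sq_X sq_B by blast
    moreover have "?u * ?u * (?u * ?u) = inverse a * x * a" unfolding m(2)[symmetric] by (simp add: mult.assoc power4_eq_xxxx)
    ultimately show "g \<in> A * X" using A_conj_AX xa by metis
  qed
qed

lemma permutes_if_X_normalizes:
  assumes "\<And>c. c \<in> Y \<Longrightarrow> X \<subseteq> Nm c" shows "X * A \<subseteq> A * X"
proof (cases "\<zeta> = Y")
  case False
  then obtain c where "c \<in> Y" "Nm c \<noteq> G" by (auto simp: \<zeta>_def)
  thus ?thesis using overgroup[OF subgrp_Nm A_Nm assms Nm_G] by blast
qed (rule permutes_if_zeta_full)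

lemma infinite_image_or_fibre:
  assumes "infinite W" obtains "infinite (f ` W)" | v where "infinite {w \<in> W. f w = v}"
  using pigeonhole_infinite[OF assms, of f] by blast

text \<open>Suppose the inclusion fails. Then \<open>\<zeta>\<close> is finite. Let \<open>\<Delta>\<close> be the normalizer of the smallest
  cyclic subgroup of \<open>Y\<close> that is not normal in \<open>G\<close>; it contains \<open>A\<close> and the normalizer of every
  other nonnormal cyclic subgroup of \<open>Y\<close>, and it meets \<open>X\<close> in a finite group. In the hypothesis
  of \<open>permutes_if_almost_stabilized\<close> consider the conjugates \<open>y \<sigma> y\<^sup>-\<^sup>1 = c t\<close> in \<open>A * T\<close>.
  Finitely many \<open>y\<close> have \<open>t \<in> \<Delta>\<close>. For the others \<open>t\<close> inverts \<open>c\<close>, so \<open>c \<in> Y\<close> would generate a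
  normal subgroup and force \<open>\<sigma> \<in> A * T\<close>. Thus \<open>c = s\<close> lies outside \<open>Y\<close>, and the square \<open>\<epsilon>\<close> of
  \<open>s\<close> is central. Pulling \<open>t\<close> back to \<open>t' = y\<^sup>-\<^sup>1 t y\<close> gives elements of \<open>T\<close> that all act on \<open>\<sigma>\<close>
  as multiplication by \<open>\<epsilon>\<close>. If infinitely many \<open>t'\<close> occur, infinitely many elements of \<open>X\<close>
  centralize \<open>\<sigma>\<close>, so all of \<open>X\<close> does. If one \<open>t'\<close> occurs infinitely often, then \<open>\<sigma> = s' t'\<close> with
  \<open>s'\<close> fixed, and the commutators of \<open>s1 = s y1\<close> with infinitely many \<open>x \<in> X\<close> lie in \<open>Y\<close> and are
  inverted by \<open>x t1\<close>; so almost all of them lie in the finite group \<open>\<zeta>\<close>, infinitely many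
  coincide, and \<open>X\<close> centralizes \<open>s1\<close>. In both cases \<open>\<sigma>\<close> normalizes \<open>X\<close>.\<close>
theorem permutes_nonabelian_central_square:
  assumes zc: z_central shows "X * A \<subseteq> A * X"
proof (rule ccontr)
  assume goal: "\<not> X * A \<subseteq> A * X"
  have fin: "finite (A \<inter> X)" using goal permutes_if_infinite_meet by blast
  have "\<zeta> \<noteq> Y" using goal permutes_if_zeta_full by blast
  hence fz: "finite \<zeta>" by (intro pruefer_subgroup[OF Y subgrp_zeta]) (auto simp: \<zeta>_def)
  define pw where "pw c = {c ^ k | k::nat. True}" for c :: 'a
  have fpw: "finite (pw c)" if "c \<in> Y" for c
    using finite_powers(1) pruefer_torsion[OF Y that] unfolding pw_def by metis
  obtain c1 where c1: "c1 \<in> Y - \<zeta>" "\<And>c. c \<in> Y - \<zeta> \<Longrightarrow> card (pw c1) \<le> card (pw c)"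
  proof -
    have "\<exists>c. c \<in> Y - \<zeta>" using \<open>\<zeta> \<noteq> Y\<close> by (auto simp: \<zeta>_def)
    then obtain c where "c \<in> Y - \<zeta>" ..
    from ex_has_least_nat[of "\<lambda>c. c \<in> Y - \<zeta>", OF this, of "\<lambda>c. card (pw c)"] show ?thesis using that by blast
  qed
  have c1_power: "\<exists>k::nat. c1 = c ^ k" if c: "c \<in> Y - \<zeta>" for c
  proof (rule ccontr)
    assume n: "\<not> (\<exists>k::nat. c1 = c ^ k)"
    then obtain k :: nat where k: "c = c1 ^ k" using pruefer_chain[OF Y, of c1 c] c c1 by blast
    have sub: "pw c \<subseteq> pw c1" unfolding k pw_def by (auto simp flip: power_mult)
    have "pw c = pw c1" by (rule card_seteq[OF fpw sub c1(2)[OF c]]) (use c1 in blast)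
    moreover have "c1 \<in> pw c1" unfolding pw_def by (auto intro!: exI[of _ 1])
    ultimately show False using n by (auto simp: pw_def)
  qed
  define \<Delta> where "\<Delta> = Nm c1"
  have \<Delta>: "subgrp \<Delta>" "A \<subseteq> \<Delta>" "\<Delta> \<subseteq> G" using subgrp_Nm A_Nm c1 Nm_G by (auto simp: \<Delta>_def)
  have Nm_\<Delta>: "Nm c \<subseteq> \<Delta>" if "c \<in> Y" "c \<notin> \<zeta>" for c
    using c1_power[of c] that Nm_power unfolding \<Delta>_def by blast
  have \<Delta>X: "finite (\<Delta> \<inter> X)"
  proof (rule pruefer_subgroup[OF X subgrp_Int[OF \<Delta>(1) Xs]])
    show "\<Delta> \<inter> X \<noteq> X" using overgroup[OF \<Delta>(1,2) _ \<Delta>(3)] goal c1 by (auto simp: \<Delta>_def \<zeta>_def)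
  qed auto
  have "X * A \<subseteq> A * X"
  proof (rule permutes_if_almost_stabilized[OF fin zc])
    fix \<sigma> assume \<sigma>: "\<sigma> \<in> I" "\<sigma> \<in> A * X"
    show "(\<forall>x\<in>X. \<sigma> * x * inverse \<sigma> \<in> X) \<or> finite {y \<in> X. y * \<sigma> * inverse y \<in> A * T}"
    proof (rule ccontr)
      assume "\<not> ((\<forall>x\<in>X. \<sigma> * x * inverse \<sigma> \<in> X) \<or> finite {y \<in> X. y * \<sigma> * inverse y \<in> A * T})"
      hence no: "\<not> (\<forall>x\<in>X. \<sigma> * x * inverse \<sigma> \<in> X)" and inf: "infinite {y \<in> X. y * \<sigma> * inverse y \<in> A * T}" by auto
      define W where "W = {y \<in> X. y * \<sigma> * inverse y \<in> A * T} - {y \<in> X. y * \<sigma> * inverse y \<in> \<Delta>}"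
      have W: "infinite W" unfolding W_def using inf stabilizer_finite[OF \<Delta>(1,2) \<Delta>X fin \<sigma>(1)] by simp
      have "\<exists>s t. s \<in> swap.T \<and> t \<in> T \<and> t \<notin> \<Delta> \<and> y * \<sigma> * inverse y = s * t \<and> t * s * inverse t = inverse s" if y: "y \<in> W" for y
      proof -
        have yX: "y \<in> X" using y by (auto simp: W_def)
        obtain c t where c: "c \<in> A" "t \<in> T" "y * \<sigma> * inverse y = c * t" using y by (auto simp: W_def mem_times)
        have t\<Delta>: "t \<notin> \<Delta>" using y c \<Delta> subgrp_mult[OF \<Delta>(1)] by (auto simp: W_def)
        have i: "c * t \<in> I" using I_conj[OF \<sigma>(1) X_in_G[OF yX]] c by simp
        have tct: "t * c * inverse t = inverse c" by (rule T_inverts_left_part[OF i c(2) zc])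
        have "c \<notin> Y"
        proof
          assume cY: "c \<in> Y"
          have "c \<in> \<zeta>"
          proof (rule ccontr)
            assume "c \<notin> \<zeta>"
            thus False using Nm_\<Delta>[OF cY] inverts_Nm[OF T_in_G[OF c(2)] cY tct] t\<Delta> by blast
          qed
          hence "inverse y \<in> Nm c" using X_in_G X_inverse yX by (auto simp: \<zeta>_def)
          hence "inverse y * c * y \<in> A" using subgrp_power[OF A c(1)] by (auto simp: Nm_def)
          moreover have "inverse y * t * y \<in> T" using XT TX X_inverse yX c by blast
          moreover have "\<sigma> = inverse y * (c * t) * y" unfolding c(3)[symmetric] by (simp add: mult.assoc)
          hence "\<sigma> = (inverse y * c * y) * (inverse y * t * y)" by (simp add: mult.assoc)
          ultimately have "\<sigma> \<in> A * T" using A_AT' by metis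
          thus False using \<sigma> AX_AT AX_in_G by blast
        qed
        hence "c \<in> swap.T" using c A_cases by blast
        thus ?thesis using c t\<Delta> tct by blast
      qed
      then obtain s t where st: "\<And>y. y \<in> W \<Longrightarrow> s y \<in> swap.T \<and> t y \<in> T \<and> t y \<notin> \<Delta> \<and> y * \<sigma> * inverse y = s y * t y \<and> t y * s y * inverse (t y) = inverse (s y)"
        by metis
      define \<epsilon> where "\<epsilon> = swap.z"
      have \<epsilon>Y: "\<epsilon> \<in> Y" using swap.z_X by (simp add: \<epsilon>_def)
      have ss: "u * u = \<epsilon>" "inverse u = \<epsilon> * u" if "u \<in> swap.T" for u
        using swap.t_square swap.inverse_t that by (auto simp: \<epsilon>_def)
      have \<epsilon>\<epsilon>: "\<epsilon> * \<epsilon> = 1" "inverse \<epsilon> = \<epsilon>" using swap.z_z swap.inverse_z by (auto simp: \<epsilon>_def)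
      have \<epsilon>\<zeta>: "\<epsilon> \<in> \<zeta>"
      proof (rule ccontr)
        assume n: "\<epsilon> \<notin> \<zeta>"
        obtain y where y: "y \<in> W" using W by (metis ex_in_conv finite.emptyI)
        have "t y * \<epsilon> * inverse (t y) = (t y * s y * inverse (t y)) * (t y * s y * inverse (t y))"
          unfolding ss(1)[OF conjunct1[OF st[OF y]], symmetric] by (simp add: mult.assoc)
        also have "\<dots> = inverse \<epsilon>" using ss(1)[of "s y"] st[OF y] by (simp flip: grp_inverse_mult)
        finally have "t y \<in> Nm \<epsilon>" by (rule inverts_Nm[rotated 2]) (use st[OF y] T_in_G \<epsilon>Y in auto)
        thus False using Nm_\<Delta>[OF \<epsilon>Y n] st[OF y] by blast
      qed
      \<comment> \<open>A normal subgroup of order at most two is central.\<close>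
      have \<epsilon>c: "\<epsilon> * g = g * \<epsilon>" if g: "g \<in> G" for g
      proof (cases "\<epsilon> = 1")
        case False
        have "g \<in> Nm \<epsilon>" using \<epsilon>\<zeta> g by (auto simp: \<zeta>_def)
        then obtain k :: nat where k: "g * \<epsilon> * inverse g = \<epsilon> ^ k" by (auto simp: Nm_def)
        have "\<epsilon> ^ k = (if even k then 1 else \<epsilon>)"
        proof (induction k)
          case (Suc k) thus ?case using \<epsilon>\<epsilon> by auto
        qed simp
        moreover have "g * \<epsilon> * inverse g \<noteq> 1"
        proof
          assume "g * \<epsilon> * inverse g = 1"
          hence "inverse g * (g * \<epsilon> * inverse g) * g = inverse g * 1 * g" by simp
          thus False using False by (simp add: mult.assoc)
        qed
        ultimately have "g * \<epsilon> * inverse g = \<epsilon>" using k by metis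
        thus ?thesis by (metis grp_left_inverse mult.assoc mult.right_neutral)
      qed simp
      define t' where "t' y = inverse y * t y * y" for y
      have t'T: "t' y \<in> T" if "y \<in> W" for y
        using st[OF that] XT TX X_inverse that unfolding t'_def W_def by blast
      have t'\<sigma>: "t' y * \<sigma> * inverse (t' y) = \<epsilon> * \<sigma>" if y: "y \<in> W" for y
      proof -
        have yG: "y \<in> G" using y X_in_G by (auto simp: W_def)
        have \<sigma>y: "\<sigma> = inverse y * (s y * t y) * y" using st[OF y] by (metis (no_types, lifting) grp_left_inverse inv_mult_cancel mult.assoc mult.right_neutral)
        have "t' y * \<sigma> * inverse (t' y) = inverse y * (t y * s y * inverse (t y)) * t y * y"
          unfolding \<sigma>y t'_def by (simp add: grp_simps)
        also have "t y * s y * inverse (t y) = \<epsilon> * s y" using ss st[OF y] by simp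
        also have "inverse y * (\<epsilon> * s y) * t y * y = \<epsilon> * \<sigma>"
          using \<epsilon>c[OF G_inverse[OF yG]] unfolding \<sigma>y by (simp add: mult.assoc) (metis mult.assoc)
        finally show ?thesis .
      qed
      show False
      proof (cases rule: infinite_image_or_fibre[OF W, of t'])
        case 1
        obtain y0 where y0: "y0 \<in> W" using W by (metis ex_in_conv finite.emptyI)
        have "(\<lambda>u. u * inverse (t' y0)) ` t' ` W \<subseteq> centralizer {\<sigma>} \<inter> X"
        proof clarify
          fix y assume y: "y \<in> W"
          have "t' y * inverse (t' y0) \<in> X" using TT T_inverse t'T y y0 by blast
          moreover have "(t' y * inverse (t' y0)) * \<sigma> = \<sigma> * (t' y * inverse (t' y0))"
          proof -
            have "\<sigma> = inverse (t' y0) * (\<epsilon> * \<sigma>) * t' y0" using t'\<sigma>[OF y0]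
              by (metis (no_types, lifting) grp_left_inverse inv_mult_cancel mult.assoc mult.right_neutral)
            also have "\<dots> = \<epsilon> * (inverse (t' y0) * \<sigma> * t' y0)"
              using \<epsilon>c[OF G_inverse[OF T_in_G[OF t'T[OF y0]]]] by (metis mult.assoc)
            finally have e: "inverse (t' y0) * \<sigma> * t' y0 = \<epsilon> * \<sigma>" using \<epsilon>\<epsilon> by (metis inv_mult_cancel)
            have "(t' y * inverse (t' y0)) * \<sigma> * inverse (t' y * inverse (t' y0)) = t' y * (inverse (t' y0) * \<sigma> * t' y0) * inverse (t' y)"
              by (simp add: grp_simps)
            also have "\<dots> = \<epsilon> * (t' y * \<sigma> * inverse (t' y))" unfolding e using \<epsilon>c[OF T_in_G[OF t'T[OF y]]] by (metis mult.assoc)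
            also have "\<dots> = \<sigma>" unfolding t'\<sigma>[OF y] using \<epsilon>\<epsilon> by (metis mult.assoc mult.left_neutral)
            finally show ?thesis by (metis grp_left_inverse mult.assoc mult.right_neutral)
          qed
          ultimately show "t' y * inverse (t' y0) \<in> centralizer {\<sigma>} \<inter> X" by (simp add: centralizer_def)
        qed
        moreover have "inj_on (\<lambda>u. u * inverse (t' y0)) (t' ` W)" by (auto simp: inj_on_def grp_right_cancel)
        ultimately have "infinite (centralizer {\<sigma>} \<inter> X)" using 1 finite_imageD finite_subset by blast
        hence "centralizer {\<sigma>} \<inter> X = X" using pruefer_subgroup[OF X subgrp_Int[OF subgrp_centralizer Xs]] by blast
        hence "x * \<sigma> = \<sigma> * x" if "x \<in> X" for x using that by (auto simp: centralizer_def)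
        hence "\<forall>x\<in>X. \<sigma> * x * inverse \<sigma> \<in> X" by (metis grp_right_inverse mult.assoc mult.right_neutral)
        thus False using no by blast
      next
        case (2 v)
        define W3 where "W3 = {y \<in> W. t' y = v}"
        have W3: "infinite W3" using 2 by (simp add: W3_def)
        obtain y1 where y1: "y1 \<in> W3" using W3 by (metis ex_in_conv finite.emptyI)
        have y1W: "y1 \<in> W" "y1 \<in> X" and v: "v = t' y1" using y1 by (auto simp: W3_def W_def)
        define s' where "s' = \<sigma> * inverse v"
        have sy: "s y = y * s' * inverse y" if y: "y \<in> W3" for y
        proof -
          have "y \<in> W" "v = t' y" using y by (auto simp: W3_def)
          hence "s y * t y = y * \<sigma> * inverse y" "v = inverse y * t y * y" using st by (auto simp: t'_def)
          hence "y * s' * inverse y = (s y * t y) * inverse (t y)" unfolding s'_def by (simp add: grp_simps)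
          thus ?thesis by (simp add: mult.assoc)
        qed
        define s1 where "s1 = s y1"
        define t1 where "t1 = t y1"
        have s1: "s1 \<in> swap.T" "t1 \<in> T" "t1 \<notin> \<Delta>" "t1 * s1 * inverse t1 = \<epsilon> * s1"
          using st[OF y1W(1)] ss by (auto simp: s1_def t1_def)
        have s1G: "s1 \<in> G" using s1 S_A A_in_G by blast
        have t1G: "t1 \<in> G" using s1 T_in_G by blast
        define XX where "XX = (\<lambda>y. y * inverse y1) ` W3"
        have XX: "infinite XX" "XX \<subseteq> X"
        proof -
          have "inj_on (\<lambda>y. y * inverse y1) W3" by (auto simp: inj_on_def grp_right_cancel)
          thus "infinite XX" unfolding XX_def using W3 finite_imageD by blast
          show "XX \<subseteq> X" unfolding XX_def using X_mult X_inverse y1W by (auto simp: W3_def W_def)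
        qed
        \<comment> \<open>\<open>s1\<close> and its conjugate by \<open>x \<in> XX\<close> lie in the same coset of \<open>Y\<close> in \<open>A\<close>.\<close>
        define e where "e x = x * s1 * inverse x * inverse s1" for x
        have eY: "e x \<in> Y" if xX: "x \<in> XX" for x
        proof -
          obtain y where y: "y \<in> W3" "x = y * inverse y1" using xX by (auto simp: XX_def)
          have "x * s1 * inverse x = s y" unfolding s1_def sy[OF y1] sy[OF y(1)] y(2) by (simp add: grp_simps)
          moreover have "s y \<in> swap.T" using st y by (auto simp: W3_def)
          ultimately show ?thesis unfolding e_def using swap.TT swap.T_inverse s1 by metis
        qed
        have e_inv: "(x * t1) * e x * inverse (x * t1) = inverse (e x)" if x: "x \<in> XX" for x
        proof -
          have xX: "x \<in> X" using x XX by blast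
          have tx: "t1 * x * inverse t1 = inverse x" "t1 * inverse x * inverse t1 = x"
            using t_inverts[OF s1(2) xX] t_inverts[OF s1(2) X_inverse[OF xX]] by simp_all
          have ts: "t1 * inverse s1 * inverse t1 = inverse s1 * \<epsilon>"
          proof -
            have "t1 * inverse s1 * inverse t1 = inverse (t1 * s1 * inverse t1)" by (simp add: grp_simps)
            thus ?thesis unfolding s1(4) using \<epsilon>\<epsilon> by (simp add: grp_inverse_mult)
          qed
          have "t1 * e x * inverse t1 = (t1 * x * inverse t1) * (t1 * s1 * inverse t1) * (t1 * inverse x * inverse t1) * (t1 * inverse s1 * inverse t1)"
            by (simp add: e_def mult.assoc)
          also have "\<dots> = inverse x * (\<epsilon> * s1) * x * (inverse s1 * \<epsilon>)" unfolding tx ts s1(4) ..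
          also have "\<dots> = \<epsilon> * (inverse x * s1 * x * inverse s1) * \<epsilon>" using \<epsilon>c[OF X_in_G[OF X_inverse[OF xX]]] by (metis mult.assoc)
          also have "\<dots> = \<epsilon> * \<epsilon> * (inverse x * s1 * x * inverse s1)"
          proof -
            have "inverse x * s1 * x * inverse s1 \<in> G" by (intro G_mult G_inverse s1G X_in_G xX)
            hence c: "\<epsilon> * (inverse x * s1 * x * inverse s1) = (inverse x * s1 * x * inverse s1) * \<epsilon>" by (rule \<epsilon>c)
            have "\<epsilon> * w * \<epsilon> = \<epsilon> * \<epsilon> * w" if "\<epsilon> * w = w * \<epsilon>" for w using that by (metis mult.assoc)
            from this[OF c] show ?thesis .
          qed
          also have "\<dots> = inverse x * s1 * x * inverse s1" using \<epsilon>\<epsilon> by simp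
          finally have te: "t1 * e x * inverse t1 = inverse x * s1 * x * inverse s1" .
          have "(x * t1) * e x * inverse (x * t1) = x * (t1 * e x * inverse t1) * inverse x" by (simp add: grp_simps)
          also have "\<dots> = x * (inverse x * s1 * x * inverse s1) * inverse x" unfolding te ..
          also have "\<dots> = inverse (e x)" by (simp add: e_def grp_simps)
          finally show ?thesis .
        qed
        have fin\<Delta>: "finite {x \<in> XX. e x \<notin> \<zeta>}"
        proof (cases "{x \<in> XX. e x \<notin> \<zeta>} = {}")
          case False
          have D: "x * t1 \<in> \<Delta>" if "x \<in> XX" "e x \<notin> \<zeta>" for x
          proof -
            have "x * t1 \<in> G" using that XX X_in_G t1G G_mult by blast
            thus ?thesis using inverts_Nm[OF _ eY e_inv] Nm_\<Delta>[OF eY] that by blast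
          qed
          obtain x1 where x1: "x1 \<in> XX" "e x1 \<notin> \<zeta>" using False by blast
          have "{x \<in> XX. e x \<notin> \<zeta>} \<subseteq> (\<lambda>u. u * x1) ` (\<Delta> \<inter> X)"
          proof
            fix x assume x: "x \<in> {x \<in> XX. e x \<notin> \<zeta>}"
            have "(x * t1) * inverse (x1 * t1) \<in> \<Delta>"
              using D x x1 subgrp_mult[OF \<Delta>(1)] subgrp_inverse[OF \<Delta>(1)] by simp
            hence "x * inverse x1 \<in> \<Delta>" by (simp add: grp_simps)
            moreover have "x * inverse x1 \<in> X" using x x1 XX X_mult X_inverse by blast
            moreover have "x = (x * inverse x1) * x1" by (simp add: mult.assoc)
            ultimately show "x \<in> (\<lambda>u. u * x1) ` (\<Delta> \<inter> X)" by blast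
          qed
          thus ?thesis using \<Delta>X finite_subset by blast
        next
          case True
          show ?thesis unfolding True by simp
        qed
        have "infinite (XX - {x \<in> XX. e x \<notin> \<zeta>})" using XX fin\<Delta> by simp
        moreover have "finite (e ` (XX - {x \<in> XX. e x \<notin> \<zeta>}))" by (rule finite_subset[OF _ fz]) auto
        ultimately have "\<exists>x0\<in>XX - {x \<in> XX. e x \<notin> \<zeta>}. infinite {x \<in> XX - {x \<in> XX. e x \<notin> \<zeta>}. e x = e x0}"
          by (rule pigeonhole_infinite)
        then obtain e0 where "infinite {x \<in> XX - {x \<in> XX. e x \<notin> \<zeta>}. e x = e0}" by blast
        then have "infinite {x \<in> XX. e x = e0}" by (rule contrapos_nn) (rule finite_subset[rotated], auto)
        then obtain V where V: "infinite V" "V \<subseteq> XX" "\<And>x. x \<in> V \<Longrightarrow> e x = e0" by (rule that) auto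
        obtain x1 where x1: "x1 \<in> V" using V by (metis ex_in_conv finite.emptyI)
        have "(\<lambda>u. inverse x1 * u) ` V \<subseteq> centralizer {s1} \<inter> X"
        proof clarify
          fix x assume x: "x \<in> V"
          have "e x = e x1" using V x x1 by simp
          hence "x * s1 * inverse x = x1 * s1 * inverse x1" unfolding e_def using grp_right_cancel by blast
          hence "inverse x1 * (x * s1 * inverse x) * x = inverse x1 * (x1 * s1 * inverse x1) * x" by simp
          hence "(inverse x1 * x) * s1 = s1 * (inverse x1 * x)" by (simp add: mult.assoc)
          moreover have "inverse x1 * x \<in> X" by (rule X_mult[OF X_inverse]) (use x x1 V(2) XX(2) in blast)+
          ultimately show "inverse x1 * x \<in> centralizer {s1} \<inter> X" by (simp add: centralizer_def)
        qed
        moreover have "inj_on (\<lambda>u. inverse x1 * u) V" by (auto simp: inj_on_def grp_left_cancel)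
        ultimately have "infinite (centralizer {s1} \<inter> X)" using V(1) finite_imageD finite_subset by blast
        hence c: "centralizer {s1} \<inter> X = X" using pruefer_subgroup[OF X subgrp_Int[OF subgrp_centralizer Xs]] by blast
        hence xs: "x * s1 = s1 * x" if "x \<in> X" for x using that by (auto simp: centralizer_def)
        have "s1 = s'"
        proof -
          have "y1 * s1 = y1 * s'" using xs[OF y1W(2)] sy[OF y1] unfolding s1_def[symmetric] by (simp add: mult.assoc)
          thus ?thesis using grp_left_cancel by blast
        qed
        hence \<sigma>s: "\<sigma> = s1 * v" by (simp add: s'_def mult.assoc)
        have "\<forall>x\<in>X. \<sigma> * x * inverse \<sigma> \<in> X"
        proof
          fix x assume x: "x \<in> X"
          have "v \<in> T" using t'T y1W v by blast
          have "\<sigma> * x * inverse \<sigma> = s1 * (v * x * inverse v) * inverse s1" unfolding \<sigma>s by (simp add: grp_simps)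
          also have "\<dots> = inverse x" unfolding t_inverts[OF \<open>v \<in> T\<close> x] using xs[OF X_inverse[OF x]]
            by (metis grp_right_inverse mult.assoc mult.right_neutral)
          finally show "\<sigma> * x * inverse \<sigma> \<in> X" using X_inverse x by simp
        qed
        thus False using no by blast
      qed
    qed
  qed
  thus False using goal by blast
qed

end

section \<open>Ito's theorem\<close>

definition cm :: "'a::grp \<Rightarrow> 'a \<Rightarrow> 'a" where "cm a b = a * b * inverse a * inverse b"

lemma conj_eq_cm: "g * h * inverse g = cm g h * h"
  by (simp add: cm_def mult.assoc)

lemma cm_eq_one_iff: "cm a b = 1 \<longleftrightarrow> a * b = b * a"
proof
  assume "cm a b = 1"
  hence "cm a b * (b * a) = b * a" by simp
  thus "a * b = b * a" by (simp add: cm_def mult.assoc)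
next
  assume "a * b = b * a"
  thus "cm a b = 1" by (simp add: cm_def) (simp add: mult.assoc)
qed

lemma product_swap:
  assumes "subgrp X" "subgrp Y" "subgrp H" "H = X * Y" "h \<in> H"
  obtains y x where "y \<in> Y" "x \<in> X" "h = y * x"
proof -
  have "inverse h \<in> X * Y" using subgrp_inverse assms by blast
  then obtain x y where "x \<in> X" "y \<in> Y" "inverse h = x * y" by (auto simp: mem_times)
  hence "h = inverse y * inverse x" by (metis grp_inverse_inverse grp_inverse_mult)
  thus ?thesis using that subgrp_inverse assms \<open>x \<in> X\<close> \<open>y \<in> Y\<close> by blast
qed

locale abelian_product =
  fixes X Y H :: "'a::grp set"
  assumes X: "subgrp X" "commuting X" and Y: "subgrp Y" "commuting Y" and H: "subgrp H" "H = X * Y"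
begin

text \<open>The commutator group of \<open>X\<close> and \<open>Y\<close>, which turns out to contain all commutators of \<open>H\<close>.\<close>
definition M where "M = gen {cm x y | x y. x \<in> X \<and> y \<in> Y}"

lemma XH: "x \<in> X \<Longrightarrow> x \<in> H" and YH: "y \<in> Y \<Longrightarrow> y \<in> H"
  unfolding H(2) mem_times using subgrp_one[OF X(1)] subgrp_one[OF Y(1)] by force+

text \<open>Ito's computation: let \<open>b1 a b1\<^sup>-\<^sup>1 = a3 b3\<close> and \<open>a1 b a1\<^sup>-\<^sup>1 = b2 a2\<close> with factors in \<open>X\<close>
  and \<open>Y\<close>. Because \<open>X\<close> and \<open>Y\<close> are abelian, \<open>b3\<close> and \<open>a2\<close> drop out of the commutators, and both
  conjugates of \<open>cm a b\<close> are equal to \<open>cm a3 b2\<close>.\<close>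
lemma cm_twist:
  assumes "a \<in> X" "a1 \<in> X" "b \<in> Y" "b1 \<in> Y"
  shows "(a1 * b1) * cm a b * inverse (a1 * b1) = (b1 * a1) * cm a b * inverse (b1 * a1)"
proof -
  note Hm = subgrp_mult[OF H(1)] subgrp_inverse[OF H(1)]
  have "b1 * a * inverse b1 \<in> H" using assms XH YH by (intro Hm) auto
  then obtain a3 b3 where 3: "a3 \<in> X" "b3 \<in> Y" "b1 * a * inverse b1 = a3 * b3" unfolding H(2) mem_times by blast
  have "a1 * b * inverse a1 \<in> H" using assms XH YH by (intro Hm) auto
  then obtain a2 b2 where 2: "b2 \<in> Y" "a2 \<in> X" "a1 * b * inverse a1 = b2 * a2"
    using product_swap[OF X(1) Y(1) H] by metis
  have XX: "u * v = v * u" if "u \<in> X" "v \<in> X" for u v using commutingD[OF X(2)] that by blast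
  have YY: "u * v = v * u" if "u \<in> Y" "v \<in> Y" for u v using commutingD[OF Y(2)] that by blast
  have cX: "u * v * inverse u = v" if "u \<in> X" "v \<in> X" for u v unfolding XX[OF that] by (simp add: mult.assoc)
  have cY: "u * v * inverse u = v" if "u \<in> Y" "v \<in> Y" for u v unfolding YY[OF that] by (simp add: mult.assoc)
  have conj: "g * cm u v * inverse g = cm (g * u * inverse g) (g * v * inverse g)" for g u v :: 'a
    by (simp add: cm_def grp_simps)
  have red1: "cm (a' * b') b'' = cm a' b''" if "b' \<in> Y" "b'' \<in> Y" for a' b' b''
  proof -
    have "cm (a' * b') b'' = a' * (b' * b'' * inverse b') * inverse a' * inverse b''" by (simp add: cm_def grp_simps)
    thus ?thesis unfolding cY[OF that] by (simp add: cm_def)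
  qed
  have red2: "cm a' (b' * a'') = cm a' b'" if "a' \<in> X" "a'' \<in> X" for a' a'' b'
  proof -
    have "cm a' (b' * a'') = a' * b' * (a'' * inverse a' * inverse a'') * inverse b'" by (simp add: cm_def grp_simps)
    thus ?thesis unfolding cX[OF that(2) subgrp_inverse[OF X(1) that(1)]] by (simp add: cm_def)
  qed
  have "(a1 * b1) * cm a b * inverse (a1 * b1) = a1 * (b1 * cm a b * inverse b1) * inverse a1" by (simp add: grp_simps)
  also have "b1 * cm a b * inverse b1 = cm (a3 * b3) b" unfolding conj 3(3) cY[OF assms(4,3)] ..
  also have "\<dots> = cm a3 b" by (rule red1) (use 3 assms in auto)
  also have "a1 * cm a3 b * inverse a1 = cm a3 (b2 * a2)" unfolding conj 2(3) cX[OF assms(2) 3(1)] ..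
  also have "\<dots> = cm a3 b2" by (rule red2) (use 2 3 in auto)
  finally have 1: "(a1 * b1) * cm a b * inverse (a1 * b1) = cm a3 b2" .
  have "(b1 * a1) * cm a b * inverse (b1 * a1) = b1 * (a1 * cm a b * inverse a1) * inverse b1" by (simp add: grp_simps)
  also have "a1 * cm a b * inverse a1 = cm a (b2 * a2)" unfolding conj 2(3) cX[OF assms(2,1)] ..
  also have "\<dots> = cm a b2" by (rule red2) (use 2 assms in auto)
  also have "b1 * cm a b2 * inverse b1 = cm (a3 * b3) b2" unfolding conj 3(3) cY[OF assms(4) 2(1)] ..
  also have "\<dots> = cm a3 b2" by (rule red1) (use 2 3 in auto)
  finally show ?thesis using 1 by simp
qed

text \<open>By \<open>cm_twist\<close>, the products \<open>c\<^sup>-\<^sup>1 d\<^sup>-\<^sup>1\<close> and \<open>d\<^sup>-\<^sup>1 c\<^sup>-\<^sup>1\<close> conjugate \<open>cm a b\<close> alike, and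
  the quotient of these two products is \<open>cm c d\<close>.\<close>
lemma M_commuting: "commuting M"
  unfolding M_def
proof (rule commuting_gen)
  have "cm a b * cm c d = cm c d * cm a b" if "a \<in> X" "b \<in> Y" "c \<in> X" "d \<in> Y" for a b c d
  proof -
    let ?u = "inverse c * inverse d" and ?v = "inverse d * inverse c"
    have "?u * cm a b * inverse ?u = ?v * cm a b * inverse ?v"
      by (rule cm_twist) (use that subgrp_inverse X Y in auto)
    hence "inverse ?v * (?u * cm a b * inverse ?u) * ?u = inverse ?v * (?v * cm a b * inverse ?v) * ?u" by simp
    hence "cm c d * cm a b = cm a b * cm c d" by (simp add: cm_def grp_simps)
    thus ?thesis by simp
  qed
  thus "commuting {cm x y |x y. x \<in> X \<and> y \<in> Y}" by (auto simp: commuting_def)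
qed

lemma M_subgrp: "subgrp M" by (simp add: M_def subgrp_gen)
lemma cm_M: "x \<in> X \<Longrightarrow> y \<in> Y \<Longrightarrow> cm x y \<in> M" unfolding M_def by (rule gen_incl) blast
lemma cm_M': "x \<in> X \<Longrightarrow> y \<in> Y \<Longrightarrow> cm y x \<in> M"
  using subgrp_inverse[OF M_subgrp cm_M[of x y]] by (simp add: cm_def grp_simps)

lemma M_normal: assumes "h \<in> H" "m \<in> M" shows "h * m * inverse h \<in> M"
proof -
  note Mm = subgrp_mult[OF M_subgrp] subgrp_inverse[OF M_subgrp]
  have x: "x * m * inverse x \<in> M" if "x \<in> X" "m \<in> M" for x m
    using that(2) unfolding M_def
  proof (rule gen_conj[rotated])
    fix s assume "s \<in> {cm x y |x y. x \<in> X \<and> y \<in> Y}"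
    then obtain u y where u: "u \<in> X" "y \<in> Y" "s = cm u y" by blast
    have "x * s * inverse x = cm (x * u) y * inverse (cm x y)" by (simp add: u cm_def grp_simps)
    thus "x * s * inverse x \<in> gen {cm x y |x y. x \<in> X \<and> y \<in> Y}"
      using Mm(1)[OF cm_M[OF subgrp_mult[OF X(1) that(1) u(1)] u(2)] Mm(2)[OF cm_M[OF that(1) u(2)]]] by (simp add: M_def)
  qed
  have y: "y * m * inverse y \<in> M" if "y \<in> Y" "m \<in> M" for y m
    using that(2) unfolding M_def
  proof (rule gen_conj[rotated])
    fix s assume "s \<in> {cm x y |x y. x \<in> X \<and> y \<in> Y}"
    then obtain x v where u: "x \<in> X" "v \<in> Y" "s = cm x v" by blast
    have "y * s * inverse y = inverse (cm x y) * cm x (y * v)" by (simp add: u cm_def grp_simps)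
    thus "y * s * inverse y \<in> gen {cm x y |x y. x \<in> X \<and> y \<in> Y}"
      using Mm(1)[OF Mm(2)[OF cm_M[OF u(1) that(1)]] cm_M[OF u(1) subgrp_mult[OF Y(1) that(1) u(2)]]] by (simp add: M_def)
  qed
  obtain u v where uv: "u \<in> X" "v \<in> Y" "h = u * v" using assms unfolding H(2) mem_times by blast
  have "h * m * inverse h = u * (v * m * inverse v) * inverse u" unfolding uv by (simp add: grp_simps)
  thus ?thesis using x y uv assms by metis
qed

lemma cm_H_M: assumes "g \<in> H" "h \<in> H" shows "cm g h \<in> M"
proof -
  obtain x y where g: "x \<in> X" "y \<in> Y" "g = x * y" using assms unfolding H(2) mem_times by blast
  obtain x' y' where h: "x' \<in> X" "y' \<in> Y" "h = x' * y'" using assms unfolding H(2) mem_times by blast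
  have xx: "x * x' = x' * x" "y * y' = y' * y" using g h commutingD[OF X(2)] commutingD[OF Y(2)] by auto
  have one: "inverse x' * inverse x * x' * x = 1"
    using xx(1) by (metis grp_inverse_mult grp_left_inverse mult.assoc)
  have "(x * cm y x' * inverse x) * (x' * cm x y' * inverse x') =
     x * y * x' * inverse y * (inverse x' * inverse x * x' * x) * y' * inverse x * inverse y' * inverse x'"
    by (simp add: cm_def grp_simps)
  also have "\<dots> = x * y * x' * (inverse y * y') * inverse x * inverse y' * inverse x'" unfolding one by (simp add: mult.assoc)
  also have "inverse y * y' = y' * inverse y" by (rule commute_inverse) (rule xx(2))
  also have "x * y * x' * (y' * inverse y) * inverse x * inverse y' * inverse x' = cm g h"
    unfolding g h cm_def by (simp add: grp_simps)
  finally have e: "(x * cm y x' * inverse x) * (x' * cm x y' * inverse x') = cm g h" .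
  show ?thesis unfolding e[symmetric]
    by (intro subgrp_mult[OF M_subgrp] M_normal XH cm_M cm_M' g h)
qed

theorem ito:
  assumes "a \<in> H" "b \<in> H" "c \<in> H" "d \<in> H" shows "cm a b * cm c d = cm c d * cm a b"
  using cm_H_M assms commutingD[OF M_commuting] by blast

end

section \<open>Products of two Pruefer groups\<close>

text \<open>The map \<open>f\<close> sends the kernel of its \<open>j + 1\<close>-st iterate into that of its \<open>j\<close>-th iterate,
  with finite fibres.\<close>
lemma finite_kernel_iterates:
  fixes f :: "'a::grp \<Rightarrow> 'a"
  assumes M: "subgrp M" and f: "\<And>m. m \<in> M \<Longrightarrow> f m \<in> M" "\<And>m n. m \<in> M \<Longrightarrow> n \<in> M \<Longrightarrow> f (m * n) = f m * f n"
    and fin: "finite {m \<in> M. f m = 1}"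
  shows "finite {m \<in> M. (f ^^ j) m = 1}"
proof (induction j)
  case 0
  have "{m \<in> M. (f ^^ 0) m = 1} \<subseteq> {1}" by auto
  thus ?case using finite_subset by blast
next
  case (Suc j)
  let ?W = "{m \<in> M. (f ^^ Suc j) m = 1}"
  have "f ` ?W \<subseteq> {m \<in> M. (f ^^ j) m = 1}" using f(1) by (auto simp: funpow_swap1)
  hence im: "finite (f ` ?W)" using Suc finite_subset by blast
  have "fcov {m \<in> M. f m = 1} ?W"
  proof (rule fcov_fibres[OF im])
    fix v w assume vw: "v \<in> ?W" "w \<in> ?W" "f v = f w"
    have "f (v * inverse w) = f w * inverse (f w)"
      using vw f(2) subgrp_inverse[OF M] hom_inverse[of M f w] M by simp
    thus "v * inverse w \<in> {m \<in> M. f m = 1}" using vw M by (simp add: subgrp_mult subgrp_inverse)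
  qed
  thus ?case using fin by (rule fcov_imp_finite)
qed

context
  fixes M :: "'a::grp set" and x :: 'a
  assumes M: "subgrp M" "commuting M" and xM: "\<And>m. m \<in> M \<Longrightarrow> x * m * inverse x \<in> M"
begin

lemma cm_in: "m \<in> M \<Longrightarrow> cm x m \<in> M"
  unfolding cm_def using subgrp_mult[OF M(1) xM] subgrp_inverse[OF M(1)] by blast

lemma cm_hom: assumes "m \<in> M" "n \<in> M" shows "cm x (m * n) = cm x m * cm x n"
proof -
  have "inverse m * cm x n = cm x n * inverse m"
    using commutingD[OF M(2) subgrp_inverse[OF M(1) assms(1)] cm_in[OF assms(2)]] .
  hence "cm x m * cm x n = x * m * inverse x * (cm x n * inverse m)" by (simp add: cm_def[of x m] mult.assoc)
  also have "\<dots> = cm x (m * n)" by (simp add: cm_def grp_simps)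
  finally show ?thesis by simp
qed

lemma cm_iter_in: "m \<in> M \<Longrightarrow> (cm x ^^ i) m \<in> M"
  by (induction i) (auto simp: cm_in)

lemma prod_list_in: "(\<And>i. i \<in> set xs \<Longrightarrow> f i \<in> M) \<Longrightarrow> prod_list (map f xs) \<in> M"
  by (induction xs) (auto simp: subgrp_one[OF M(1)] subgrp_mult[OF M(1)])

lemma prod_list_mult:
  "(\<And>i. i \<in> set xs \<Longrightarrow> f i \<in> M \<and> g i \<in> M) \<Longrightarrow>
    prod_list (map (\<lambda>i. f i * g i) xs) = prod_list (map f xs) * prod_list (map g xs)"
proof (induction xs)
  case (Cons a xs)
  have "g a * prod_list (map f xs) = prod_list (map f xs) * g a"
    by (rule commutingD[OF M(2)]) (use Cons prod_list_in[of xs f] in auto)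
  thus ?case using Cons by (simp add: mult.assoc) (metis mult.assoc)
qed simp

lemma conj_prod_list: "x * prod_list (map f xs) * inverse x = prod_list (map (\<lambda>i. x * f i * inverse x) xs)"
proof (induction xs)
  case (Cons a xs)
  have "x * prod_list (map f (a # xs)) * inverse x = (x * f a * inverse x) * (x * prod_list (map f xs) * inverse x)"
    by (simp add: mult.assoc)
  thus ?case unfolding Cons by simp
qed simp

text \<open>On the abelian group \<open>M\<close>, conjugation by \<open>x\<close> is \<open>1 + D\<close> with \<open>D = cm x\<close>, written
  additively. This is the binomial expansion of \<open>(1 + D)\<^sup>j\<close>.\<close>
lemma conj_binomial:
  assumes m: "m \<in> M"
  shows "x ^ j * m * inverse (x ^ j) = prod_list (map (\<lambda>i. (cm x ^^ i) m ^ (j choose i)) [0..<Suc j])"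
proof (induction j)
  case 0
  show ?case by simp
next
  case (Suc j)
  define D where "D i = (cm x ^^ i) m" for i
  have DM: "D i ^ k \<in> M" for i k unfolding D_def by (intro subgrp_power[OF M(1)] cm_iter_in m)
  have conj: "x * D i ^ k * inverse x = D (Suc i) ^ k * D i ^ k" for i k
  proof -
    have "x * D i * inverse x = D (Suc i) * D i" by (simp add: D_def conj_eq_cm)
    hence "x * D i ^ k * inverse x = (D (Suc i) * D i) ^ k" by (simp flip: conj_power)
    also have "\<dots> = D (Suc i) ^ k * D i ^ k" by (rule commuting_power[OF M(2)]) (use DM[of _ 1] in auto)
    finally show ?thesis .
  qed
  define P where "P = prod_list (map (\<lambda>i. D (Suc i) ^ (j choose i)) [0..<Suc j])"
  define Q where "Q = prod_list (map (\<lambda>i. D i ^ (j choose i)) [0..<Suc j])"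
  define R where "R = prod_list (map (\<lambda>i. D (Suc i) ^ (j choose Suc i)) [0..<Suc j])"
  have PQR: "P \<in> M" "Q \<in> M" "R \<in> M" unfolding P_def Q_def R_def by (intro prod_list_in DM)+
  have "x ^ Suc j * m * inverse (x ^ Suc j) = x * (x ^ j * m * inverse (x ^ j)) * inverse x" by (simp add: grp_simps)
  also have "\<dots> = x * Q * inverse x" unfolding Suc Q_def D_def ..
  also have "\<dots> = P * Q" unfolding Q_def P_def conj_prod_list conj by (rule prod_list_mult) (use DM in auto)
  also have "Q = m * R"
  proof -
    have "Q = prod_list (map (\<lambda>i. D i ^ (j choose i)) [0..<Suc (Suc j)])" by (simp add: Q_def binomial_eq_0)
    also have "[0..<Suc (Suc j)] = 0 # map Suc [0..<Suc j]" by (metis map_Suc_upt upt_conv_Cons zero_less_Suc)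
    finally show ?thesis by (simp add: R_def D_def o_def)
  qed
  also have "P * (m * R) = m * (P * R)"
    using commutingD[OF M(2) PQR(1) m] by (metis mult.assoc)
  also have "P * R = prod_list (map (\<lambda>i. D (Suc i) ^ (Suc j choose Suc i)) [0..<Suc j])"
    unfolding P_def R_def by (subst prod_list_mult[symmetric]) (use DM in \<open>auto simp: power_add\<close>)
  also have "m * \<dots> = prod_list (map (\<lambda>i. D i ^ (Suc j choose i)) [0..<Suc (Suc j)])"
  proof -
    have "[0..<Suc (Suc j)] = 0 # map Suc [0..<Suc j]" by (metis map_Suc_upt upt_conv_Cons zero_less_Suc)
    thus ?thesis by (simp add: D_def o_def del: binomial_Suc_Suc upt_Suc)
  qed
  finally show ?case by (simp add: D_def)
qed

text \<open>Expand \<open>(1 + D)\<^sup>p m\<close>: the left side is \<open>m\<close> as \<open>x\<^sup>p\<close> centralizes \<open>m\<close>, and the middle terms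
  vanish because \<open>p\<close> divides their binomial coefficients and kills \<open>m\<close>. What remains is
  \<open>D\<^sup>p m = 0\<close>.\<close>
lemma cm_iter_prime:
  assumes m: "m \<in> M" "m ^ p = 1" and p: "Factorial_Ring.prime (p::nat)"
    and xp: "x ^ p * m = m * x ^ p"
  shows "(cm x ^^ p) m = 1"
proof -
  have pow: "(cm x ^^ i) m ^ p = 1" for i
  proof (induction i)
    case (Suc i)
    have pow1: "cm x n ^ k = cm x (n ^ k)" if "n \<in> M" for n k
      by (rule hom_power[OF M(1) cm_hom that, symmetric])
    have "(cm x ^^ Suc i) m ^ p = cm x ((cm x ^^ i) m ^ p)" using pow1[OF cm_iter_in[OF m(1), of i], of p] by simp
    also have "\<dots> = 1" unfolding Suc by (simp add: cm_eq_one_iff)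
    finally show ?case .
  qed (use m in simp)
  have mid: "(cm x ^^ i) m ^ (p choose i) = 1" if "0 < i" "i < p" for i
  proof -
    have "p dvd (p choose i)" using dvd_choose_prime[of i p] that p by auto
    then obtain k where "p choose i = p * k" by blast
    thus ?thesis by (simp add: power_mult pow)
  qed
  have p0: "p > 1" using p prime_gt_1_nat by blast
  have eq: "[0..<Suc p] = 0 # [1..<p] @ [p]" using p0 upt_conv_Cons[of 0 p] by simp
  have one: "prod_list (map (\<lambda>i. (cm x ^^ i) m ^ (p choose i)) [1..<p]) = 1"
  proof -
    have "map (\<lambda>i. (cm x ^^ i) m ^ (p choose i)) [1..<p] = map (\<lambda>i. 1) [1..<p]" by (rule map_cong) (use mid in auto)
    thus ?thesis by (simp add: map_replicate_const)
  qed
  have "m = x ^ p * m * inverse (x ^ p)" unfolding xp by (simp add: mult.assoc)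
  also have "\<dots> = m * (cm x ^^ p) m" unfolding conj_binomial[OF m(1)] eq using one by simp
  finally have "m * 1 = m * (cm x ^^ p) m" by simp
  thus ?thesis using grp_left_cancel by metis
qed

end

text \<open>The group \<open>M\<close> stands for the derived subgroup of \<open>H = X Y\<close>; only that it is an abelian
  normal subgroup with abelian quotient is fixed here, as these properties pass to quotients of
  \<open>H\<close>.\<close>
locale two_pruefer =
  fixes p X q Y and H M :: "'a::grp set"
  assumes X: "pruefer p X" and Y: "pruefer q Y" and H: "subgrp H" "H = X * Y"
    and M: "subgrp M" "commuting M" "M \<subseteq> H"
    and M_normal: "\<And>h m. h \<in> H \<Longrightarrow> m \<in> M \<Longrightarrow> h * m * inverse h \<in> M"
    and cm_M: "\<And>g h. g \<in> H \<Longrightarrow> h \<in> H \<Longrightarrow> cm g h \<in> M"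
begin

lemmas Xs = pruefer_subgrp[OF X] and Ys = pruefer_subgrp[OF Y]

lemma XH: "x \<in> X \<Longrightarrow> x \<in> H" and YH: "y \<in> Y \<Longrightarrow> y \<in> H"
  unfolding H(2) mem_times using subgrp_one[OF Xs] subgrp_one[OF Ys] by force+

lemma H_YX: "H = Y * X"
proof
  show "H \<subseteq> Y * X"
  proof
    fix h assume "h \<in> H"
    from product_swap[OF Xs Ys H this] show "h \<in> Y * X" by (metis mem_times)
  qed
  show "Y * X \<subseteq> H"
    using subgrp_mult[OF H(1) YH XH] by (auto simp: mem_times)
qed

lemma swap: "two_pruefer q Y p X H M"
  by (rule two_pruefer.intro) (use X Y H M M_normal cm_M H_YX in auto)

lemma MH: "m \<in> M \<Longrightarrow> m \<in> H" using M by blast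

lemma X_comm: "u \<in> X \<Longrightarrow> v \<in> X \<Longrightarrow> u * v = v * u" using commutingD[OF pruefer_commuting[OF X]] .
lemma Y_comm: "u \<in> Y \<Longrightarrow> v \<in> Y \<Longrightarrow> u * v = v * u" using commutingD[OF pruefer_commuting[OF Y]] .
lemma M_comm: "u \<in> M \<Longrightarrow> v \<in> M \<Longrightarrow> u * v = v * u" using commutingD[OF M(2)] .

definition central where "central x \<longleftrightarrow> (\<forall>h\<in>H. x * h = h * x)"

lemma central_X: assumes "x \<in> X" "\<forall>y\<in>Y. x * y = y * x" shows "central x"
  unfolding central_def
proof
  fix h assume "h \<in> H"
  then obtain u v where h: "u \<in> X" "v \<in> Y" "h = u * v" unfolding H(2) mem_times by blast
  have "x * u = u * x" "x * v = v * x" using assms h X_comm by auto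
  thus "x * h = h * x" unfolding h by (metis mult.assoc)
qed

text \<open>\<open>X\<close> centralizes the finite normal subgroup \<open>M\<close>, so \<open>u \<mapsto> cm u y\<close> is a homomorphism of \<open>X\<close>
  into \<open>M\<close>.\<close>
lemma finite_M_commuting:
  assumes "finite M" "x \<in> X" "y \<in> Y" shows "x * y = y * x"
proof -
  have xM: "u * m = m * u" if "u \<in> X" "m \<in> M" for u m
    by (rule pruefer_acts_trivially[OF X assms(1) that(2) _ that(1)]) (use M_normal XH in auto)
  have "cm x y = 1"
  proof (rule pruefer_hom_finite[OF X, of "\<lambda>u. cm u y"])
    fix u v assume uv: "u \<in> X" "v \<in> X"
    have "cm (u * v) y = u * cm v y * inverse u * cm u y" by (simp add: cm_def grp_simps)
    also have "u * cm v y * inverse u = cm v y" using xM[OF uv(1) cm_M[OF XH[OF uv(2)] YH[OF assms(3)]]] by (simp add: mult.assoc)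
    also have "cm v y * cm u y = cm u y * cm v y" using M_comm cm_M XH YH uv assms by blast
    finally show "cm (u * v) y = cm u y * cm v y" .
  next
    show "finite ((\<lambda>u. cm u y) ` X)" by (rule finite_subset[OF _ assms(1)]) (use cm_M XH YH assms in auto)
  qed (rule assms)
  thus ?thesis by (simp add: cm_eq_one_iff)
qed

text \<open>If \<open>X \<subseteq> M\<close>, then the abelian group \<open>M\<close> cannot contain \<open>Y\<close>, so \<open>M = X (M \<inter> Y)\<close> with \<open>M \<inter> Y\<close>
  finite, of exponent \<open>n\<close> say. The \<open>n\<close>-th powers of \<open>M\<close> make up \<open>X\<close>, so \<open>X\<close> is normal in \<open>H\<close>.
  Then \<open>Y\<close> acts on the finite subgroups of \<open>X\<close>, trivially.\<close>
lemma X_not_sub_M: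
  assumes nc: "x \<in> X" "y \<in> Y" "x * y \<noteq> y * x" shows "\<not> X \<subseteq> M"
proof
  assume XM: "X \<subseteq> M"
  have "M \<inter> Y \<noteq> Y" using nc XM M_comm by blast
  hence fin: "finite (M \<inter> Y)" by (intro pruefer_subgroup[OF Y subgrp_Int[OF M(1) Ys]]) auto
  obtain g where g: "g \<in> Y" "\<forall>u\<in>M \<inter> Y. \<exists>k::nat. u = g ^ k" using pruefer_locally_cyclic[OF Y fin] by auto
  obtain e where e: "g ^ q ^ e = 1" "q ^ e > 0" using pruefer_torsion[OF Y g(1)] .
  define n where "n = q ^ e"
  have gn: "u ^ n = 1" if u: "u \<in> M \<inter> Y" for u
  proof -
    obtain k where "u = g ^ k" using g u by blast
    thus ?thesis using e by (simp add: n_def mult.commute flip: power_mult) (metis power_mult power_one mult.commute)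
  qed
  have Mn: "m ^ n \<in> X" if m: "m \<in> M" for m
  proof -
    obtain u v where uv: "u \<in> X" "v \<in> Y" "m = u * v" using MH[OF m] unfolding H(2) mem_times by blast
    have "inverse u * m \<in> M" using uv(1) XM subgrp_mult[OF M(1) subgrp_inverse[OF M(1)]] m by blast
    hence v: "v \<in> M \<inter> Y" using uv by simp
    have "m ^ n = u ^ n * v ^ n" unfolding uv by (rule commuting_power[OF M(2)]) (use uv v XM in auto)
    thus ?thesis using gn[OF v] subgrp_power[OF Xs uv(1)] by simp
  qed
  have X_normal: "h * u * inverse h \<in> X" if hu: "h \<in> H" "u \<in> X" for h u
  proof -
    obtain w where w: "w \<in> X" "w ^ n = u" using pruefer_divisible[OF X, of n u] e hu by (auto simp: n_def)
    have "h * w * inverse h \<in> M" using M_normal hu w XM by blast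
    thus ?thesis using Mn[of "h * w * inverse h"] w by (simp add: conj_power)
  qed
  obtain r where r: "x ^ p ^ r = 1" "p ^ r > 0" using pruefer_torsion[OF X nc(1)] .
  have "y * x = x * y"
  proof (rule pruefer_acts_trivially[OF Y _ _ _ nc(2)])
    show "finite {u \<in> X. u ^ p ^ r = 1}" by (rule pruefer_bounded[OF X r(2)])
    show "x \<in> {u \<in> X. u ^ p ^ r = 1}" using nc r by simp
    fix v u assume "v \<in> Y" "u \<in> {u \<in> X. u ^ p ^ r = 1}"
    thus "v * u * inverse v \<in> {u \<in> X. u ^ p ^ r = 1}" using X_normal YH by (simp add: conj_power)
  qed
  thus False using nc by simp
qed

text \<open>The centralizer of \<open>x\<close> in \<open>H\<close> is \<open>X\<close> times the finite centralizer of \<open>x\<close> in \<open>Y\<close>, and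
  \<open>X \<inter> M\<close> is finite.\<close>
lemma finite_centralizer_M:
  assumes x: "x \<in> X" "\<not> central x" and XM: "\<not> X \<subseteq> M"
  shows "finite {m \<in> M. m * x = x * m}"
proof -
  have ncy: "\<exists>y\<in>Y. x * y \<noteq> y * x" using x central_X by blast
  have "finite (centralizer {x} \<inter> Y)"
    by (rule pruefer_subgroup[OF Y subgrp_Int[OF subgrp_centralizer Ys]])
      (use ncy in \<open>force simp: centralizer_def\<close>)+
  let ?C = "{m \<in> M. m * x = x * m}"
  have "fcov X ?C"
  proof (rule fcovI[OF \<open>finite (centralizer {x} \<inter> Y)\<close>])
    fix m assume m: "m \<in> ?C"
    then obtain u v where uv: "u \<in> X" "v \<in> Y" "m = u * v" using MH[of m] unfolding H(2) mem_times by blast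
    have "v = inverse u * m" using uv by simp
    moreover have "inverse u * m \<in> centralizer {x}"
      by (rule subgrp_mult[OF subgrp_centralizer])
        (use m uv X_comm[OF subgrp_inverse[OF Xs uv(1)] x(1)] in \<open>auto simp: centralizer_def\<close>)
    ultimately show "\<exists>h\<in>X. \<exists>f\<in>centralizer {x} \<inter> Y. m = h * f" using uv by blast
  qed
  moreover have "fcov M ?C" by (rule fcov_refl) auto
  ultimately have "fcov (X \<inter> M) ?C" by (intro fcov_Int Xs M)
  moreover have "finite (X \<inter> M)" by (rule pruefer_subgroup[OF X subgrp_Int[OF Xs M(1)]]) (use XM in auto)
  ultimately show ?thesis by (rule fcov_imp_finite)
qed

text \<open>Some power \<open>u\<close> of \<open>x\<close> is not central while \<open>u\<^sup>p\<close> is. The map \<open>cm u\<close> has the finite kernel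
  of \<open>finite_centralizer_M\<close> on \<open>M\<close>, and its \<open>p\<close>-th iterate kills all elements of order \<open>p\<close> by
  \<open>cm_iter_prime\<close>. So \<open>M\<close> has finitely many elements of order \<open>p\<close>, and being of bounded exponent
  it is finite.\<close>
lemma bounded_exponent:
  assumes ex: "\<And>m. m \<in> M \<Longrightarrow> m ^ p ^ n = 1" and xy: "x \<in> X" "y \<in> Y"
  shows "x * y = y * x"
proof (rule ccontr)
  assume nc: "x * y \<noteq> y * x"
  note XM = X_not_sub_M[OF xy nc]
  have ncx: "\<not> central x" using nc YH xy by (auto simp: central_def)
  obtain r where r: "x ^ p ^ r = 1" using pruefer_torsion[OF X xy(1)] by metis
  have c1: "central (x ^ p ^ r)" unfolding r by (simp add: central_def)
  define k where "k = (LEAST k. central (x ^ p ^ k))"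
  have k: "central (x ^ p ^ k)" unfolding k_def by (rule LeastI[of _ r]) (rule c1)
  have k0: "k \<noteq> 0" using k ncx by (cases k) auto
  then obtain l where l: "k = Suc l" by (cases k) auto
  define u where "u = x ^ p ^ l"
  have u: "u \<in> X" "\<not> central u"
    using subgrp_power[OF Xs xy(1)] not_less_Least[of l "\<lambda>k. central (x ^ p ^ k)"] l unfolding u_def k_def by auto
  have up: "central (u ^ p)" using k unfolding u_def l by (simp add: mult.commute flip: power_mult)
  have finC: "finite {m \<in> M. m * u = u * m}" by (rule finite_centralizer_M[OF u XM])
  have uM: "u * m * inverse u \<in> M" if "m \<in> M" for m using M_normal XH u that by blast
  have "{m \<in> M. cm u m = 1} = {m \<in> M. m * u = u * m}" by (auto simp: cm_eq_one_iff)
  hence finD: "finite {m \<in> M. (cm u ^^ p) m = 1}"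
    using finite_kernel_iterates[OF M(1) cm_in[OF M(1,2) uM] cm_hom[OF M(1,2) uM], of p] finC by simp
  have "{m \<in> M. m ^ p = 1} \<subseteq> {m \<in> M. (cm u ^^ p) m = 1}"
    using cm_iter_prime[OF M(1,2) uM _ _ pruefer_prime[OF X]] up MH by (auto simp: central_def)
  hence fp: "finite {m \<in> M. m ^ p = 1}" using finD finite_subset by blast
  have "finite {m \<in> M. ((\<lambda>m. m ^ p) ^^ n) m = 1}"
    by (rule finite_kernel_iterates[OF M(1) _ _ fp]) (auto intro: subgrp_power[OF M(1)] commuting_power[OF M(2)])
  moreover have "((\<lambda>m. m ^ p) ^^ n) m = m ^ p ^ n" for m :: 'a
    by (induction n) (simp_all add: mult.commute flip: power_mult)
  ultimately have "finite M" using ex by (simp add: Collect_mem_eq cong: conj_cong)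
  thus False using finite_M_commuting xy nc by blast
qed

end

text \<open>When a commutator commutes with its two entries, it is multiplicative in each of them.\<close>
lemma cm_power_class2:
  assumes "c = cm u y" "c * u = u * c" "c * y = y * c"
  shows "cm (u ^ n) y = c ^ n" "cm u (y ^ n) = c ^ n"
proof -
  have cu: "u * c ^ k * inverse u = c ^ k" for k
    using power_commuting_commutes[OF assms(2), of k] by (metis grp_right_inverse mult.assoc mult.right_neutral)
  have cy: "y * c ^ k * inverse y = c ^ k" for k
    using power_commuting_commutes[OF assms(3), of k] by (metis grp_right_inverse mult.assoc mult.right_neutral)
  show "cm (u ^ n) y = c ^ n"
  proof (induction n)
    case (Suc n)
    have "cm (u ^ Suc n) y = u * cm (u ^ n) y * inverse u * cm u y" by (simp add: cm_def grp_simps)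
    also have "\<dots> = c ^ n * c" unfolding Suc cu assms(1)[symmetric] ..
    finally show ?case by (simp add: power_commutes)
  qed (simp add: cm_eq_one_iff)
  show "cm u (y ^ n) = c ^ n"
  proof (induction n)
    case (Suc n)
    have "cm u (y ^ Suc n) = cm u y * (y * cm u (y ^ n) * inverse y)" by (simp add: cm_def grp_simps)
    also have "\<dots> = c * c ^ n" unfolding Suc cy assms(1)[symmetric] ..
    finally show ?case by simp
  qed (simp add: cm_eq_one_iff)
qed

lemma hom_cm:
  assumes "subgrp H" "\<And>g h. g \<in> H \<Longrightarrow> h \<in> H \<Longrightarrow> f (g * h) = f g * f h" "g \<in> H" "h \<in> H"
  shows "f (cm g h) = cm (f g) (f h)"
proof -
  have "g * h \<in> H" "g * h * inverse g \<in> H" "inverse g \<in> H" "inverse h \<in> H"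
    using assms(1,3,4) by (simp_all add: subgrp_mult subgrp_inverse)
  thus ?thesis using assms by (simp add: cm_def hom_inverse[OF assms(1,2)])
qed

lemma conj_cm: "g * cm u v * inverse g = cm (g * u * inverse g) (g * v * inverse g)"
  by (simp add: cm_def grp_simps)

context two_pruefer
begin

text \<open>The derived subgroup equals its commutator group with \<open>H\<close>. Modulo the latter, \<open>H\<close> has
  class two, so for \<open>x = u\<^sup>n\<close> and \<open>y\<^sup>n = 1\<close> one gets \<open>cm x y = cm u (y\<^sup>n) = 1\<close>; such \<open>u\<close> exists
  as \<open>X\<close> is divisible, and \<open>n\<close> exists as \<open>Y\<close> is periodic.\<close>
lemma cm_generated:
  assumes gen: "M = gen {cm x y | x y. x \<in> X \<and> y \<in> Y}"
  shows "M \<subseteq> gen {cm m h | m h. m \<in> M \<and> h \<in> H}"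
proof -
  let ?S = "{cm m h | m h. m \<in> M \<and> h \<in> H}"
  define L where "L = gen ?S"
  have L: "subgrp L" by (simp add: L_def subgrp_gen)
  have LM: "L \<subseteq> H" unfolding L_def by (rule gen_least[OF H(1)]) (use cm_M MH in auto)
  have Lnorm: "g * l * inverse g \<in> L" if "g \<in> H" "l \<in> L" for g l
    using that(2) unfolding L_def
  proof (rule gen_conj[rotated])
    fix s assume "s \<in> ?S"
    then obtain m h where s: "m \<in> M" "h \<in> H" "s = cm m h" by blast
    have "g * h * inverse g \<in> H" using that(1) s H(1) by (simp add: subgrp_mult subgrp_inverse)
    hence "g * s * inverse g \<in> ?S" unfolding s(3) conj_cm using M_normal[OF that(1) s(1)] by blast
    thus "g * s * inverse g \<in> gen ?S" by (rule gen_incl)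
  qed
  obtain \<phi> :: "'a \<Rightarrow> 'a set sym" where \<phi>:
    "\<And>g h. g \<in> H \<Longrightarrow> h \<in> H \<Longrightarrow> \<phi> (g * h) = \<phi> g * \<phi> h"
    "\<And>g h. g \<in> H \<Longrightarrow> h \<in> H \<Longrightarrow> \<phi> g = \<phi> h \<longleftrightarrow> inverse g * h \<in> L"
    using quotient_hom[OF H(1) L LM Lnorm] by metis
  have cen: "\<phi> m * \<phi> h = \<phi> h * \<phi> m" if mh: "m \<in> M" "h \<in> H" for m h
  proof -
    have "inverse (h * m) * (m * h) = cm (inverse m) (inverse h)" by (simp add: cm_def grp_simps)
    also have "\<dots> \<in> L" unfolding L_def
      by (rule gen_incl) (use mh subgrp_inverse[OF M(1)] subgrp_inverse[OF H(1)] in blast)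
    finally have "\<phi> (h * m) = \<phi> (m * h)" using \<phi>(2)[of "h * m" "m * h"] mh MH subgrp_mult[OF H(1)] by blast
    thus ?thesis using \<phi>(1) mh MH by simp
  qed
  have "cm x y \<in> L" if xy: "x \<in> X" "y \<in> Y" for x y
  proof -
    obtain e where e: "y ^ q ^ e = 1" "q ^ e > 0" using pruefer_torsion[OF Y xy(2)] .
    obtain u where u: "u \<in> X" "u ^ q ^ e = x" using pruefer_divisible[OF X e(2) xy(1)] .
    note c = hom_cm[OF H(1) \<phi>(1)]
    define c where "c = cm (\<phi> u) (\<phi> y)"
    have c': "c = \<phi> (cm u y)" using c XH[OF u(1)] YH[OF xy(2)] by (simp add: c_def)
    have com: "c * \<phi> u = \<phi> u * c" "c * \<phi> y = \<phi> y * c"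
      unfolding c' by (rule cen; use cm_M XH u YH xy in blast)+
    have "\<phi> (cm x y) = cm (\<phi> x) (\<phi> y)" using c XH YH xy by blast
    also have "\<phi> x = \<phi> u ^ q ^ e" using hom_power[OF H(1) \<phi>(1) XH[OF u(1)]] u by metis
    also have "cm (\<phi> u ^ q ^ e) (\<phi> y) = cm (\<phi> u) (\<phi> y ^ q ^ e)" using cm_power_class2[OF c_def com] by simp
    also have "\<phi> y ^ q ^ e = 1" using hom_power[OF H(1) \<phi>(1) YH[OF xy(2)]] e hom_one[OF H(1) \<phi>(1)] by metis
    also have "cm (\<phi> u) 1 = \<phi> 1" using hom_one[OF H(1) \<phi>(1)] by (simp add: cm_eq_one_iff)
    finally have "inverse (cm x y) * 1 \<in> L"
      using \<phi>(2)[of "cm x y" 1] cm_M[OF XH YH] MH xy subgrp_one[OF H(1)] by blast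
    thus ?thesis using subgrp_inverse_iff[OF L] by simp
  qed
  hence "gen {cm x y | x y. x \<in> X \<and> y \<in> Y} \<subseteq> L" by (intro gen_least[OF L]) auto
  thus ?thesis using gen by (simp add: L_def)
qed

text \<open>The map \<open>N m = (m x)\<^sup>n\<close> is the product of the conjugates of \<open>m\<close> under the powers of \<open>x\<close>,
  hence a homomorphism of \<open>M\<close> into its centralizer of \<open>x\<close>. That centralizer \<open>C\<close> is finite and
  normal in \<open>H\<close>, so \<open>X\<close> and \<open>Y\<close> act on it trivially and it is central. Therefore \<open>N\<close> is constant
  on conjugates and kills all commutators of \<open>M\<close> with \<open>H\<close>; by \<open>cm_generated\<close> it kills \<open>M\<close>.\<close>
lemma norm_trivial:
  assumes gen: "M = gen {cm x y | x y. x \<in> X \<and> y \<in> Y}"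
    and x: "x \<in> X" "\<not> central x" and XM: "\<not> X \<subseteq> M" and n: "x ^ n = 1" and m: "m \<in> M"
  shows "(m * x) ^ n = 1"
proof -
  define C where "C = {m \<in> M. m * x = x * m}"
  have finC: "finite C" unfolding C_def by (rule finite_centralizer_M[OF x XM])
  note Mm = subgrp_mult[OF M(1)] subgrp_inverse[OF M(1)]
  have mu: "inverse h * x * h = cm (inverse h) x * x" "cm (inverse h) x \<in> M" if "h \<in> H" for h
    using that cm_M[OF subgrp_inverse[OF H(1) that] XH[OF x(1)]] by (simp_all add: cm_def mult.assoc)
  have C_conj: "h * c * inverse h \<in> C" if h: "h \<in> H" "c \<in> C" for h c
  proof -
    have c: "c \<in> M" "c * x = x * c" using h by (auto simp: C_def)
    have "c * (inverse h * x * h) = (inverse h * x * h) * c"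
      unfolding mu(1)[OF h(1)] using M_comm[OF c(1) mu(2)[OF h(1)]] c(2) by (metis mult.assoc)
    hence "h * (c * (inverse h * x * h)) * inverse h = h * ((inverse h * x * h) * c) * inverse h" by simp
    hence "h * c * inverse h * x = x * (h * c * inverse h)" by (simp add: mult.assoc)
    thus ?thesis using M_normal h c by (auto simp: C_def)
  qed
  have C_central: "h * c = c * h" if h: "h \<in> H" "c \<in> C" for h c
  proof -
    obtain u v where uv: "u \<in> X" "v \<in> Y" "h = u * v" using h unfolding H(2) mem_times by blast
    have "u * c = c * u" by (rule pruefer_acts_trivially[OF X finC h(2) _ uv(1)]) (use C_conj XH in blast)
    moreover have "v * c = c * v" by (rule pruefer_acts_trivially[OF Y finC h(2) _ uv(2)]) (use C_conj YH in blast)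
    ultimately show ?thesis unfolding uv by (metis mult.assoc)
  qed
  \<comment> \<open>Partial norms, for the induction that shows the homomorphism property.\<close>
  define Nf where "Nf i m = (m * x) ^ i * inverse (x ^ i)" for i m
  have Nf_Suc: "Nf (Suc i) m = Nf i m * (x ^ i * m * inverse (x ^ i))" for i m
  proof -
    have "Nf (Suc i) m = (m * x) ^ i * (m * x) * inverse (x ^ i * x)" by (simp only: Nf_def power_Suc2)
    thus ?thesis by (simp add: Nf_def grp_simps)
  qed
  have xiM: "x ^ i * m * inverse (x ^ i) \<in> M" if "m \<in> M" for i m
    using M_normal[OF XH[OF subgrp_power[OF Xs x(1)]] that] .
  have Nf_M: "Nf i m \<in> M" if "m \<in> M" for i m
  proof (induction i)
    case 0 thus ?case by (simp add: Nf_def subgrp_one[OF M(1)])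
  next
    case (Suc i) thus ?case unfolding Nf_Suc using Mm(1) xiM that by blast
  qed
  have Nf_mult: "Nf i (m * m') = Nf i m * Nf i m'" if "m \<in> M" "m' \<in> M" for i m m'
  proof (induction i)
    case 0 thus ?case by (simp add: Nf_def)
  next
    case (Suc i)
    let ?a = "x ^ i * m * inverse (x ^ i)" and ?b = "x ^ i * m' * inverse (x ^ i)"
    have "Nf (Suc i) (m * m') = Nf i m * (Nf i m' * ?a) * ?b" unfolding Nf_Suc Suc by (simp add: grp_simps)
    also have "Nf i m' * ?a = ?a * Nf i m'" by (rule M_comm[OF Nf_M xiM]) (use that in auto)
    finally show ?case by (simp add: Nf_Suc mult.assoc)
  qed
  define N where "N m = (m * x) ^ n" for m
  have N_Nf: "N m = Nf n m" for m by (simp add: N_def Nf_def n)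
  have N_mult: "N (m * m') = N m * N m'" if "m \<in> M" "m' \<in> M" for m m' unfolding N_Nf by (rule Nf_mult[OF that])
  have N_C: "N m \<in> C" if m: "m \<in> M" for m
  proof -
    have NM: "N m \<in> M" unfolding N_Nf by (rule Nf_M[OF m])
    have "N m * (m * x) = (m * x) * N m" unfolding N_def by (rule power_commutes)
    moreover have "N m * m = m * N m" by (rule M_comm[OF NM m])
    ultimately have "m * (N m * x) = m * (x * N m)" by (metis mult.assoc)
    hence "N m * x = x * N m" using grp_left_cancel by blast
    thus ?thesis using NM by (simp add: C_def)
  qed
  have N_one: "N 1 = 1" by (simp add: N_def n)
  have N_conj: "N (h * m * inverse h) = N m" if h: "h \<in> H" "m \<in> M" for h m
  proof -
    let ?\<mu> = "cm (inverse h) x"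
    have "h * m * inverse h * x = h * (m * (inverse h * x * h)) * inverse h" by (simp add: grp_simps)
    also have "\<dots> = h * (m * ?\<mu> * x) * inverse h" unfolding mu(1)[OF h(1)] by (simp add: mult.assoc)
    finally have "N (h * m * inverse h) = h * N (m * ?\<mu>) * inverse h" by (simp add: N_def conj_power)
    also have "N (m * ?\<mu>) = N m * N ?\<mu>" by (rule N_mult[OF h(2) mu(2)[OF h(1)]])
    also have "N ?\<mu> = 1"
    proof -
      have "N ?\<mu> = (inverse h * x * inverse (inverse h)) ^ n" unfolding N_def mu(1)[OF h(1), symmetric] by simp
      thus ?thesis unfolding conj_power n by simp
    qed
    also have "h * (N m * 1) * inverse h = N m * h * inverse h" using C_central[OF h(1) N_C[OF h(2)]] by simp
    also have "\<dots> = N m" by (simp add: mult.assoc)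
    finally show ?thesis .
  qed
  have "gen {cm m h | m h. m \<in> M \<and> h \<in> H} \<subseteq> {m \<in> M. N m = 1}"
  proof (rule gen_least)
    have "N (inverse m) = inverse (N m)" if "m \<in> M" for m
      by (rule hom_inverse[OF M(1) N_mult that])
    thus "subgrp {m \<in> M. N m = 1}" using Mm N_mult N_one subgrp_one[OF M(1)] by (auto simp: subgrp_def)
    show "{cm m h | m h. m \<in> M \<and> h \<in> H} \<subseteq> {m \<in> M. N m = 1}"
    proof clarify
      fix m h assume h: "m \<in> M" "h \<in> H"
      have "N (cm m h) = N (m * (h * inverse m * inverse h))" by (simp add: cm_def mult.assoc)
      also have "\<dots> = N m * N (inverse m)" using N_mult[OF h(1) M_normal[OF h(2) Mm(2)[OF h(1)]]] N_conj[OF h(2) Mm(2)[OF h(1)]] by simp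
      also have "\<dots> = N (m * inverse m)" using N_mult[OF h(1) Mm(2)[OF h(1)]] by simp
      finally show "cm m h \<in> M \<and> N (cm m h) = 1" using cm_M[OF MH[OF h(1)] h(2)] by (simp add: N_one)
    qed
  qed
  thus ?thesis using cm_generated[OF gen] m by (auto simp: N_def)
qed

text \<open>Let \<open>M1 = cm x ` M\<close>, a normal subgroup of \<open>H\<close>. Modulo \<open>M1\<close> the element \<open>x\<close> commutes with
  \<open>M\<close>, so \<open>norm_trivial\<close> turns into \<open>m\<^sup>n x\<^sup>n = 1\<close>, that is \<open>m\<^sup>n = 1\<close>, with \<open>n\<close> a power of \<open>p\<close>.
  By \<open>bounded_exponent\<close> the images of \<open>X\<close> and \<open>Y\<close> commute, and so \<open>M = M1\<close>.\<close>
lemma commutator_onto: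
  assumes gen: "M = gen {cm x y | x y. x \<in> X \<and> y \<in> Y}"
    and x: "x \<in> X" "\<not> central x" and XM: "\<not> X \<subseteq> M" and YM: "\<not> Y \<subseteq> M"
  shows "M \<subseteq> cm x ` M"
proof -
  obtain k where k: "x ^ p ^ k = 1" using pruefer_torsion[OF X x(1)] by metis
  have xM: "x * m * inverse x \<in> M" if "m \<in> M" for m using M_normal XH x that by blast
  define M1 where "M1 = cm x ` M"
  have M1: "subgrp M1" unfolding M1_def by (rule subgrp_hom_image[OF M(1) cm_hom[OF M(1,2) xM] M(1) order_refl])
  have M1M: "M1 \<subseteq> M" unfolding M1_def using cm_in[OF M(1,2) xM] by blast
  have M1norm: "h * l * inverse h \<in> M1" if hl: "h \<in> H" "l \<in> M1" for h l
  proof -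
    obtain m where m: "m \<in> M" "l = cm x m" using hl by (auto simp: M1_def)
    let ?\<mu> = "cm h x" and ?m = "h * m * inverse h"
    have mM: "?m \<in> M" by (rule M_normal[OF hl(1) m(1)])
    have "h * l * inverse h = cm (?\<mu> * x) ?m" unfolding m conj_cm conj_eq_cm[of h x] ..
    also have "\<dots> = ?\<mu> * (x * ?m * inverse x) * inverse ?\<mu> * inverse ?m" by (simp add: cm_def grp_simps)
    also have "?\<mu> * (x * ?m * inverse x) = (x * ?m * inverse x) * ?\<mu>" by (rule M_comm[OF cm_M[OF hl(1) XH[OF x(1)]] xM[OF mM]])
    also have "(x * ?m * inverse x) * ?\<mu> * inverse ?\<mu> * inverse ?m = cm x ?m" by (simp add: cm_def mult.assoc)
    finally show ?thesis unfolding M1_def using mM by blast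
  qed
  obtain \<phi> :: "'a \<Rightarrow> 'a set sym" where \<phi>:
    "\<And>g h. g \<in> H \<Longrightarrow> h \<in> H \<Longrightarrow> \<phi> (g * h) = \<phi> g * \<phi> h"
    "\<And>g h. g \<in> H \<Longrightarrow> h \<in> H \<Longrightarrow> \<phi> g = \<phi> h \<longleftrightarrow> inverse g * h \<in> M1"
    using quotient_hom[OF H(1) M1 _ M1norm] M1M M(3) by (metis subset_trans)
  note hh = H(1) \<phi>(1)
  have inf: "infinite (\<phi> ` Z)" if Z: "pruefer r Z" "Z \<subseteq> H" "\<not> Z \<subseteq> M" for r Z
  proof
    assume fin: "finite (\<phi> ` Z)"
    have "Z \<subseteq> M1"
    proof (rule pruefer_fibres[OF Z(1) fin M1])
      fix v w assume vw: "v \<in> Z" "w \<in> Z" "\<phi> v = \<phi> w"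
      hence "inverse w * v \<in> M1" using \<phi>(2)[of w v] Z by auto
      moreover have "inverse w * v = v * inverse w"
        using commutingD[OF pruefer_commuting[OF Z(1)] vw(1) subgrp_inverse[OF pruefer_subgrp[OF Z(1)] vw(2)]] by simp
      ultimately show "v * inverse w \<in> M1" by simp
    qed
    thus False using Z M1M by blast
  qed
  have XsubH: "X \<subseteq> H" "Y \<subseteq> H" using XH YH by auto
  interpret Q: two_pruefer p "\<phi> ` X" q "\<phi> ` Y" "\<phi> ` H" "\<phi> ` M"
  proof
    show "pruefer p (\<phi> ` X)" by (rule pruefer_hom_image[OF X]) (use \<phi>(1) XH inf[OF X XsubH(1) XM] in auto)
    show "pruefer q (\<phi> ` Y)" by (rule pruefer_hom_image[OF Y]) (use \<phi>(1) YH inf[OF Y XsubH(2) YM] in auto)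
    show "subgrp (\<phi> ` H)" "subgrp (\<phi> ` M)" using subgrp_hom_image[OF hh] H(1) M by auto
    show "\<phi> ` H = \<phi> ` X * \<phi> ` Y"
    proof
      show "\<phi> ` H \<subseteq> \<phi> ` X * \<phi> ` Y"
      proof clarify
        fix h assume "h \<in> H"
        then obtain u v where uv: "u \<in> X" "v \<in> Y" "h = u * v" unfolding H(2) mem_times by blast
        thus "\<phi> h \<in> \<phi> ` X * \<phi> ` Y" using \<phi>(1) XH YH unfolding mem_times by auto
      qed
      show "\<phi> ` X * \<phi> ` Y \<subseteq> \<phi> ` H"
      proof
        fix g assume "g \<in> \<phi> ` X * \<phi> ` Y"
        then obtain u v where uv: "u \<in> X" "v \<in> Y" "g = \<phi> u * \<phi> v" unfolding mem_times by blast
        hence "g = \<phi> (u * v)" "u * v \<in> H" using \<phi>(1) XH YH subgrp_mult[OF H(1)] by auto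
        thus "g \<in> \<phi> ` H" by blast
      qed
    qed
    show "commuting (\<phi> ` M)" using M_comm MH by (auto simp: commuting_def simp flip: \<phi>(1))
    show "\<phi> ` M \<subseteq> \<phi> ` H" using M by auto
  next
    fix g m assume "g \<in> \<phi> ` H" "m \<in> \<phi> ` M"
    then obtain h n where h: "h \<in> H" "n \<in> M" "g = \<phi> h" "m = \<phi> n" by blast
    have "\<phi> (h * n * inverse h) = \<phi> h * \<phi> n * inverse (\<phi> h)"
      using \<phi>(1) h MH hom_inverse[OF hh] subgrp_mult[OF H(1)] subgrp_inverse[OF H(1)] by simp
    thus "g * m * inverse g \<in> \<phi> ` M" using M_normal[OF h(1,2)] h by (metis imageI)
  next
    fix g h assume "g \<in> \<phi> ` H" "h \<in> \<phi> ` H"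
    then obtain u v where "u \<in> H" "v \<in> H" "g = \<phi> u" "h = \<phi> v" by blast
    thus "cm g h \<in> \<phi> ` M" using hom_cm[OF hh, of u v] cm_M[of u v] by (metis imageI)
  qed
  have ex: "m ^ p ^ k = 1" if m\<phi>: "m \<in> \<phi> ` M" for m
  proof -
    obtain n where n: "n \<in> M" "m = \<phi> n" using m\<phi> by blast
    have "inverse (n * x) * (x * n) \<in> M1"
    proof -
      have "inverse (n * x) * (x * n) = inverse x * (inverse n * (x * n * inverse x)) * x" by (simp add: grp_simps)
      also have "inverse n * (x * n * inverse x) = (x * n * inverse x) * inverse n"
        by (rule M_comm[OF subgrp_inverse[OF M(1) n(1)] xM[OF n(1)]])
      also have "inverse x * ((x * n * inverse x) * inverse n) * x = inverse x * cm x n * inverse (inverse x)"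
        by (simp add: cm_def)
      also have "\<dots> \<in> M1" by (rule M1norm) (use n XH x subgrp_inverse[OF Xs x(1)] in \<open>auto simp: M1_def\<close>)
      finally show ?thesis .
    qed
    moreover have nx: "n * x \<in> H" "x * n \<in> H" using n MH XH x subgrp_mult[OF H(1)] by auto
    ultimately have "\<phi> (n * x) = \<phi> (x * n)" using \<phi>(2) by blast
    hence com: "commuting {\<phi> n, \<phi> x}" using \<phi>(1) n MH XH x by (auto simp: commuting_def)
    have "1 = \<phi> ((n * x) ^ p ^ k)" unfolding norm_trivial[OF gen x XM k n(1)] using hom_one[OF hh] by simp
    also have "\<dots> = (\<phi> n * \<phi> x) ^ p ^ k" using hom_power[OF hh nx(1)] \<phi>(1) n MH XH x by simp
    also have "\<dots> = \<phi> n ^ p ^ k * \<phi> x ^ p ^ k" by (rule commuting_power[OF com]) auto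
    also have "\<phi> x ^ p ^ k = 1" using hom_power[OF hh XH[OF x(1)], of "p ^ k"] k hom_one[OF hh] by simp
    finally show ?thesis using n by simp
  qed
  have "cm u v \<in> M1" if uv: "u \<in> X" "v \<in> Y" for u v
  proof -
    have "\<phi> u * \<phi> v = \<phi> v * \<phi> u" by (rule Q.bounded_exponent[OF ex]) (use uv in auto)
    hence "\<phi> (cm u v) = \<phi> 1" using hom_cm[OF hh XH[OF uv(1)] YH[OF uv(2)]] hom_one[OF hh] by (simp add: cm_eq_one_iff)
    hence "inverse (cm u v) * 1 \<in> M1" using \<phi>(2)[of "cm u v" 1] MH[OF cm_M[OF XH YH]] uv subgrp_one[OF H(1)] by blast
    thus ?thesis using subgrp_inverse_iff[OF M1] by simp
  qed
  hence "gen {cm x y | x y. x \<in> X \<and> y \<in> Y} \<subseteq> M1" by (intro gen_least[OF M1]) auto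
  thus ?thesis using gen by (simp add: M1_def)
qed

text \<open>If \<open>x\<close> is not central, then \<open>commutator_onto\<close> says that all elements of \<open>M x\<close> are
  conjugate to \<open>x\<close> under \<open>M\<close>. All conjugates of \<open>x\<close> lie in \<open>M x\<close>, so \<open>H = M C\<close> with \<open>C\<close> the
  centralizer of \<open>x\<close>, which is \<open>X\<close> times a finite set. Hence \<open>M X\<close> has finite index in \<open>H\<close> and
  contains \<open>Y\<close>; in turn \<open>X \<subseteq> M Y\<close>. Write \<open>x = \<mu> v\<close> with \<open>\<mu> \<in> M\<close> and \<open>v \<in> Y\<close>; then \<open>v\<close> is
  conjugate to \<open>x\<close> under \<open>M \<subseteq> Y X\<close>, so it is conjugate to \<open>x\<close> under \<open>Y\<close>, and \<open>x\<close> belongs to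
  \<open>Y\<close>.\<close>
lemma all_commute:
  assumes gen: "M = gen {cm x y | x y. x \<in> X \<and> y \<in> Y}" and xy: "x \<in> X" "y \<in> Y"
  shows "x * y = y * x"
proof (rule ccontr)
  assume nc: "x * y \<noteq> y * x"
  have XM: "\<not> X \<subseteq> M" by (rule X_not_sub_M[OF xy nc])
  have YM: "\<not> Y \<subseteq> M" by (rule two_pruefer.X_not_sub_M[OF swap xy(2,1)]) (use nc in simp)
  have ncx: "\<not> central x" using nc YH xy by (auto simp: central_def)
  note onto = commutator_onto[OF gen xy(1) ncx XM YM]
  have MX: "\<exists>m\<in>M. \<mu> * x = m * x * inverse m" if \<mu>: "\<mu> \<in> M" for \<mu>
  proof -
    obtain m where m: "m \<in> M" "inverse \<mu> = cm x m" using onto subgrp_inverse[OF M(1) \<mu>] by blast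
    have "\<mu> = inverse (cm x m)" using m by (metis grp_inverse_inverse)
    hence "\<mu> * x = m * x * inverse m" by (simp add: cm_def grp_simps)
    thus ?thesis using m by blast
  qed
  have finF: "finite (centralizer {x} \<inter> Y)"
    by (rule pruefer_subgroup[OF Y subgrp_Int[OF subgrp_centralizer Ys]]) (use nc xy in \<open>force simp: centralizer_def\<close>)+
  have subM: "subgrp (M * Z)" if Z: "subgrp Z" "Z \<subseteq> H" for Z
    unfolding subgrp_def
  proof (intro conjI ballI)
    show "1 \<in> M * Z" unfolding mem_times using subgrp_one[OF M(1)] subgrp_one[OF Z(1)] by force
  next
    fix g h assume "g \<in> M * Z" "h \<in> M * Z"
    then obtain m u n v where g: "m \<in> M" "u \<in> Z" "g = m * u" "n \<in> M" "v \<in> Z" "h = n * v" unfolding mem_times by blast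
    have "g * h = (m * (u * n * inverse u)) * (u * v)" by (simp add: g mult.assoc)
    moreover have "m * (u * n * inverse u) \<in> M" using subgrp_mult[OF M(1) g(1)] M_normal g Z by blast
    ultimately show "g * h \<in> M * Z" unfolding mem_times using subgrp_mult[OF Z(1)] g by blast
  next
    fix g assume "g \<in> M * Z"
    then obtain m u where g: "m \<in> M" "u \<in> Z" "g = m * u" unfolding mem_times by blast
    have "inverse g = (inverse u * inverse m * inverse (inverse u)) * inverse u" by (simp add: g grp_simps)
    moreover have "inverse u * inverse m * inverse (inverse u) \<in> M"
      by (rule M_normal) (use g Z subgrp_inverse[OF Z(1)] subgrp_inverse[OF M(1)] in auto)
    ultimately show "inverse g \<in> M * Z" unfolding mem_times using subgrp_inverse[OF Z(1)] g by blast
  qed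
  have "fcov (M * X) H"
  proof (rule fcovI[OF finF])
    fix h assume h: "h \<in> H"
    obtain m where m: "m \<in> M" "cm h x * x = m * x * inverse m" using MX[OF cm_M[OF h XH[OF xy(1)]]] by blast
    have "h * x * inverse h = m * x * inverse m" using m(2) by (simp add: conj_eq_cm)
    hence "inverse m * (h * x * inverse h) * h = inverse m * (m * x * inverse m) * h" by simp
    hence c: "inverse m * h * x = x * (inverse m * h)" by (simp add: mult.assoc)
    have "inverse m * h \<in> H" using h m MH by (simp add: subgrp_mult subgrp_inverse H(1))
    then obtain u v where uv: "u \<in> X" "v \<in> Y" "inverse m * h = u * v" unfolding H(2) mem_times by blast
    have "v = inverse u * (inverse m * h)" using uv by simp
    moreover have "inverse u * (inverse m * h) \<in> centralizer {x}"
      by (rule subgrp_mult[OF subgrp_centralizer])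
        (use c X_comm[OF subgrp_inverse[OF Xs uv(1)] xy(1)] in \<open>auto simp: centralizer_def\<close>)
    ultimately have v: "v \<in> centralizer {x} \<inter> Y" using uv by blast
    have "h = m * (inverse m * h)" by simp
    hence "h = (m * u) * v" unfolding uv(3) by (simp add: mult.assoc)
    moreover have "m * u \<in> M * X" using m uv unfolding mem_times by blast
    ultimately show "\<exists>h'\<in>M * X. \<exists>f\<in>centralizer {x} \<inter> Y. h = h' * f" using v by blast
  qed
  hence "fcov (M * X) Y" by (rule fcov_subset) (use YH in auto)
  hence YMX: "Y \<subseteq> M * X" using pruefer_fcov[OF Y subM[OF Xs]] XH by blast
  have "X \<inter> (M * Y) = X"
  proof (rule ccontr)
    assume "X \<inter> (M * Y) \<noteq> X"
    hence fin: "finite (X \<inter> (M * Y))"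
      by (intro pruefer_subgroup[OF X subgrp_Int[OF Xs subM[OF Ys]]]) (use YH in auto)
    have "fcov M Y"
    proof (rule fcovI[OF fin])
      fix v assume v: "v \<in> Y"
      then obtain m u where mu: "m \<in> M" "u \<in> X" "v = m * u" using subsetD[OF YMX v] unfolding mem_times by blast
      hence "u = inverse m * v" by simp
      hence "u \<in> M * Y" unfolding mem_times using subgrp_inverse[OF M(1) mu(1)] v by blast
      thus "\<exists>h\<in>M. \<exists>f\<in>X \<inter> (M * Y). v = h * f" using mu by blast
    qed
    thus False using pruefer_fcov[OF Y M(1)] YM by blast
  qed
  hence "x \<in> M * Y" using xy by blast
  then obtain \<mu> v where v: "\<mu> \<in> M" "v \<in> Y" "x = \<mu> * v" unfolding mem_times by blast
  have "v = inverse \<mu> * x" using v by simp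
  then obtain m where m: "m \<in> M" "v = m * x * inverse m" using MX[OF subgrp_inverse[OF M(1) v(1)]] by auto
  obtain y' x' where yx: "y' \<in> Y" "x' \<in> X" "m = y' * x'" using MH[OF m(1)] unfolding H_YX mem_times by blast
  have "v = y' * (x' * x * inverse x') * inverse y'" unfolding m yx by (simp add: grp_simps)
  also have "x' * x * inverse x' = x" unfolding X_comm[OF yx(2) xy(1)] by (simp add: mult.assoc)
  finally have "x = inverse y' * v * y'" by (simp add: mult.assoc)
  hence "x \<in> Y" using yx v by (simp add: subgrp_mult[OF Ys] subgrp_inverse[OF Ys])
  thus False using Y_comm xy nc by blast
qed

end

text \<open>The derived subgroup of \<open>X Y\<close> is abelian by Ito's theorem.\<close>
theorem pruefer_product_commute:
  assumes X: "pruefer p X" and Y: "pruefer q Y" and H: "subgrp (X * Y)" and xy: "x \<in> X" "y \<in> Y"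
  shows "x * y = y * x"
proof -
  interpret P: abelian_product X Y "X * Y"
    by (rule abelian_product.intro) (use X Y H pruefer_subgrp pruefer_commuting in auto)
  interpret Q: two_pruefer p X q Y "X * Y" P.M
  proof
    have "{cm x y |x y. x \<in> X \<and> y \<in> Y} \<subseteq> X * Y"
      using P.XH P.YH H by (auto simp: cm_def subgrp_mult subgrp_inverse)
    thus "P.M \<subseteq> X * Y" unfolding P.M_def by (rule gen_least[OF H])
  qed (use X Y H P.M_subgrp P.M_commuting P.M_normal P.cm_H_M in auto)
  show ?thesis by (rule Q.all_commute[OF P.M_def xy])
qed

section \<open>Two nonabelian factors\<close>

lemma product_subgrp:
  assumes A: "subgrp A" and X: "subgrp X" and XA: "X * A \<subseteq> A * X"
  shows "subgrp (A * X)" "A * X = X * A"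
proof -
  have AX: "A * X \<subseteq> X * A"
  proof
    fix g assume "g \<in> A * X"
    then obtain a x where ax: "a \<in> A" "x \<in> X" "g = a * x" unfolding mem_times by blast
    have "inverse x * inverse a \<in> X * A" unfolding mem_times using ax subgrp_inverse A X by blast
    hence "inverse g \<in> A * X" using XA ax by (auto simp: grp_inverse_mult)
    then obtain c y where "c \<in> A" "y \<in> X" "inverse g = c * y" unfolding mem_times by blast
    hence "g = inverse y * inverse c" by (metis grp_inverse_inverse grp_inverse_mult)
    thus "g \<in> X * A" unfolding mem_times using \<open>c \<in> A\<close> \<open>y \<in> X\<close> subgrp_inverse A X by blast
  qed
  thus eq: "A * X = X * A" using XA by blast
  show "subgrp (A * X)"
    unfolding subgrp_def
  proof (intro conjI ballI)
    show "1 \<in> A * X" unfolding mem_times using subgrp_one[OF A] subgrp_one[OF X] by force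
  next
    fix g h assume "g \<in> A * X" "h \<in> A * X"
    hence "g * h \<in> A * X * (A * X)" unfolding mem_times by blast
    also have "\<dots> = A * (X * A) * X" by (simp add: mult.assoc)
    also have "\<dots> = (A * A) * (X * X)" unfolding eq[symmetric] by (simp add: mult.assoc)
    also have "A * A = A" using subgrp_mult[OF A] subgrp_one[OF A] by (force simp: mem_times set_eq_iff)
    also have "X * X = X" using subgrp_mult[OF X] subgrp_one[OF X] by (force simp: mem_times set_eq_iff)
    finally show "g * h \<in> A * X" .
  next
    fix g assume "g \<in> A * X"
    then obtain a x where "a \<in> A" "x \<in> X" "g = a * x" unfolding mem_times by blast
    hence "inverse g \<in> X * A" unfolding mem_times using subgrp_inverse A X by (metis grp_inverse_mult)
    thus "inverse g \<in> A * X" by (simp add: eq)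
  qed
qed

context doubly_inverted
begin

lemma doubly_swap: "doubly_inverted q B Y a0 G p X b"
proof (rule doubly_inverted.intro)
  show "inverted_factor q B Y a0 G" by (rule swap.inverted_factor_axioms)
  show "doubly_inverted_axioms B Y p X b"
  proof
    show "B = X \<union> (\<lambda>y. y * b) ` X" by (simp add: B_def T_def)
    show "B \<inter> Y \<subseteq> X" using AT_empty Y_A by (auto simp: B_def)
  qed (use X b_inverts b_square in auto)
qed

text \<open>\<open>X\<close> centralizes and hence normalizes every cyclic subgroup of \<open>Y\<close>.\<close>
lemma permutes_if_commute:
  assumes "\<And>x y. x \<in> X \<Longrightarrow> y \<in> Y \<Longrightarrow> x * y = y * x" shows "X * A \<subseteq> A * X"
proof (rule permutes_if_X_normalizes)
  fix c assume c: "c \<in> Y"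
  show "X \<subseteq> Nm c"
  proof
    fix x assume x: "x \<in> X"
    have "x * c * inverse x = c ^ 1" unfolding assms[OF x c] by (simp add: mult.assoc)
    moreover have "inverse x * c * x = inverse x * (x * c)" unfolding assms[OF x c] by (simp add: mult.assoc)
    hence "inverse x * c * x = c ^ 1" by simp
    ultimately show "x \<in> Nm c" using X_in_G[OF x] unfolding Nm_def by blast
  qed
qed

text \<open>If \<open>B Y\<close> is a subgroup, it is the product of the abelian group \<open>Y\<close> and of \<open>B\<close>, so
  \<open>permutes_abelian\<close> makes \<open>X Y\<close> a subgroup, and a product of two Pruefer groups is abelian.\<close>
lemma permutes_if_swap_permutes:
  assumes YB: "Y * B \<subseteq> B * Y" shows "X * A \<subseteq> A * X"
proof (rule permutes_if_commute)
  fix x y assume xy: "x \<in> X" "y \<in> Y"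
  note sub = product_subgrp[OF B swap.Xs YB]
  interpret YB: inverted_factor p Y X b "B * Y"
  proof
    show "subgrp (B * Y)" by (rule sub)
    have BY: "\<beta> \<in> B * Y" if "\<beta> \<in> B" for \<beta> using that swap.X_one by (metis mem_times mult.right_neutral)
    have YBY: "y \<in> B * Y" if "y \<in> Y" for y using that subgrp_one[OF B] by (metis mem_times mult.left_neutral)
    show "Y \<subseteq> B * Y" using YBY by blast
    show "X \<subseteq> B * Y" "b \<in> B * Y" using BY b_in_T by (auto simp: B_def)
    show "B * Y \<subseteq> Y * (X \<union> (\<lambda>x. x * b) ` X)" using equalityD1[OF sub(2)] by (simp add: B_def T_def)
    show "Y \<inter> (\<lambda>x. x * b) ` X = {}" using AT_empty Y_A by (auto simp: T_def)
  qed (use X swap.Xs b_inverts b_square in auto)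
  have "X * Y \<subseteq> Y * X" by (rule YB.permutes_abelian[OF pruefer_commuting[OF Y]])
  note sub2 = product_subgrp[OF swap.Xs Xs this]
  show "x * y = y * x" by (rule pruefer_product_commute[OF X Y _ xy]) (use sub2 in simp)
qed

text \<open>\<open>X\<close> acts on the finite subgroups of \<open>Y\<close>.\<close>
lemma commute_if_X_normalizes_Y:
  assumes N: "\<And>x y. x \<in> X \<Longrightarrow> y \<in> Y \<Longrightarrow> x * y * inverse x \<in> Y" and xy: "x \<in> X" "y \<in> Y"
  shows "x * y = y * x"
proof -
  obtain e where e: "y ^ q ^ e = 1" "q ^ e > 0" using pruefer_torsion[OF Y xy(2)] .
  show ?thesis
  proof (rule pruefer_acts_trivially[OF X pruefer_bounded[OF Y e(2)] _ _ xy(1)])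
    show "y \<in> {u \<in> Y. u ^ q ^ e = 1}" using e xy by simp
    fix v u assume "v \<in> X" "u \<in> {u \<in> Y. u ^ q ^ e = 1}"
    thus "v * u * inverse v \<in> {u \<in> Y. u ^ q ^ e = 1}" using N by (simp add: conj_power)
  qed
qed

text \<open>If \<open>z \<noteq> 1\<close>, then \<open>z\<close> is the only involution of \<open>B\<close>, which is locally a generalized
  quaternion group.\<close>
lemma B_power_z:
  assumes "\<beta> \<in> B" "\<beta> \<noteq> 1" shows "\<exists>k::nat. z = \<beta> ^ k"
proof (cases "\<beta> \<in> X")
  case True
  from pruefer_chain[OF X z_X True] show ?thesis
  proof (elim disjE exE)
    fix k assume k: "\<beta> = z ^ k"
    have "z ^ k = (if even k then 1 else z)"
      by (induction k) (use z_z in auto)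
    hence "\<beta> = z ^ 1" using k assms by (auto split: if_splits)
    thus ?thesis by (metis power_one_right)
  qed blast
next
  case False
  hence "z = \<beta> ^ 2" using t_square assms by (auto simp: B_def power2_eq_square)
  thus ?thesis ..
qed

lemma B_torsion:
  assumes "\<beta> \<in> B" obtains m where "\<beta> ^ m = 1" "m > 0"
proof (cases "\<beta> \<in> X")
  case True
  thus ?thesis using pruefer_torsion[OF X] that by metis
next
  case False
  hence "\<beta> ^ 4 = 1" using t_square z_z assms by (auto simp: B_def power4_eq_xxxx) (metis mult.assoc)
  thus ?thesis using that[of 4] by simp
qed

end

text \<open>If the involutions \<open>\<epsilon>\<close> and \<open>z\<close> do not commute, a nontrivial element of \<open>B\<close> cannot commute
  with \<open>\<epsilon>\<close>, since \<open>z\<close> is one of its powers; likewise for \<open>A\<close> and \<open>z\<close>. Let \<open>h = \<epsilon> z\<close> and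
  \<open>h\<^sup>2 = \<alpha> \<beta>\<close> with \<open>\<alpha> \<in> A\<close>, \<open>\<beta> \<in> B\<close>. As \<open>\<alpha>\<close> commutes with \<open>\<epsilon>\<close> and \<open>\<beta>\<close> with \<open>z\<close>, one computes
  \<open>\<beta>\<^sup>-\<^sup>1 h \<beta> = h\<^sup>-\<^sup>3\<close>. Since \<open>\<beta>\<close> has finite order, iterating this shows that \<open>h\<close> has a finite
  order \<open>N\<close>, so \<open>\<epsilon>\<close> and \<open>z\<close> generate a finite dihedral group. If \<open>N\<close> is even, the central
  involution of this group commutes with \<open>\<epsilon>\<close> and \<open>z\<close> and therefore lies in \<open>A \<inter> B\<close>, which is
  trivial. If \<open>N\<close> is odd, \<open>\<epsilon>\<close> and \<open>z\<close> are conjugate in \<open>G = B A\<close>; as \<open>A\<close> centralizes \<open>\<epsilon>\<close> and \<open>B\<close>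
  centralizes \<open>z\<close>, they are equal.\<close>
lemma (in doubly_inverted) quaternion_commute: "swap.z * z = z * swap.z"
proof (rule ccontr)
  define \<epsilon> where "\<epsilon> = swap.z"
  assume "swap.z * z \<noteq> z * swap.z"
  hence nc: "\<epsilon> * z \<noteq> z * \<epsilon>" by (simp add: \<epsilon>_def)
  have \<epsilon>\<epsilon>: "\<epsilon> * \<epsilon> = 1" using swap.z_z by (simp add: \<epsilon>_def)
  have \<epsilon>\<epsilon>': "\<epsilon> * (\<epsilon> * r) = r" "z * (z * r) = r" for r using \<epsilon>\<epsilon> z_z by (metis mult.assoc mult.left_neutral)+
  have inv: "inverse \<epsilon> = \<epsilon>" "inverse z = z" using swap.inverse_z inverse_z by (simp_all add: \<epsilon>_def)
  have \<epsilon>A: "\<epsilon> * a = a * \<epsilon>" if "a \<in> A" for a using swap.z_B that swap_B by (simp add: \<epsilon>_def)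
  have \<epsilon>Y: "\<epsilon> \<in> Y" "\<epsilon> \<in> A" "\<epsilon> \<in> G" using swap.z_X Y_A A_in_G by (auto simp: \<epsilon>_def)
  have zG: "z \<in> G" using z_X X_in_G by blast
  interpret S: doubly_inverted q B Y a0 G p X b by (rule doubly_swap)
  have CB: "\<beta> = 1" if \<beta>: "\<beta> \<in> B" "\<epsilon> * \<beta> = \<beta> * \<epsilon>" for \<beta>
  proof (rule ccontr)
    assume "\<beta> \<noteq> 1"
    then obtain k :: nat where "z = \<beta> ^ k" using B_power_z \<beta> by blast
    thus False using nc commute_power[OF \<beta>(2)] by simp
  qed
  have CA: "a = 1" if a: "a \<in> A" "z * a = a * z" for a
  proof (rule ccontr)
    assume "a \<noteq> 1"
    then obtain k :: nat where "\<epsilon> = a ^ k" using S.B_power_z[of a] a by (auto simp: swap_B \<epsilon>_def)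
    thus False using nc commute_power[OF a(2)] by simp
  qed
  have AB: "c = 1" if "c \<in> A" "c \<in> B" for c using CB[OF that(2)] \<epsilon>A[OF that(1)] by blast
  define h where "h = \<epsilon> * z"
  define g where "g = z * \<epsilon>"
  have hg: "inverse h = g" "inverse g = h" by (simp_all add: h_def g_def grp_inverse_mult inv)
  have hG: "h \<in> G" using \<epsilon>Y zG G_mult by (simp add: h_def)
  have "h * h \<in> G" using hG G_mult by blast
  then obtain \<alpha> \<beta> where ab: "\<alpha> \<in> A" "\<beta> \<in> B" "h * h = \<alpha> * \<beta>" using G_cases unfolding B_def by (metis Un_iff)
  have \<beta>h: "inverse \<beta> * h * \<beta> = g ^ 3"
  proof -
    have "inverse \<beta> * \<epsilon> * \<beta> = inverse (\<alpha> * \<beta>) * \<epsilon> * (\<alpha> * \<beta>)"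
      using \<epsilon>A[OF ab(1)] by (simp add: grp_simps) (metis inv_mult_cancel mult.assoc)
    hence e: "inverse \<beta> * \<epsilon> * \<beta> = g * g * \<epsilon> * (h * h)" unfolding ab(3)[symmetric] by (simp add: grp_inverse_mult hg)
    have "inverse \<beta> * h * \<beta> = (inverse \<beta> * \<epsilon> * \<beta>) * z"
      using z_B[OF ab(2)] by (simp add: h_def mult.assoc)
    also have "\<dots> = g ^ 3" unfolding e g_def h_def by (simp add: mult.assoc power3_eq_cube \<epsilon>\<epsilon>' \<epsilon>\<epsilon> z_z)
    finally show ?thesis .
  qed
  have \<beta>g: "inverse \<beta> * g * \<beta> = h ^ 3"
  proof -
    have "inverse \<beta> * g * \<beta> = inverse (inverse \<beta> * h * \<beta>)" by (simp add: grp_simps hg)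
    thus ?thesis unfolding \<beta>h by (simp add: grp_inverse_power hg)
  qed
  have conjb: "inverse \<beta> * u ^ n * \<beta> = (inverse \<beta> * u * \<beta>) ^ n" for u n
    using conj_power[of "inverse \<beta>" u n] by simp
  have it: "inverse (\<beta> ^ (2 * n)) * h * \<beta> ^ (2 * n) = h ^ (9 ^ n)" for n
  proof (induction n)
    case (Suc n)
    have "\<beta> ^ (2 * Suc n) = \<beta> ^ (2 * n) * \<beta> * \<beta>"
      using power_add[of \<beta> "2 * n" 2] by (simp add: power2_eq_square mult.assoc)
    hence "inverse (\<beta> ^ (2 * Suc n)) * h * \<beta> ^ (2 * Suc n) = inverse \<beta> * (inverse \<beta> * (inverse (\<beta> ^ (2 * n)) * h * \<beta> ^ (2 * n)) * \<beta>) * \<beta>"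
      by (simp add: grp_simps)
    also have "\<dots> = inverse \<beta> * (g ^ 3) ^ 9 ^ n * \<beta>" unfolding Suc conjb \<beta>h ..
    also have "\<dots> = ((h ^ 3) ^ 3) ^ 9 ^ n" unfolding conjb \<beta>g ..
    also have "\<dots> = h ^ 9 ^ Suc n" by (simp flip: power_mult)
    finally show ?case .
  qed simp
  obtain m where m: "\<beta> ^ m = 1" "m > 0" using B_torsion[OF ab(2)] .
  have "\<beta> ^ (2 * m) = 1" using m by (simp add: mult.commute[of 2] power_mult)
  hence "h = h ^ 9 ^ m" using it[of m] by simp
  moreover have "(9::nat) ^ m = Suc (9 ^ m - 1)" by simp
  ultimately have "h * 1 = h * h ^ (9 ^ m - 1)" by (metis mult.right_neutral power_Suc)
  hence hm: "h ^ (9 ^ m - 1) = 1" using grp_left_cancel by metis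
  have "(9::nat) ^ m - 1 > 0" using one_less_power[of "9::nat" m] m by simp
  define N where "N = (LEAST N. N > 0 \<and> h ^ N = 1)"
  have N: "N > 0" "h ^ N = 1"
    using LeastI[of "\<lambda>N. N > 0 \<and> h ^ N = 1", OF conjI[OF \<open>(9::nat) ^ m - 1 > 0\<close> hm]] by (auto simp: N_def)
  have Nmin: "h ^ i \<noteq> 1" if "0 < i" "i < N" for i using not_less_Least[of i "\<lambda>N. N > 0 \<and> h ^ N = 1"] that by (auto simp: N_def)
  have \<epsilon>h: "\<epsilon> * h ^ i * \<epsilon> = g ^ i" for i
  proof -
    have "\<epsilon> * h * inverse \<epsilon> = g" by (simp add: h_def g_def inv mult.assoc \<epsilon>\<epsilon>')
    thus ?thesis using conj_power[of \<epsilon> h i] by (simp add: inv)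
  qed
  have gi: "g ^ i = inverse (h ^ i)" for i by (simp add: grp_inverse_power hg)
  show False
  proof (cases "even N")
    case True
    then obtain k where k: "N = 2 * k" by blast
    have kN: "0 < k" "k < N" using N k by auto
    define j where "j = h ^ k"
    have j1: "j \<noteq> 1" using Nmin[OF kN] by (simp add: j_def)
    have "j * j = 1" using N k by (simp add: j_def mult_2 flip: power_add)
    hence jinv: "inverse j = j" by (rule grp_inverse_unique)
    have "\<epsilon> * j * \<epsilon> = j" using \<epsilon>h[of k] gi[of k] jinv by (simp add: j_def)
    hence "\<epsilon> * j * \<epsilon> * \<epsilon> = j * \<epsilon>" by simp
    hence j\<epsilon>: "\<epsilon> * j = j * \<epsilon>" by (simp add: mult.assoc \<epsilon>\<epsilon>)
    have jh: "h * j = j * h" unfolding j_def by (simp add: power_commutes)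
    have jz: "z * j = j * z"
    proof -
      have "z = \<epsilon> * h" by (simp add: h_def \<epsilon>\<epsilon>')
      thus ?thesis using j\<epsilon> jh by (metis mult.assoc)
    qed
    have jG: "j \<in> G" unfolding j_def by (rule subgrp_power[OF G hG])
    have "j \<in> A"
    proof -
      obtain a c where a: "a \<in> A" "c \<in> B" "j = a * c" using G_cases[OF jG] unfolding B_def by (metis Un_iff)
      have "c = inverse a * j" using a by simp
      moreover have "\<epsilon> * (inverse a * j) = (inverse a * j) * \<epsilon>" using \<epsilon>A[OF A_inverse[OF a(1)]] j\<epsilon> by (metis mult.assoc)
      ultimately have "c = 1" using CB[OF a(2)] by metis
      thus ?thesis using a by simp
    qed
    moreover have "j \<in> B"
    proof -
      obtain c a where a: "c \<in> B" "a \<in> A" "j = c * a" using G_BA[OF jG] .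
      have "a = inverse c * j" using a by simp
      moreover have "z * (inverse c * j) = (inverse c * j) * z" using z_B[OF subgrp_inverse[OF B a(1)]] jz by (metis mult.assoc)
      ultimately have "a = 1" using CA[OF a(2)] by metis
      thus ?thesis using a by simp
    qed
    ultimately show False using AB j1 by blast
  next
    case False
    then obtain k where k: "N = 2 * k + 1" by (metis oddE)
    define w where "w = h ^ k"
    have "\<epsilon> * inverse w * \<epsilon> = w" using \<epsilon>h[of k] gi[of k]
    proof -
      have "inverse (\<epsilon> * w * \<epsilon>) = inverse (inverse w)" using \<epsilon>h[of k] gi[of k] by (simp add: w_def)
      thus ?thesis by (simp add: grp_simps inv)
    qed
    hence "inverse w * \<epsilon> * w = \<epsilon> * (w * w)" using \<epsilon>\<epsilon>'(1) by (metis mult.assoc)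
    also have "w * w = g"
    proof -
      have "h * (w * w) = 1" using N(2) unfolding k w_def by (simp add: mult_2 power_add)
      thus ?thesis using hg grp_inverse_unique by metis
    qed
    finally have "inverse w * \<epsilon> * w = \<epsilon> * z * \<epsilon>" using \<open>w * w = g\<close> by (simp add: g_def mult.assoc)
    hence zc: "z = (\<epsilon> * inverse w) * \<epsilon> * inverse (\<epsilon> * inverse w)"
      by (simp add: grp_inverse_mult inv) (metis mult.assoc \<epsilon>\<epsilon>'(1) \<epsilon>\<epsilon> mult.right_neutral)
    have "\<epsilon> * inverse w \<in> G" using \<epsilon>Y subgrp_power[OF G hG] by (simp add: w_def G_mult G_inverse)
    then obtain c a where a: "c \<in> B" "a \<in> A" "\<epsilon> * inverse w = c * a" using G_BA by metis
    have "z = c * (a * \<epsilon> * inverse a) * inverse c" using zc unfolding a(3) by (simp add: grp_simps)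
    also have "a * \<epsilon> * inverse a = \<epsilon>" using \<epsilon>A[OF a(2)] by (simp add: mult.assoc) (metis grp_right_inverse mult.assoc mult.right_neutral)
    finally have "z * c = c * \<epsilon>" by (simp add: mult.assoc)
    hence "c * z = c * \<epsilon>" using z_B[OF a(1)] by simp
    hence "z = \<epsilon>" using grp_left_cancel by blast
    thus False using nc by simp
  qed
qed

context doubly_inverted
begin

text \<open>By \<open>permutes_nonabelian_central_square\<close> and its mirror image it remains to treat the case
  that neither \<open>z\<close> nor \<open>\<epsilon>\<close> is central; they commute by \<open>quaternion_commute\<close>. The normal closure
  \<open>N\<close> of \<open>z\<close> centralizes \<open>\<epsilon>\<close>, as \<open>A\<close> does. The centralizer of \<open>\<epsilon>\<close> is \<open>A\<close> times a finite subset
  of \<open>B\<close>, because otherwise it contains \<open>X\<close> and \<open>overgroup\<close> applies; so \<open>N\<close> is covered by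
  finitely many cosets of \<open>Y\<close>. If \<open>Y \<subseteq> N\<close>, then \<open>Y\<close>, having finite index in \<open>N\<close> and no proper
  subgroup of finite index, is normal in \<open>G\<close>. If not, \<open>N\<close> is finite and is centralized by \<open>Y\<close>,
  so \<open>z\<close> is centralized by \<open>Y\<close> and by \<open>B\<close>, and \<open>overgroup\<close> applies to the factors in reverse
  order.\<close>
theorem permutes_nonabelian: "X * A \<subseteq> A * X"
proof (rule ccontr)
  assume goal: "\<not> X * A \<subseteq> A * X"
  interpret S: doubly_inverted q B Y a0 G p X b by (rule doubly_swap)
  have nz: "\<not> z_central" using permutes_nonabelian_central_square goal by blast
  have n\<epsilon>: "\<not> swap.z_central" using S.permutes_nonabelian_central_square permutes_if_swap_permutes goal by blast
  define \<epsilon> where "\<epsilon> = swap.z"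
  have \<epsilon>A: "\<epsilon> * a = a * \<epsilon>" if "a \<in> A" for a using swap.z_B that swap_B by (simp add: \<epsilon>_def)
  have \<epsilon>z: "\<epsilon> * z = z * \<epsilon>" using quaternion_commute by (simp add: \<epsilon>_def)
  let ?C = "centralizer {\<epsilon>}"
  have AC: "A \<subseteq> ?C" using \<epsilon>A by (auto simp: centralizer_def)
  have "\<not> X \<subseteq> ?C"
  proof
    assume "X \<subseteq> ?C"
    hence "?C \<inter> G = G" using overgroup[OF subgrp_Int[OF subgrp_centralizer G], of "{\<epsilon>}"] AC AG XG goal by auto
    hence "g * \<epsilon> = \<epsilon> * g" if "g \<in> G" for g using that by (auto simp: centralizer_def)
    thus False using n\<epsilon> unfolding swap.z_central_def \<epsilon>_def[symmetric] by metis
  qed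
  hence "finite (?C \<inter> X)" by (intro pruefer_subgroup[OF X subgrp_Int[OF subgrp_centralizer Xs]]) auto
  hence finB: "finite (?C \<inter> B)" by (rule finite_Int_B[OF subgrp_centralizer])
  define N where "N = gen z_conjugates"
  have N: "subgrp N" "N \<subseteq> G" and zN: "z \<in> N" using z_closure by (auto simp: N_def)
  have N_conj: "g * n * inverse g \<in> N" if "g \<in> G" "n \<in> N" for g n
    using that z_closure_normal by (simp add: N_def)
  have NC: "N \<subseteq> ?C"
    unfolding N_def
  proof (rule gen_least[OF subgrp_centralizer])
    show "z_conjugates \<subseteq> ?C"
    proof
      fix s assume "s \<in> z_conjugates"
      then obtain a where a: "a \<in> A" "s = inverse a * z * a" by (auto simp: z_conjugates_def)
      have "a \<in> ?C" "z \<in> ?C" using AC a \<epsilon>z by (auto simp: centralizer_def)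
      thus "s \<in> ?C" unfolding a by (simp add: subgrp_mult subgrp_inverse subgrp_centralizer)
    qed
  qed
  have "fcov A N"
  proof (rule fcovI[OF finB])
    fix n assume n: "n \<in> N"
    show "\<exists>h\<in>A. \<exists>f\<in>?C \<inter> B. n = h * f"
    proof (rule centralizer_decomp[OF AC])
      show "n \<in> G" "n \<in> ?C" using n N(2) NC by auto
      show "\<And>a \<beta>. a \<in> A \<Longrightarrow> \<beta> \<in> B \<Longrightarrow> \<beta> \<in> ?C \<Longrightarrow> n = a * \<beta> \<Longrightarrow> \<exists>h\<in>A. \<exists>f\<in>?C \<inter> B. n = h * f" by blast
    qed
  qed
  moreover have "fcov Y A"
    by (rule fcovI[of "{1, a0}"]) (use A_eq in auto)
  ultimately have YN: "fcov Y N" by (rule fcov_trans[rotated])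
  show False
  proof (cases "N \<inter> Y = Y")
    case True
    have "g * y * inverse g \<in> Y" if g: "g \<in> G" "y \<in> Y" for g y
    proof -
      let ?Z = "(\<lambda>y. g * y * inverse g) ` Y"
      have inj: "inj_on (\<lambda>y. g * y * inverse g) Y" by (auto simp: inj_on_def grp_left_cancel grp_right_cancel)
      have "pruefer q ?Z"
        by (rule pruefer_hom_image[OF Y]) (use inj finite_imageD pruefer_infinite[OF Y] in \<open>auto simp: mult.assoc\<close>)
      moreover have "fcov Y ?Z" by (rule fcov_subset[OF YN]) (use True N_conj g in auto)
      ultimately have "?Z \<subseteq> Y" using pruefer_fcov swap.Xs by blast
      thus ?thesis using g by blast
    qed
    thus False using goal permutes_if_commute commute_if_X_normalizes_Y X_in_G by blast
  next
    case False
    hence finY: "finite (Y \<inter> N)" by (intro pruefer_subgroup[OF Y subgrp_Int[OF swap.Xs N(1)]]) auto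
    have "fcov (Y \<inter> N) N" by (rule fcov_Int[OF swap.Xs N(1) YN fcov_refl]) simp
    hence finN: "finite N" using finY by (rule fcov_imp_finite)
    have "y * z = z * y" if y: "y \<in> Y" for y
      by (rule pruefer_acts_trivially[OF Y finN zN _ y]) (use N_conj A_in_G Y_A in blast)
    hence YC: "Y \<subseteq> centralizer {z} \<inter> G" using Y_A A_in_G by (auto simp: centralizer_def)
    have BC: "B \<subseteq> centralizer {z} \<inter> G" using z_B B_in_G by (auto simp: centralizer_def)
    have "Y * B \<subseteq> B * Y \<or> centralizer {z} \<inter> G = G"
      by (rule S.overgroup[OF subgrp_Int[OF subgrp_centralizer G] BC YC]) simp
    moreover have "centralizer {z} \<inter> G \<noteq> G"
    proof
      assume "centralizer {z} \<inter> G = G"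
      hence "g * z = z * g" if "g \<in> G" for g using that by (auto simp: centralizer_def)
      thus False using nz by (simp add: z_central_def)
    qed
    ultimately show False using permutes_if_swap_permutes goal by blast
  qed
qed

end

section \<open>The product with an inverted Pruefer subgroup\<close>

definition inverted_extension :: "nat \<Rightarrow> 'a::grp set \<Rightarrow> 'a \<Rightarrow> 'a set \<Rightarrow> bool" where
  "inverted_extension p X b B \<longleftrightarrow> pruefer p X \<and> (\<forall>x\<in>X. b * x * inverse b = inverse x) \<and> b * b \<in> X \<and>
     B = X \<union> (\<lambda>x. x * b) ` X \<and> subgrp B"

text \<open>If \<open>A\<close> meets \<open>X b\<close>, then \<open>A X\<close> contains \<open>B\<close> and is everything. If \<open>A\<close> is a nonabelian
  extension of \<open>Y\<close> and \<open>A \<inter> X\<close> is not inside \<open>Y\<close>, then \<open>A \<subseteq> Y X\<close>, and the abelian group \<open>Y\<close> can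
  replace \<open>A\<close> as a factor. The other cases are \<open>permutes_abelian\<close> and \<open>permutes_nonabelian\<close>.\<close>
theorem permutes_inverted_extension:
  assumes A: "subgrp A" "commuting A \<or> (\<exists>q Y a0. inverted_extension q Y a0 A)"
    and B: "inverted_extension p X b B" and G: "subgrp (A * B)"
  shows "X * A \<subseteq> A * X"
proof -
  have B': "pruefer p X" "\<And>x. x \<in> X \<Longrightarrow> b * x * inverse b = inverse x" "b * b \<in> X" "B = X \<union> (\<lambda>x. x * b) ` X" "subgrp B"
    using B by (auto simp: inverted_extension_def)
  have Xs: "subgrp X" using pruefer_subgrp[OF B'(1)] .
  have AG: "A \<subseteq> A * B" using subgrp_one[OF B'(5)] by (force simp: mem_times)
  have BG: "B \<subseteq> A * B" using subgrp_one[OF A(1)] by (force simp: mem_times)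
  have XB: "X \<subseteq> B" "b \<in> B" using B'(4) subgrp_one[OF Xs] by force+
  show ?thesis
  proof (cases "A \<inter> (\<lambda>x. x * b) ` X = {}")
    case False
    then obtain t x0 where t: "t \<in> A" "x0 \<in> X" "t = x0 * b" by blast
    show ?thesis
    proof
      fix g assume "g \<in> X * A"
      hence "g \<in> A * B" using XB BG AG subgrp_mult[OF G] unfolding mem_times[of g X A] by blast
      then obtain a \<beta> where a: "a \<in> A" "\<beta> \<in> B" "g = a * \<beta>" unfolding mem_times by blast
      show "g \<in> A * X"
      proof (cases "\<beta> \<in> X")
        case True
        thus ?thesis using a unfolding mem_times by blast
      next
        case False
        then obtain x where x: "x \<in> X" "\<beta> = x * b" using a B'(4) by blast
        have "t * (inverse b * (inverse x0 * x) * inverse (inverse b)) = \<beta>" unfolding t x by (simp add: grp_simps)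
        moreover have "inverse b * (inverse x0 * x) * inverse (inverse b) \<in> X"
        proof -
          have u: "inverse (inverse x0 * x) \<in> X" using Xs t x by (simp add: subgrp_mult subgrp_inverse)
          have "b * inverse (inverse x0 * x) * inverse b = inverse x0 * x" using B'(2)[OF u] by simp
          hence "inverse b * (b * inverse (inverse x0 * x) * inverse b) * b = inverse b * (inverse x0 * x) * b" by simp
          hence "inverse b * (inverse x0 * x) * b = inverse (inverse x0 * x)" by (simp add: mult.assoc)
          thus ?thesis using u by simp
        qed
        ultimately have "g = (a * t) * (inverse b * (inverse x0 * x) * inverse (inverse b))" "a * t \<in> A" "inverse b * (inverse x0 * x) * inverse (inverse b) \<in> X"
          using a t subgrp_mult[OF A(1)] by (auto simp: mult.assoc)
        thus ?thesis unfolding mem_times by blast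
      qed
    qed
  next
    case True
    have I: "inverted_factor p C X b (A * B)"
      if "subgrp C" "C \<subseteq> A" "A * B \<subseteq> C * B" for C
      by (rule inverted_factor.intro) (use that True A B' G AG BG XB in auto)
    show ?thesis
    proof (cases "commuting A")
      case c: True
      show ?thesis by (rule inverted_factor.permutes_abelian[OF I c]) (use A in auto)
    next
      case False
      then obtain q Y a0 where Y: "inverted_extension q Y a0 A" using A by blast
      hence Y': "pruefer q Y" "\<And>y. y \<in> Y \<Longrightarrow> a0 * y * inverse a0 = inverse y" "a0 * a0 \<in> Y" "A = Y \<union> (\<lambda>x. x * a0) ` Y"
        by (auto simp: inverted_extension_def)
      show ?thesis
      proof (cases "A \<inter> X \<subseteq> Y")
        case True
        have "doubly_inverted p A X b (A * B) q Y a0"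
          by (rule doubly_inverted.intro[OF I]) (use A True Y' in \<open>auto simp: doubly_inverted_axioms_def\<close>)
        thus ?thesis by (rule doubly_inverted.permutes_nonabelian)
      next
        case False
        then obtain s where s: "s \<in> A" "s \<in> X" "s \<notin> Y" by blast
        then obtain y0 where y0: "y0 \<in> Y" "s = y0 * a0" using Y'(4) by blast
        have Ys: "subgrp Y" using pruefer_subgrp[OF Y'(1)] .
        have YX: "a \<in> Y * X" if aA: "a \<in> A" for a
        proof (cases "a \<in> Y")
          case True thus ?thesis using subgrp_one[OF Xs] unfolding mem_times by force
        next
          case False
          then obtain y where y: "y \<in> Y" "a = y * a0" using aA Y'(4) by blast
          have "a = (y * inverse y0) * s" unfolding y y0 by (simp add: mult.assoc)
          moreover have "y * inverse y0 \<in> Y" using y y0 Ys by (simp add: subgrp_mult subgrp_inverse)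
          ultimately show ?thesis using s(2) unfolding mem_times by blast
        qed
        have "A * B \<subseteq> Y * B"
        proof
          fix g assume "g \<in> A * B"
          then obtain a \<beta> where a: "a \<in> A" "\<beta> \<in> B" "g = a * \<beta>" unfolding mem_times by blast
          obtain y x where y: "y \<in> Y" "x \<in> X" "a = y * x" using YX[OF a(1)] unfolding mem_times by blast
          have "g = y * (x * \<beta>)" "x * \<beta> \<in> B" using a y XB subgrp_mult[OF B'(5)] by (auto simp: mult.assoc)
          thus "g \<in> Y * B" using y unfolding mem_times by blast
        qed
        hence "X * Y \<subseteq> Y * X"
          by (intro inverted_factor.permutes_abelian[OF I pruefer_commuting[OF Y'(1)]]) (use Ys Y' in auto)
        show ?thesis
        proof
          fix g assume "g \<in> X * A"
          then obtain x a where xa: "x \<in> X" "a \<in> A" "g = x * a" unfolding mem_times by blast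
          obtain y u where y: "y \<in> Y" "u \<in> X" "a = y * u" using YX[OF xa(2)] unfolding mem_times by blast
          have "x * y \<in> X * Y" using xa y unfolding mem_times by blast
          hence "x * y \<in> Y * X" by (rule subsetD[OF \<open>X * Y \<subseteq> Y * X\<close>])
          then obtain y' x' where y': "y' \<in> Y" "x' \<in> X" "x * y = y' * x'" unfolding mem_times by blast
          have "g = (x * y) * u" unfolding xa y by (simp add: mult.assoc)
          hence "g = y' * (x' * u)" unfolding y' by (simp add: mult.assoc)
          moreover have "y' \<in> A" "x' * u \<in> X" using y' Y'(4) subgrp_mult[OF Xs] y by auto
          ultimately show "g \<in> A * X" unfolding mem_times by blast
        qed
      qed
    qed
  qed
qed

text \<open>Here \<open>W\<close> has index at most two in \<open>K\<close>, so membership in \<open>W\<close> is a parity.\<close>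
lemma index_two_commutators:
  assumes W: "subgrp W" and K: "subgrp K" "K \<subseteq> W \<union> (\<lambda>w. k * w) ` W" "W \<subseteq> K" "k \<in> K" and g: "g \<in> K" "h \<in> K"
  shows "cm g h \<in> W"
proof (cases "k \<in> W")
  case True
  hence "K \<subseteq> W" using K subgrp_mult[OF W] by blast
  hence "g \<in> W" "h \<in> W" using g by auto
  thus ?thesis using W by (simp add: cm_def subgrp_mult subgrp_inverse)
next
  case False
  have par: "u * v \<in> W \<longleftrightarrow> (u \<in> W \<longleftrightarrow> v \<in> W)" if uv: "u \<in> K" "v \<in> K" for u v
  proof (cases "u \<in> W \<or> v \<in> W")
    case True
    thus ?thesis using subgrp_mult_left_iff[OF W] subgrp_mult_right_iff[OF W] by blast
  next
    case F: False
    then obtain w w' where w: "w \<in> W" "w' \<in> W" "u = k * w" "v = k * w'" using K uv by blast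
    have "u * v \<in> W"
    proof (rule ccontr)
      assume "u * v \<notin> W"
      then obtain w'' where "w'' \<in> W" "u * v = k * w''" using K(2) subgrp_mult[OF K(1) uv] by blast
      hence "k * (w * (k * w')) = k * w''" using w by (simp add: mult.assoc)
      hence "w * (k * w') \<in> W" using grp_left_cancel \<open>w'' \<in> W\<close> by metis
      thus False using False w subgrp_mult_left_iff[OF W] subgrp_mult_right_iff[OF W] by blast
    qed
    thus ?thesis using F by blast
  qed
  have inK: "g * h \<in> K" "g * h * inverse g \<in> K" "inverse g \<in> K" "inverse h \<in> K"
    using g K(1) by (simp_all add: subgrp_mult subgrp_inverse)
  show ?thesis unfolding cm_def
    using par[OF inK(2,4)] par[OF inK(1,3)] par[OF g] subgrp_inverse_iff[OF W] by auto
qed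

text \<open>For nonabelian \<open>A\<close>, the group \<open>X Y\<close> is abelian and has index at most two in \<open>A X\<close>. That
  \<open>X Y\<close> is a subgroup is \<open>permutes_inverted_extension\<close>, applied to the group \<open>X A\<close> with \<open>X\<close> as
  the first factor and \<open>A\<close> as the second.\<close>
theorem permuting_product_metabelian:
  assumes A: "subgrp A" "commuting A \<or> (\<exists>q Y a0. inverted_extension q Y a0 A)"
    and X: "pruefer p X" and XA: "X * A \<subseteq> A * X"
    and g: "a \<in> A * X" "b \<in> A * X" "c \<in> A * X" "d \<in> A * X"
  shows "cm a b * cm c d = cm c d * cm a b"
proof -
  have Xs: "subgrp X" using pruefer_subgrp[OF X] .
  note K = product_subgrp[OF A(1) Xs XA]
  show ?thesis
  proof (cases "commuting A")
    case True
    interpret abelian_product A X "A * X"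
      by (rule abelian_product.intro) (use A True Xs K pruefer_commuting[OF X] in auto)
    show ?thesis by (rule ito[OF g])
  next
    case False
    then obtain q Y a0 where Y: "inverted_extension q Y a0 A" using A by blast
    hence Y': "pruefer q Y" "\<And>y. y \<in> Y \<Longrightarrow> a0 * y * inverse a0 = inverse y" "a0 * a0 \<in> Y" "A = Y \<union> (\<lambda>x. x * a0) ` Y"
      by (auto simp: inverted_extension_def)
    have Ys: "subgrp Y" using pruefer_subgrp[OF Y'(1)] .
    have "Y * X \<subseteq> X * Y"
      by (rule permutes_inverted_extension[OF Xs _ Y]) (use pruefer_commuting[OF X] K in auto)
    note W = product_subgrp[OF Xs Ys this]
    have com: "commuting (X * Y)"
    proof -
      have xy: "x * y = y * x" if "x \<in> X" "y \<in> Y" for x y by (rule pruefer_product_commute[OF X Y'(1) W(1) that])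
      have "X \<subseteq> centralizer (X \<union> Y)" "Y \<subseteq> centralizer (X \<union> Y)"
        using xy commutingD[OF pruefer_commuting[OF X]] commutingD[OF pruefer_commuting[OF Y'(1)]] by (auto simp: centralizer_def)
      hence "commuting (X \<union> Y)" by (auto simp: commuting_def centralizer_def)
      hence "commuting (gen (X \<union> Y))" by (rule commuting_gen)
      moreover have "X * Y \<subseteq> gen (X \<union> Y)"
        by (auto simp: mem_times intro!: gen_closed intro: gen_incl)
      ultimately show ?thesis by (simp add: commuting_def subset_iff)
    qed
    have a0A: "a0 \<in> A" using Y'(4) subgrp_one[OF Ys] by force
    have sub: "A * X \<subseteq> X * Y \<union> (\<lambda>w. a0 * w) ` (X * Y)"
    proof
      fix g assume "g \<in> A * X"
      then obtain a x where ax: "a \<in> A" "x \<in> X" "g = a * x" unfolding mem_times by blast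
      show "g \<in> X * Y \<union> (\<lambda>w. a0 * w) ` (X * Y)"
      proof (cases "a \<in> Y")
        case True
        thus ?thesis using ax unfolding W(2) mem_times by blast
      next
        case False
        then obtain y where y: "y \<in> Y" "a = y * a0" using ax Y'(4) by blast
        have "y * a0 = a0 * inverse y"
          using Y'(2)[OF subgrp_inverse[OF Ys y(1)]] by (metis grp_inverse_inverse grp_left_inverse mult.assoc mult.right_neutral)
        hence "g = a0 * (inverse y * x)" using ax y by (simp add: mult.assoc)
        moreover have "inverse y * x \<in> X * Y" unfolding W(2) mem_times using subgrp_inverse[OF Ys y(1)] ax by blast
        ultimately show ?thesis by blast
      qed
    qed
    have "Y \<subseteq> A" using Y'(4) by blast
    hence WK: "X * Y \<subseteq> A * X" unfolding W(2) by (rule set_times_mono2) simp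
    have a0K: "a0 \<in> A * X" using a0A subgrp_one[OF Xs] unfolding mem_times by force
    show ?thesis
      using commutingD[OF com] index_two_commutators[OF W(1) K(1) sub WK a0K] g by blast
  qed
qed

section \<open>Recognising inverted extensions\<close>

lemma power_gcd:
  assumes "z ^ m = (1::'a::grp)" "m > 0" shows "\<exists>l::nat. z ^ gcd i m = (z ^ i) ^ l"
proof (cases "i = 0")
  case True
  thus ?thesis using assms by auto
next
  case False
  then obtain x y where "i * x = m * y + gcd i m" using bezout_nat[of i m] by blast
  hence "(z ^ i) ^ x = z ^ (m * y) * z ^ gcd i m" by (simp flip: power_mult power_add)
  also have "\<dots> = z ^ gcd i m" by (simp add: power_mult assms)
  finally show ?thesis by metis
qed

text \<open>The subgroups of a cyclic \<open>p\<close>-group are ordered by inclusion: \<open>z\<^sup>i\<close> generates the same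
  group as \<open>z\<close> to the power \<open>gcd i (p\<^sup>n)\<close>, which is a power of \<open>p\<close>.\<close>
lemma cyclic_p_group_chain:
  fixes z :: "'a::grp" and i j :: nat
  assumes p: "Factorial_Ring.prime (p::nat)" and z: "z ^ p ^ n = 1"
  shows "(\<exists>k::nat. z ^ i = (z ^ j) ^ k) \<or> (\<exists>k::nat. z ^ j = (z ^ i) ^ k)"
proof -
  have p0: "p ^ n > 0" using p prime_gt_0_nat by simp
  have one: "\<exists>k::nat. z ^ j = (z ^ i) ^ k" if "gcd i (p ^ n) dvd gcd j (p ^ n)" for i j
  proof -
    have "gcd i (p ^ n) dvd j" using that gcd_dvd1 by (rule dvd_trans)
    then obtain r where "j = gcd i (p ^ n) * r" ..
    moreover obtain l where "z ^ gcd i (p ^ n) = (z ^ i) ^ l" using power_gcd[OF z p0] by blast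
    ultimately have "z ^ j = (z ^ i) ^ (l * r)" by (metis power_mult)
    thus ?thesis ..
  qed
  obtain a b where ab: "gcd i (p ^ n) = p ^ a" "gcd j (p ^ n) = p ^ b"
    using divides_primepow_nat[OF p] by (metis gcd_dvd2)
  show ?thesis
  proof (cases "a \<le> b")
    case True
    thus ?thesis using one[of i j] ab by (simp add: le_imp_power_dvd)
  next
    case False
    thus ?thesis using one[of j i] ab by (simp add: le_imp_power_dvd)
  qed
qed

text \<open>The subgroup \<open>X\<close> is normal, and \<open>f x = x (b x b\<^sup>-\<^sup>1)\<close> is a homomorphism whose values
  commute with \<open>b\<close>, as \<open>b\<^sup>2 \<in> X\<close>. The centralizer of \<open>b\<close> in \<open>X\<close> is a proper subgroup since \<open>B\<close>
  is not abelian, hence finite; so \<open>f\<close> is trivial and \<open>b\<close> inverts \<open>X\<close>.\<close>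
lemma nonabelian_index_two:
  assumes B: "subgrp B" "\<not> commuting B" and X: "pruefer p X" and b: "b \<in> B"
    and B_eq: "B = X \<union> (\<lambda>x. x * b) ` X"
  shows "inverted_extension p X b B"
proof -
  have Xs: "subgrp X" using pruefer_subgrp[OF X] .
  have Xc: "u * v = v * u" if "u \<in> X" "v \<in> X" for u v using commutingD[OF pruefer_commuting[OF X] that] .
  have XB: "X \<subseteq> B" using B_eq by blast
  have bX: "b \<notin> X"
  proof
    assume "b \<in> X"
    hence "B = X" using B_eq subgrp_mult[OF Xs] by auto
    thus False using B pruefer_commuting[OF X] by simp
  qed
  have left: "B \<subseteq> X \<union> (\<lambda>x. inverse b * x) ` X"
  proof
    fix g assume "g \<in> B"
    hence "inverse g \<in> X \<union> (\<lambda>x. x * b) ` X" using subgrp_inverse[OF B(1)] B_eq by blast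
    thus "g \<in> X \<union> (\<lambda>x. inverse b * x) ` X"
    proof
      assume "inverse g \<in> X" thus ?thesis using subgrp_inverse_iff[OF Xs] by blast
    next
      assume "inverse g \<in> (\<lambda>x. x * b) ` X"
      then obtain x where x: "x \<in> X" "inverse g = x * b" by blast
      hence "g = inverse b * inverse x" by (metis grp_inverse_inverse grp_inverse_mult)
      thus ?thesis using subgrp_inverse[OF Xs x(1)] by blast
    qed
  qed
  have cmX: "cm g h \<in> X" if "g \<in> B" "h \<in> B" for g h
    by (rule index_two_commutators[OF Xs B(1) left XB subgrp_inverse[OF B(1) b] that])
  have conj: "b * x * inverse b \<in> X" if "x \<in> X" for x
    unfolding conj_eq_cm using cmX[OF b] subgrp_mult[OF Xs] that XB by blast
  have bb: "b * b \<in> X"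
  proof -
    have "b * b \<in> B" using subgrp_mult[OF B(1)] b by blast
    moreover have "b * b \<noteq> x * b" if "x \<in> X" for x using that bX by (auto simp: grp_right_cancel)
    ultimately show ?thesis using B_eq by blast
  qed
  define f where "f x = x * (b * x * inverse b)" for x
  have f_hom: "f (x * y) = f x * f y" if "x \<in> X" "y \<in> X" for x y
  proof -
    have "f x * f y = x * ((b * x * inverse b) * y) * (b * y * inverse b)" by (simp add: f_def mult.assoc)
    also have "(b * x * inverse b) * y = y * (b * x * inverse b)" using Xc conj that by blast
    also have "x * (y * (b * x * inverse b)) * (b * y * inverse b) = f (x * y)" by (simp add: f_def mult.assoc)
    finally show ?thesis by simp
  qed
  have f_fix: "b * f x = f x * b" if x: "x \<in> X" for x
  proof -
    have "b * f x * inverse b = (b * x * inverse b) * ((b * b) * x * inverse (b * b))" by (simp add: f_def grp_simps)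
    also have "(b * b) * x * inverse (b * b) = x" unfolding Xc[OF bb x] by (simp add: mult.assoc)
    also have "(b * x * inverse b) * x = f x" unfolding f_def using Xc conj x by blast
    finally have "b * f x * inverse b * b = f x * b" by simp
    thus ?thesis by (simp add: mult.assoc)
  qed
  have "finite (centralizer {b} \<inter> X)"
  proof (rule pruefer_subgroup[OF X subgrp_Int[OF subgrp_centralizer Xs]])
    show "centralizer {b} \<inter> X \<noteq> X"
    proof
      assume "centralizer {b} \<inter> X = X"
      hence xb: "x * b = b * x" if "x \<in> X" for x using that by (auto simp: centralizer_def)
      have "X \<subseteq> centralizer B" "b \<in> centralizer B"
        unfolding centralizer_def B_eq using xb Xc by (auto simp: mult.assoc[symmetric]) (metis mult.assoc)+
      hence "B \<subseteq> centralizer B" using B_eq subgrp_mult[OF subgrp_centralizer] by blast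
      thus False using B(2) by (auto simp: commuting_def centralizer_def)
    qed
  qed auto
  moreover have "f ` X \<subseteq> centralizer {b} \<inter> X"
    using f_fix conj subgrp_mult[OF Xs] by (auto simp: centralizer_def f_def)
  ultimately have "finite (f ` X)" using finite_subset by blast
  note fin = this
  have "f x = 1" if "x \<in> X" for x by (rule pruefer_hom_finite[OF X f_hom fin that])
  hence "b * x * inverse b = inverse x" if "x \<in> X" for x
    using that grp_inverse_unique unfolding f_def by metis
  thus ?thesis unfolding inverted_extension_def using X bb B_eq B by blast
qed

section \<open>Transfer to the group library\<close>

lemma hom_nat_pow:
  assumes "monoid L" "x \<in> carrier L" "f \<one>\<^bsub>L\<^esub> = (1::'b::grp)"
    and "\<And>u v. u \<in> carrier L \<Longrightarrow> v \<in> carrier L \<Longrightarrow> f (u \<otimes>\<^bsub>L\<^esub> v) = f u * f v"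
  shows "f (x [^]\<^bsub>L\<^esub> (n::nat)) = f x ^ n"
proof -
  interpret monoid L by fact
  show ?thesis by (induction n) (use assms in \<open>auto simp: power_commutes\<close>)
qed

text \<open>A faithful permutation representation \<open>\<phi>\<close>. It carries the given group into the type class;
  the lemmas below translate each hypothesis and each conclusion along \<open>\<phi>\<close>.\<close>
locale cayley = group G for G :: "('a, 'b) monoid_scheme" (structure) +
  fixes \<phi> :: "'a \<Rightarrow> 'a sym"
  assumes hom: "x \<in> carrier G \<Longrightarrow> y \<in> carrier G \<Longrightarrow> \<phi> (x \<otimes> y) = \<phi> x * \<phi> y"
    and inj: "x \<in> carrier G \<Longrightarrow> y \<in> carrier G \<Longrightarrow> \<phi> x = \<phi> y \<Longrightarrow> x = y"

lemma cayley_exists: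
  assumes "Group.group G" obtains \<phi> where "cayley G \<phi>"
proof -
  interpret group G by fact
  obtain \<phi> :: "'a \<Rightarrow> 'a sym" where \<phi>: "\<And>g h. g \<in> carrier G \<Longrightarrow> h \<in> carrier G \<Longrightarrow> \<phi> (g \<otimes>\<^bsub>G\<^esub> h) = \<phi> g * \<phi> h"
    "\<And>g h. g \<in> carrier G \<Longrightarrow> h \<in> carrier G \<Longrightarrow> \<phi> g = \<phi> h \<longleftrightarrow> (\<forall>\<omega>\<in>carrier G. g \<otimes>\<^bsub>G\<^esub> \<omega> = h \<otimes>\<^bsub>G\<^esub> \<omega>)"
    by (rule action_hom[of "carrier G" "carrier G" "monoid.mult G" "monoid.mult G" "m_inv G" "\<one>\<^bsub>G\<^esub>"]) (auto simp: m_assoc)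
  have "cayley G \<phi>"
  proof
    fix x y assume "x \<in> carrier G" "y \<in> carrier G" "\<phi> x = \<phi> y"
    hence "x \<otimes>\<^bsub>G\<^esub> \<one>\<^bsub>G\<^esub> = y \<otimes>\<^bsub>G\<^esub> \<one>\<^bsub>G\<^esub>" using \<phi>(2) one_closed by blast
    thus "x = y" using \<open>x \<in> carrier G\<close> \<open>y \<in> carrier G\<close> by simp
  qed (rule \<phi>(1))
  thus ?thesis using that by blast
qed

context cayley
begin

lemma phi_one: "\<phi> \<one> = 1"
proof -
  have "\<phi> \<one> * \<phi> \<one> = \<phi> \<one> * 1" using hom[of \<one> \<one>] by simp
  thus ?thesis using grp_left_cancel by blast
qed

lemma phi_inv: "x \<in> carrier G \<Longrightarrow> \<phi> (inv x) = inverse (\<phi> x)"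
  using hom[of x "inv x"] phi_one by (intro grp_inverse_unique[symmetric]) simp

lemma inj_on_phi: "inj_on \<phi> (carrier G)" using inj by (auto simp: inj_on_def)

lemma phi_mem_iff: "S \<subseteq> carrier G \<Longrightarrow> x \<in> carrier G \<Longrightarrow> \<phi> x \<in> \<phi> ` S \<longleftrightarrow> x \<in> S"
  using inj by blast

lemma subgrp_iff: assumes "S \<subseteq> carrier G" shows "subgrp (\<phi> ` S) \<longleftrightarrow> subgroup S G"
proof
  assume S: "subgrp (\<phi> ` S)"
  show "subgroup S G"
  proof
    show "S \<subseteq> carrier G" by fact
    show "\<one> \<in> S" using subgrp_one[OF S] phi_one phi_mem_iff[OF assms one_closed] by simp
  next
    fix x y assume xy: "x \<in> S" "y \<in> S"
    hence c: "x \<in> carrier G" "y \<in> carrier G" using assms by auto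
    have "\<phi> (x \<otimes> y) \<in> \<phi> ` S" unfolding hom[OF c] by (rule subgrp_mult[OF S]) (use xy in auto)
    thus "x \<otimes> y \<in> S" using phi_mem_iff[OF assms] c by simp
  next
    fix x assume x: "x \<in> S"
    hence c: "x \<in> carrier G" using assms by auto
    have "\<phi> (inv x) \<in> \<phi> ` S" unfolding phi_inv[OF c] by (rule subgrp_inverse[OF S]) (use x in auto)
    thus "inv x \<in> S" using phi_mem_iff[OF assms] c by simp
  qed
next
  assume S: "subgroup S G"
  interpret S: subgroup S G by fact
  show "subgrp (\<phi> ` S)"
    unfolding subgrp_def
  proof (intro conjI ballI)
    show "1 \<in> \<phi> ` S" using phi_one S.one_closed by (metis imageI)
  next
    fix x y assume "x \<in> \<phi> ` S" "y \<in> \<phi> ` S"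
    then obtain u v where "u \<in> S" "v \<in> S" "x = \<phi> u" "y = \<phi> v" by blast
    thus "x * y \<in> \<phi> ` S" using hom[of u v] S.m_closed[of u v] S.mem_carrier by (metis imageI)
  next
    fix x assume "x \<in> \<phi> ` S"
    then obtain u where "u \<in> S" "x = \<phi> u" by blast
    thus "inverse x \<in> \<phi> ` S" using phi_inv[of u] S.m_inv_closed[of u] S.mem_carrier by (metis imageI)
  qed
qed

lemma phi_product: assumes "S \<subseteq> carrier G" "R \<subseteq> carrier G" shows "\<phi> ` (S <#> R) = \<phi> ` S * \<phi> ` R"
proof
  show "\<phi> ` (S <#> R) \<subseteq> \<phi> ` S * \<phi> ` R"
    using assms hom by (auto simp: set_mult_def mem_times subset_eq)
  show "\<phi> ` S * \<phi> ` R \<subseteq> \<phi> ` (S <#> R)"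
  proof
    fix g assume "g \<in> \<phi> ` S * \<phi> ` R"
    then obtain s r where "s \<in> S" "r \<in> R" "g = \<phi> s * \<phi> r" unfolding mem_times by blast
    moreover from this have "\<phi> (s \<otimes> r) = \<phi> s * \<phi> r" "s \<otimes> r \<in> S <#> R"
      using assms by (auto simp: set_mult_def intro!: hom)
    ultimately have "g = \<phi> (s \<otimes> r)" "s \<otimes> r \<in> S <#> R" by simp_all
    thus "g \<in> \<phi> ` (S <#> R)" by blast
  qed
qed

lemma phi_subset: "S \<subseteq> carrier G \<Longrightarrow> R \<subseteq> carrier G \<Longrightarrow> \<phi> ` S \<subseteq> \<phi> ` R \<longleftrightarrow> S \<subseteq> R"
  using phi_mem_iff by blast

lemma commuting_iff: assumes S: "subgroup S G" shows "commuting (\<phi> ` S) \<longleftrightarrow> comm_group (G\<lparr>carrier := S\<rparr>)"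
proof
  interpret S: subgroup S G by fact
  assume c: "commuting (\<phi> ` S)"
  show "comm_group (G\<lparr>carrier := S\<rparr>)"
  proof (rule group.group_comm_groupI[OF subgroup_imp_group[OF S]])
    fix x y assume "x \<in> carrier (G\<lparr>carrier := S\<rparr>)" "y \<in> carrier (G\<lparr>carrier := S\<rparr>)"
    hence xy: "x \<in> S" "y \<in> S" by auto
    hence "\<phi> (x \<otimes> y) = \<phi> (y \<otimes> x)" using c hom by (simp add: commuting_def)
    thus "x \<otimes>\<^bsub>G\<lparr>carrier := S\<rparr>\<^esub> y = y \<otimes>\<^bsub>G\<lparr>carrier := S\<rparr>\<^esub> x" using inj xy by simp
  qed
next
  interpret S: subgroup S G by fact
  assume "comm_group (G\<lparr>carrier := S\<rparr>)"
  then interpret C: comm_group "G\<lparr>carrier := S\<rparr>" .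
  show "commuting (\<phi> ` S)"
    unfolding commuting_def
  proof clarify
    fix x y assume xy: "x \<in> S" "y \<in> S"
    hence "x \<otimes> y = y \<otimes> x" using C.m_comm[of x y] by simp
    thus "\<phi> x * \<phi> y = \<phi> y * \<phi> x" using hom[of x y] hom[of y x] xy by simp
  qed
qed

text \<open>Two elements \<open>x\<close> and \<open>y\<close> generate a cyclic group, whose generator has order dividing a
  power of \<open>p\<close>; negative powers become positive ones, and then \<open>cyclic_p_group_chain\<close> compares
  \<open>x\<close> and \<open>y\<close>.\<close>
lemma pruefer_phi:
  assumes Y: "subgroup Y G" and q: "quasicyclic (G\<lparr>carrier := Y\<rparr>)"
  obtains p where "pruefer p (\<phi> ` Y)"
proof -
  interpret Y: subgroup Y G by fact
  let ?Y = "G\<lparr>carrier := Y\<rparr>"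
  interpret YG: group ?Y by (rule subgroup_imp_group[OF Y])
  obtain p where p: "Factorial_Ring.prime p" "\<And>x. x \<in> Y \<Longrightarrow> \<exists>n. group.ord ?Y x = p ^ n"
    and inf: "infinite Y" and lc: "locally_cyclic ?Y"
    using q by (auto simp: quasicyclic_def p_group_def)
  have tors: "\<exists>n. \<phi> x ^ p ^ n = 1" if x: "x \<in> Y" for x
  proof -
    obtain n where n: "YG.ord x = p ^ n" using p x by blast
    have "x [^]\<^bsub>?Y\<^esub> (p ^ n) = \<one>" using YG.pow_ord_eq_1[of x] x n by simp
    moreover have "\<phi> (x [^]\<^bsub>?Y\<^esub> (p ^ n)) = \<phi> x ^ p ^ n"
      by (rule hom_nat_pow[OF YG.is_monoid]) (use x phi_one hom in auto)
    ultimately show ?thesis using phi_one by metis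
  qed
  have p0: "p > 0" using p prime_gt_0_nat by blast
  have chain: "(\<exists>k::nat. \<phi> x = \<phi> y ^ k) \<or> (\<exists>k::nat. \<phi> y = \<phi> x ^ k)" if xy: "x \<in> Y" "y \<in> Y" for x y
  proof -
    define L where "L = subgroup_generated ?Y {x, y}"
    have L: "Group.group L" unfolding L_def by (rule YG.group_subgroup_generated)
    interpret L: group L by (rule L)
    have cyc: "cyclic_group L" using lc xy by (auto simp: locally_cyclic_def L_def)
    have LY: "carrier L \<subseteq> Y" unfolding L_def using YG.carrier_subgroup_generated_subset by auto
    have Lc: "u \<in> carrier G" if "u \<in> carrier L" for u using LY that by auto
    have Lm: "u \<otimes>\<^bsub>L\<^esub> v = u \<otimes> v" "\<one>\<^bsub>L\<^esub> = \<one>" for u v by (simp_all add: L_def)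
    have xyL: "x \<in> carrier L" "y \<in> carrier L"
      unfolding L_def using YG.subgroup_generated_subset_carrier_subset[of "{x, y}"] xy by auto
    obtain z where z: "z \<in> carrier L" "carrier L = range (\<lambda>n::int. z [^]\<^bsub>L\<^esub> n)"
      using cyc L.cyclic_group by blast
    obtain n where n: "\<phi> z ^ p ^ n = 1" using tors z LY by blast
    have pn: "p ^ n > 0" using p0 by simp
    have pw: "\<exists>k::nat. \<phi> u = \<phi> z ^ k" if uL: "u \<in> carrier L" for u
    proof -
      obtain i :: int where i: "u = z [^]\<^bsub>L\<^esub> i" using z(2) uL by blast
      have np: "\<phi> (z [^]\<^bsub>L\<^esub> (k::nat)) = \<phi> z ^ k" for k
        by (rule hom_nat_pow[OF L.is_monoid z(1)]) (use Lm phi_one hom Lc in auto)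
      have invL: "inv\<^bsub>L\<^esub> w = inv w" if "w \<in> carrier L" for w
      proof -
        have "inv\<^bsub>L\<^esub> w \<otimes> w = \<one>" using L.l_inv[OF that] Lm by simp
        from inv_equality[OF this Lc[OF that] Lc[OF L.inv_closed[OF that]]]
        show ?thesis by simp
      qed
      show ?thesis
      proof (cases "i < 0")
        case True
        hence "u = inv\<^bsub>L\<^esub> (z [^]\<^bsub>L\<^esub> nat (- i))" unfolding i int_pow_def2 by (simp only: if_True)
        hence "\<phi> u = inverse (\<phi> z ^ nat (- i))"
          using invL[OF L.nat_pow_closed[OF z(1)]] phi_inv[OF Lc[OF L.nat_pow_closed[OF z(1)]]] np
          by (simp only: )
        also have "\<dots> = (\<phi> z ^ (p ^ n - 1)) ^ nat (- i)"
          using inverse_as_power[OF n pn] by (simp add: grp_inverse_power)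
        finally show ?thesis by (metis power_mult)
      next
        case False
        hence "u = z [^]\<^bsub>L\<^esub> nat i" unfolding i int_pow_def2 by (simp only: if_False)
        thus ?thesis using np by metis
      qed
    qed
    obtain i where i: "\<phi> x = \<phi> z ^ i" using pw[OF xyL(1)] ..
    obtain j where j: "\<phi> y = \<phi> z ^ j" using pw[OF xyL(2)] ..
    show ?thesis unfolding i j by (rule cyclic_p_group_chain[OF p(1) n])
  qed
  have "infinite (\<phi> ` Y)" using inf finite_imageD inj_on_subset[OF inj_on_phi Y.subset] by blast
  moreover have "subgrp (\<phi> ` Y)" using subgrp_iff[OF Y.subset] Y by simp
  ultimately have "pruefer p (\<phi> ` Y)" unfolding pruefer_def using p(1) tors chain by blast
  thus ?thesis using that by blast
qed

lemma index_two_cover: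
  assumes B: "subgroup B G" and Q: "quasicyclic_index_two Q (G\<lparr>carrier := B\<rparr>)"
  obtains b where "subgroup Q G" "Q \<subseteq> B" "b \<in> B" "b \<notin> Q" "B = Q \<union> (\<lambda>x. x \<otimes> b) ` Q" "quasicyclic (G\<lparr>carrier := Q\<rparr>)"
proof -
  let ?B = "G\<lparr>carrier := B\<rparr>"
  interpret BG: group ?B by (rule subgroup_imp_group[OF B])
  have QB: "subgroup Q ?B" and qc: "quasicyclic (G\<lparr>carrier := Q\<rparr>)" and card: "card (rcosets\<^bsub>?B\<^esub> Q) = 2"
    using Q by (auto simp: quasicyclic_index_two_def subgroup_index_def)
  have QG: "subgroup Q G" using incl_subgroup[OF B QB] .
  have QsB: "Q \<subseteq> B" using subgroup.subset[OF QB] by simp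
  have "Q \<in> rcosets\<^bsub>?B\<^esub> Q" using subgroup.subgroup_in_rcosets[OF QB BG.is_group] .
  then obtain C where C: "rcosets\<^bsub>?B\<^esub> Q = {Q, C}" "C \<noteq> Q"
  proof -
    obtain C D where CD: "rcosets\<^bsub>?B\<^esub> Q = {C, D}" "C \<noteq> D" using card by (auto simp: card_2_iff)
    thus ?thesis using that \<open>Q \<in> rcosets\<^bsub>?B\<^esub> Q\<close> by (metis insertE insert_commute singletonD)
  qed
  have "C \<in> rcosets\<^bsub>?B\<^esub> Q" using C by blast
  then obtain b where b: "b \<in> B" "C = Q #>\<^bsub>?B\<^esub> b" by (auto simp: RCOSETS_def)
  have C_eq: "C = (\<lambda>x. x \<otimes> b) ` Q" using b by (auto simp: r_coset_def)
  have "B = Q \<union> C" using BG.rcosets_part_G[OF QB] C by auto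
  moreover have "b \<notin> Q" using BG.coset_join2[OF _ QB] b C by auto
  ultimately show ?thesis using that QG QsB b C_eq qc by blast
qed

lemma inverted_extension_phi:
  assumes B: "subgroup B G" and nc: "\<not> comm_group (G\<lparr>carrier := B\<rparr>)"
    and Q: "subgroup Q G" "Q \<subseteq> B" "b \<in> B" "B = Q \<union> (\<lambda>x. x \<otimes> b) ` Q" "quasicyclic (G\<lparr>carrier := Q\<rparr>)"
  obtains p where "inverted_extension p (\<phi> ` Q) (\<phi> b) (\<phi> ` B)"
proof -
  interpret B: subgroup B G by fact
  obtain p where p: "pruefer p (\<phi> ` Q)" using pruefer_phi[OF Q(1,5)] .
  have "\<phi> ` B = \<phi> ` Q \<union> \<phi> ` (\<lambda>x. x \<otimes> b) ` Q" by (subst Q(4)) (simp add: image_Un)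
  also have "\<phi> ` (\<lambda>x. x \<otimes> b) ` Q = (\<lambda>x. x * \<phi> b) ` \<phi> ` Q"
  proof -
    have "\<phi> (x \<otimes> b) = \<phi> x * \<phi> b" if "x \<in> Q" for x using hom that Q B.mem_carrier by blast
    thus ?thesis by (auto simp: image_image)
  qed
  finally have B_eq: "\<phi> ` B = \<phi> ` Q \<union> (\<lambda>x. x * \<phi> b) ` \<phi> ` Q" .
  have "inverted_extension p (\<phi> ` Q) (\<phi> b) (\<phi> ` B)"
  proof (rule nonabelian_index_two[OF _ _ p _ B_eq])
    show "subgrp (\<phi> ` B)" using subgrp_iff[OF B.subset] B by simp
    show "\<not> commuting (\<phi> ` B)" using commuting_iff[OF B] nc by simp
    show "\<phi> b \<in> \<phi> ` B" using Q(3) by blast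
  qed
  thus ?thesis using that by blast
qed

lemma factor_phi:
  assumes A: "subgroup A G" and "comm_group (G\<lparr>carrier := A\<rparr>) \<or> (\<exists>Y. quasicyclic_index_two Y (G\<lparr>carrier := A\<rparr>))"
  shows "subgrp (\<phi> ` A)" "commuting (\<phi> ` A) \<or> (\<exists>q Y a0. inverted_extension q Y a0 (\<phi> ` A))"
proof -
  show "subgrp (\<phi> ` A)" using subgrp_iff A subgroup.subset by blast
  show "commuting (\<phi> ` A) \<or> (\<exists>q Y a0. inverted_extension q Y a0 (\<phi> ` A))"
  proof (cases "comm_group (G\<lparr>carrier := A\<rparr>)")
    case True
    thus ?thesis using commuting_iff[OF A] by blast
  next
    case False
    then obtain Y where "quasicyclic_index_two Y (G\<lparr>carrier := A\<rparr>)" using assms by blast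
    from index_two_cover[OF A this] show ?thesis using inverted_extension_phi[OF A False] by metis
  qed
qed

lemma phi_generate: "S \<subseteq> carrier G \<Longrightarrow> \<phi> ` generate G S \<subseteq> gen (\<phi> ` S)"
proof clarify
  fix x assume S: "S \<subseteq> carrier G" and "x \<in> generate G S"
  from this(2) show "\<phi> x \<in> gen (\<phi> ` S)"
  proof (induction rule: generate.induct)
    case one thus ?case by (simp add: phi_one gen_one)
  next
    case (incl h) thus ?case by (simp add: gen_incl)
  next
    case (inv h) thus ?case using S by (subst phi_inv) (auto intro: gen_inverse gen_incl)
  next
    case (eng h1 h2)
    hence "h1 \<in> carrier G" "h2 \<in> carrier G" using generate_in_carrier[OF S] by auto
    thus ?case using eng by (simp add: hom gen_closed)
  qed
qed

text \<open>Commutators of a subgroup commute if and only if its derived subgroup, which they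
  generate, is abelian.\<close>
lemma metabelian_transfer:
  assumes K: "subgroup K G"
    and cm: "\<And>a b c d. a \<in> \<phi> ` K \<Longrightarrow> b \<in> \<phi> ` K \<Longrightarrow> c \<in> \<phi> ` K \<Longrightarrow> d \<in> \<phi> ` K \<Longrightarrow> cm a b * cm c d = cm c d * cm a b"
  shows "metabelian (G\<lparr>carrier := K\<rparr>)" "derived G (derived G K) = {\<one>}"
proof -
  interpret K: subgroup K G by fact
  have sub: "subgroup (derived G K) G" by (rule derived_is_subgroup[OF K.subset])
  have com: "commuting (\<phi> ` derived G K)"
  proof -
    have S: "derived_set G K \<subseteq> carrier G" by (rule derived_set_in_carrier[OF K.subset])
    have "\<phi> ` derived_set G K \<subseteq> {cm a b | a b. a \<in> \<phi> ` K \<and> b \<in> \<phi> ` K}"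
    proof clarify
      fix x y assume xy: "x \<in> K" "y \<in> K"
      hence "\<phi> (x \<otimes> y \<otimes> inv x \<otimes> inv y) = cm (\<phi> x) (\<phi> y)" using hom phi_inv by (simp add: cm_def)
      thus "\<exists>a b. \<phi> (x \<otimes> y \<otimes> inv x \<otimes> inv y) = cm a b \<and> a \<in> \<phi> ` K \<and> b \<in> \<phi> ` K" using xy by blast
    qed
    moreover have "commuting {cm a b | a b. a \<in> \<phi> ` K \<and> b \<in> \<phi> ` K}"
      unfolding commuting_def using cm by clarsimp
    ultimately have "commuting (\<phi> ` derived_set G K)" unfolding commuting_def by (meson subsetD)
    hence "commuting (gen (\<phi> ` derived_set G K))" by (rule commuting_gen)
    moreover have "\<phi> ` derived G K \<subseteq> gen (\<phi> ` derived_set G K)" unfolding derived_def by (rule phi_generate[OF S])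
    ultimately show ?thesis unfolding commuting_def by blast
  qed
  have cg: "comm_group (G\<lparr>carrier := derived G K\<rparr>)" using commuting_iff[OF sub] com by simp
  have "derived (G\<lparr>carrier := K\<rparr>) K = derived G K" using derived_consistent[OF order_refl K] by simp
  thus "metabelian (G\<lparr>carrier := K\<rparr>)" unfolding metabelian_def using cg subgroup_imp_group[OF K] by simp
  have "derived (G\<lparr>carrier := derived G K\<rparr>) (derived G K) = {\<one>}"
    using comm_group.derived_eq_singleton[OF cg] by simp
  thus "derived G (derived G K) = {\<one>}" using derived_consistent[OF order_refl sub] by simp
qed

lemma solvable_from_metabelian:
  assumes K: "subgroup K G" "derived G (carrier G) \<subseteq> K" "derived G (derived G K) = {\<one>}"
  shows "solvable G" "derived_length G \<le> 3"
proof -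
  have "(derived G ^^ 3) (carrier G) = derived G (derived G (derived G (carrier G)))" by (simp add: numeral_3_eq_3)
  also have "\<dots> \<subseteq> derived G (derived G K)"
    using K subgroup.subset[OF K(1)] by (intro mono_derived derived_in_carrier) auto
  finally have le: "(derived G ^^ 3) (carrier G) \<subseteq> {\<one>}" using K by simp
  moreover have "subgroup ((derived G ^^ 3) (carrier G)) G" by (rule exp_of_derived_is_subgroup[OF subgroup_self])
  ultimately have eq: "(derived G ^^ 3) (carrier G) = {\<one>}" using subgroup.one_closed by blast
  thus "solvable G" unfolding solvable_iff_trivial_derived_seq by blast
  show "derived_length G \<le> 3" unfolding derived_length_def using eq by (rule Least_le)
qed

text \<open>The inclusion \<open>X A \<subseteq> A X\<close> and its consequence that \<open>A X\<close> is metabelian are transported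
  along \<open>\<phi>\<close>. The cosets of \<open>A X\<close> are \<open>A X\<close> and \<open>A X b\<close>; they are different if and only if
  \<open>A \<inter> B \<subseteq> X\<close>, with \<open>Q\<close> in the place of \<open>X\<close>.\<close>
lemma nonabelian_factor_structure:
  assumes A: "subgroup A G" and B: "subgroup B G" and G: "carrier G = A <#> B"
    and hA: "comm_group (G\<lparr>carrier := A\<rparr>) \<or> (\<exists>Y. quasicyclic_index_two Y (G\<lparr>carrier := A\<rparr>))"
    and nc: "\<not> comm_group (G\<lparr>carrier := B\<rparr>)" and Q: "quasicyclic_index_two Q (G\<lparr>carrier := B\<rparr>)"
  shows "A <#> Q = Q <#> A" "subgroup (A <#> Q) G" "metabelian (G\<lparr>carrier := A <#> Q\<rparr>)"
    "if A \<inter> B \<subseteq> Q then subgroup_index G (A <#> Q) = 2 else A <#> Q = carrier G"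
    "solvable G" "derived_length G \<le> 3"
proof -
  interpret A: subgroup A G by fact
  interpret B: subgroup B G by fact
  obtain b where b: "subgroup Q G" "Q \<subseteq> B" "b \<in> B" "b \<notin> Q" "B = Q \<union> (\<lambda>x. x \<otimes> b) ` Q" "quasicyclic (G\<lparr>carrier := Q\<rparr>)"
    using index_two_cover[OF B Q] .
  interpret Q: subgroup Q G by (rule b(1))
  obtain p where p: "inverted_extension p (\<phi> ` Q) (\<phi> b) (\<phi> ` B)"
    using inverted_extension_phi[OF B nc b(1,2,3,5,6)] .
  have X: "pruefer p (\<phi> ` Q)" using p by (simp add: inverted_extension_def)
  have "subgrp (\<phi> ` carrier G)" using subgrp_iff[OF order_refl] subgroup_self by simp
  hence AB: "subgrp (\<phi> ` A * \<phi> ` B)" using phi_product[OF A.subset B.subset] G by simp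
  note hA' = factor_phi[OF A hA]
  have XA: "\<phi> ` Q * \<phi> ` A \<subseteq> \<phi> ` A * \<phi> ` Q" by (rule permutes_inverted_extension[OF hA' p AB])
  note K' = product_subgrp[OF hA'(1) pruefer_subgrp[OF X] XA]
  let ?K = "A <#> Q"
  have Kc: "?K \<subseteq> carrier G" "Q <#> A \<subseteq> carrier G" using set_mult_closed A.subset Q.subset by auto
  have \<phi>K: "\<phi> ` ?K = \<phi> ` A * \<phi> ` Q" by (rule phi_product[OF A.subset Q.subset])
  have "\<phi> ` ?K = \<phi> ` (Q <#> A)" using K' \<phi>K phi_product[OF Q.subset A.subset] by simp
  thus "A <#> Q = Q <#> A" using phi_subset[OF Kc] phi_subset[OF Kc(2,1)] by blast
  show K: "subgroup ?K G" using subgrp_iff[OF Kc(1)] K' \<phi>K by simp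
  interpret K: subgroup ?K G by (rule K)
  have cmK: "cm a b * cm c d = cm c d * cm a b"
    if "a \<in> \<phi> ` ?K" "b \<in> \<phi> ` ?K" "c \<in> \<phi> ` ?K" "d \<in> \<phi> ` ?K" for a b c d
    using permuting_product_metabelian[OF hA' X XA] that unfolding \<phi>K by blast
  note met = metabelian_transfer[OF K cmK]
  show "metabelian (G\<lparr>carrier := A <#> Q\<rparr>)" by (rule met(1))
  have mK: "a \<otimes> x \<in> ?K" if "a \<in> A" "x \<in> Q" for a x using that unfolding set_mult_def by blast
  have AK: "a \<in> ?K" if "a \<in> A" for a using mK[OF that Q.one_closed] that by simp
  have QK: "x \<in> ?K" if "x \<in> Q" for x using mK[OF A.one_closed that] that by simp
  have bG: "b \<in> carrier G" using b by auto
  have cover: "g \<in> ?K \<or> (\<exists>k\<in>?K. g = k \<otimes> b)" if g: "g \<in> carrier G" for g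
  proof -
    obtain a \<beta> where a: "a \<in> A" "\<beta> \<in> B" "g = a \<otimes> \<beta>" using g G by (auto simp: set_mult_def)
    show ?thesis
    proof (cases "\<beta> \<in> Q")
      case True thus ?thesis using a by (auto simp: set_mult_def)
    next
      case False
      then obtain x where x: "x \<in> Q" "\<beta> = x \<otimes> b" using a b(5) by blast
      hence "g = (a \<otimes> x) \<otimes> b" using a bG by (simp add: m_assoc)
      moreover have "a \<otimes> x \<in> ?K" using a x by (auto simp: set_mult_def)
      ultimately show ?thesis by blast
    qed
  qed
  have derK: "derived G (carrier G) \<subseteq> ?K"
    unfolding derived_def
  proof (rule generate_subgroup_incl[OF _ K], clarify)
    fix g h assume gh: "g \<in> carrier G" "h \<in> carrier G"
    have "cm (\<phi> g) (\<phi> h) \<in> \<phi> ` ?K"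
    proof (rule index_two_commutators[of "\<phi> ` ?K" "\<phi> ` carrier G" "inverse (\<phi> b)"])
      show "subgrp (\<phi> ` ?K)" "subgrp (\<phi> ` carrier G)" using subgrp_iff Kc K subgroup_self by auto
      show "\<phi> ` carrier G \<subseteq> \<phi> ` ?K \<union> (\<lambda>w. inverse (\<phi> b) * w) ` \<phi> ` ?K"
      proof clarify
        fix g assume g: "g \<in> carrier G" "\<phi> g \<notin> (\<lambda>w. inverse (\<phi> b) * w) ` \<phi> ` ?K"
        show "\<phi> g \<in> \<phi> ` ?K"
        proof (rule ccontr)
          assume n: "\<phi> g \<notin> \<phi> ` ?K"
          have "inv g \<notin> ?K" using n g K.m_inv_closed[of "inv g"] by auto
          then obtain k where k: "k \<in> ?K" "inv g = k \<otimes> b" using cover[of "inv g"] g by auto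
          hence kc: "k \<in> carrier G" by auto
          have "\<phi> g = inverse (\<phi> (inv g))" using g phi_inv by simp
          also have "\<dots> = inverse (\<phi> b) * \<phi> (inv k)" using k kc bG hom phi_inv by (simp add: grp_inverse_mult)
          finally show False using g(2) K.m_inv_closed[OF k(1)] by blast
        qed
      qed
      show "\<phi> ` ?K \<subseteq> \<phi> ` carrier G" using Kc by blast
      show "inverse (\<phi> b) \<in> \<phi> ` carrier G" using phi_inv[OF bG] bG by (metis imageI inv_closed)
    qed (use gh in auto)
    moreover have "cm (\<phi> g) (\<phi> h) = \<phi> (g \<otimes> h \<otimes> inv g \<otimes> inv h)" using gh hom phi_inv by (simp add: cm_def)
    ultimately show "g \<otimes> h \<otimes> inv g \<otimes> inv h \<in> ?K" using phi_mem_iff[OF Kc(1)] gh by simp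
  qed
  show "solvable G" "derived_length G \<le> 3" using solvable_from_metabelian[OF K derK met(2)] by auto
  show "if A \<inter> B \<subseteq> Q then subgroup_index G (A <#> Q) = 2 else A <#> Q = carrier G"
  proof (cases "A \<inter> B \<subseteq> Q")
    case True
    have bK: "b \<notin> ?K"
    proof
      assume "b \<in> ?K"
      then obtain a x where ax: "a \<in> A" "x \<in> Q" "b = a \<otimes> x" by (auto simp: set_mult_def)
      hence "a = b \<otimes> inv x" using bG A.mem_carrier Q.mem_carrier by (metis inv_solve_right)
      hence "a \<in> B" using b(2,3) B.m_closed[OF b(3) B.m_inv_closed[of x]] ax(2) by auto
      hence "a \<in> Q" using True ax by blast
      thus False using ax b Q.m_closed by blast
    qed
    have "rcosets ?K = {?K, ?K #> b}"
    proof
      show "rcosets ?K \<subseteq> {?K, ?K #> b}"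
      proof
        fix C assume "C \<in> rcosets ?K"
        then obtain g where g: "g \<in> carrier G" "C = ?K #> g" by (auto simp: RCOSETS_def)
        from cover[OF g(1)] show "C \<in> {?K, ?K #> b}"
        proof
          assume "g \<in> ?K" thus ?thesis using coset_join2[OF g(1) K] g by simp
        next
          assume "\<exists>k\<in>?K. g = k \<otimes> b"
          hence "g \<in> ?K #> b" by (auto simp: r_coset_def)
          thus ?thesis using repr_independence[OF _ bG K] g by blast
        qed
      qed
      show "{?K, ?K #> b} \<subseteq> rcosets ?K"
        using K.subgroup_in_rcosets[OF is_group] bG by (auto simp: RCOSETS_def)
    qed
    moreover have "?K \<noteq> ?K #> b" using rcos_self[OF bG K] bK by blast
    ultimately show ?thesis using True by (simp add: subgroup_index_def)
  next
    case False
    then obtain s where s: "s \<in> A" "s \<in> B" "s \<notin> Q" by blast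
    then obtain x where x: "x \<in> Q" "s = x \<otimes> b" using b(5) by blast
    have "b = inv x \<otimes> s" using x bG Q.mem_carrier by (simp add: m_assoc[symmetric])
    hence bK: "b \<in> ?K" using AK[OF s(1)] QK[OF Q.m_inv_closed[OF x(1)]] by auto
    have "carrier G \<subseteq> ?K" using cover K.m_closed[OF _ bK] by blast
    thus ?thesis using False Kc by auto
  qed
qed

end

theorem theorem1p1:
  fixes G :: "('a, 'b) monoid_scheme" and A B :: "'a set"
  assumes "group G" and "subgroup A G" and "subgroup B G"
    and "carrier G = A <#>\<^bsub>G\<^esub> B"
    and "comm_group (G\<lparr>carrier := A\<rparr>) \<or> (\<exists>Y. quasicyclic_index_two Y (G\<lparr>carrier := A\<rparr>))"
    and "comm_group (G\<lparr>carrier := B\<rparr>) \<or> (\<exists>Y. quasicyclic_index_two Y (G\<lparr>carrier := B\<rparr>))"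
  shows "solvable G \<and> derived_length G \<le> 3 \<and>
    (\<forall>Q. \<not> comm_group (G\<lparr>carrier := B\<rparr>) \<and> quasicyclic_index_two Q (G\<lparr>carrier := B\<rparr>) \<longrightarrow>
       A <#>\<^bsub>G\<^esub> Q = Q <#>\<^bsub>G\<^esub> A \<and>
       subgroup (A <#>\<^bsub>G\<^esub> Q) G \<and>
       metabelian (G\<lparr>carrier := A <#>\<^bsub>G\<^esub> Q\<rparr>) \<and>
       (if A \<inter> B \<subseteq> Q then subgroup_index G (A <#>\<^bsub>G\<^esub> Q) = 2
        else A <#>\<^bsub>G\<^esub> Q = carrier G))"
proof -
  obtain \<phi> where "cayley G \<phi>" using cayley_exists[OF assms(1)] .
  then interpret cayley G \<phi> .
  interpret A: subgroup A G by fact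
  interpret B: subgroup B G by fact
  have "solvable G \<and> derived_length G \<le> 3"
  proof (cases "comm_group (G\<lparr>carrier := B\<rparr>)")
    case False
    then obtain Q where "quasicyclic_index_two Q (G\<lparr>carrier := B\<rparr>)" using assms(6) by blast
    thus ?thesis using nonabelian_factor_structure(5,6)[OF assms(2-5) False] by blast
  next
    case cB: True
    show ?thesis
    proof (cases "comm_group (G\<lparr>carrier := A\<rparr>)")
      case False
      then obtain Q where Q: "quasicyclic_index_two Q (G\<lparr>carrier := A\<rparr>)" using assms(5) by blast
      have "carrier G = B <#>\<^bsub>G\<^esub> A"
      proof
        show "carrier G \<subseteq> B <#>\<^bsub>G\<^esub> A"
        proof
          fix g assume g: "g \<in> carrier G"
          hence "inv\<^bsub>G\<^esub> g \<in> A <#>\<^bsub>G\<^esub> B" unfolding assms(4)[symmetric] by simp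
          then obtain a b where ab: "a \<in> A" "b \<in> B" "inv\<^bsub>G\<^esub> g = a \<otimes>\<^bsub>G\<^esub> b" by (auto simp: set_mult_def)
          have "g = inv\<^bsub>G\<^esub> (a \<otimes>\<^bsub>G\<^esub> b)" using ab(3) g by (metis inv_inv)
          also have "\<dots> = inv\<^bsub>G\<^esub> b \<otimes>\<^bsub>G\<^esub> inv\<^bsub>G\<^esub> a" using ab by (simp add: inv_mult_group)
          finally show "g \<in> B <#>\<^bsub>G\<^esub> A" using A.m_inv_closed[OF ab(1)] B.m_inv_closed[OF ab(2)] unfolding set_mult_def by blast
        qed
        show "B <#>\<^bsub>G\<^esub> A \<subseteq> carrier G" by (rule set_mult_closed[OF B.subset A.subset])
      qed
      thus ?thesis using nonabelian_factor_structure(5,6)[OF assms(3,2) _ _ False Q] cB by blast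
    next
      case cA: True
      have G: "subgroup (carrier G) G" by (rule subgroup_self)
      interpret I: abelian_product "\<phi> ` A" "\<phi> ` B" "\<phi> ` carrier G"
      proof
        show "subgrp (\<phi> ` A)" "subgrp (\<phi> ` B)" "subgrp (\<phi> ` carrier G)"
          using subgrp_iff assms(2,3) G A.subset B.subset by auto
        show "commuting (\<phi> ` A)" "commuting (\<phi> ` B)" using commuting_iff assms(2,3) cA cB by auto
        show "\<phi> ` carrier G = \<phi> ` A * \<phi> ` B" using phi_product[OF A.subset B.subset] assms(4) by simp
      qed
      have "derived G (derived G (carrier G)) = {\<one>\<^bsub>G\<^esub>}" by (rule metabelian_transfer(2)[OF G I.ito])
      thus ?thesis using solvable_from_metabelian[OF G derived_in_carrier] by blast
    qed
  qed
  thus ?thesis using nonabelian_factor_structure(1-4)[OF assms(2-5)] by blast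
qed

end
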